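(* Let $1<p<2$ and let $\beta$ be large enough. For any constants $k\in\mathbb Z_{\ge1}$ and $\epsilon>0$ there exists a constant $h_0$ such that for all integers $h\ge h_0$ the following holds. Let $A\subset\mathbb Z^2$ have $k$ vertices. Then $$\exp\big(-\beta(\mathscr E^{(p)}(\phi^*_A)+\epsilon)h^p\big)\le\hat\pi^{(p)}_\infty(\phi_x=h\ \ \forall x\in A)\le\exp\big(-\beta(\mathscr E^{(p)}(\phi^*_A)-\epsilon)h^p\big).$$ The same statement holds for $\hat\pi^{(p)}_\infty(\phi_x\ge h\ \ \forall x\in A)$.
   Context: $\hat\pi^{(p)}_\infty$ is the infinite-volume weak limit, as $M\to\infty$, of the measures on $\phi:V\to\mathbb Z$, $V=\{-M,\dots,M\}^2$, with probabilities proportional to $\exp(-\beta\sum_{x\sim y}|\phi_x-\phi_y|^p)$ (sum over nearest-neighbor pairs of $\mathbb Z^2$ with at least one endpoint in $V$, and $\phi=0$ off $V$); it exists for large $\beta$. For $f:\mathbb Z^2\to\mathbb R$, $\mathscr E^{(p)}(f)=\sum_{x\sim y}|f_x-f_y|^p$ (sum over edges of $\mathbb Z^2$). The $p$-capacity of a finite set $A$ is $\mathrm{Cap}_p(A)=\inf\{\mathscr E^{(p)}(f): f\to0\text{ at }\infty,\ f\ge1\text{ on }A\}$. For $1<p<2$ there is a unique $p$-harmonic function $\phi^*_A$ with boundary conditions $1$ on $A$ and $0$ at infinity, and $\mathscr E^{(p)}(\phi^*_A)=\mathrm{Cap}_p(A)$. *)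

theory Defs
  imports "HOL-Probability.Probability"
begin

type_synonym vertex = "int \<times> int"

definition nearest_nbr :: "vertex \<Rightarrow> vertex \<Rightarrow> bool" where
  "nearest_nbr x y \<longleftrightarrow> \<bar>fst x - fst y\<bar> + \<bar>snd x - snd y\<bar> = 1"

text \<open>Each undirected edge is represented once, oriented to the right or upwards.\<close>

definition edges :: "(vertex \<times> vertex) set" where
  "edges = {(x, y). nearest_nbr x y \<and> fst x \<le> fst y \<and> snd x \<le> snd y}"

definition energy :: "real \<Rightarrow> (vertex \<Rightarrow> real) \<Rightarrow> ennreal" where
  "energy p f = (\<Sum>\<^sub>\<infinity>(x, y)\<in>edges. ennreal (\<bar>f x - f y\<bar> powr p))"

text \<open>The term for \<open>y\<close> is $|f_y - f_x|^{p-2}(f_y - f_x)$, read as $0$ when $f_y = f_x$.\<close>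

definition p_harmonic_at :: "real \<Rightarrow> (vertex \<Rightarrow> real) \<Rightarrow> vertex \<Rightarrow> bool" where
  "p_harmonic_at p f x \<longleftrightarrow>
     (\<Sum>y | nearest_nbr x y. sgn (f y - f x) * \<bar>f y - f x\<bar> powr (p - 1)) = 0"

text \<open>Convergence along \<open>cofinite\<close> is convergence at infinity on the lattice.\<close>

definition is_p_potential :: "real \<Rightarrow> vertex set \<Rightarrow> (vertex \<Rightarrow> real) \<Rightarrow> bool" where
  "is_p_potential p A f \<longleftrightarrow>
     (\<forall>x\<in>A. f x = 1) \<and> (\<forall>x. x \<notin> A \<longrightarrow> p_harmonic_at p f x) \<and> (f \<longlongrightarrow> 0) cofinite"

text \<open>For $1 < p < 2$ and finite nonempty \<open>A\<close> this function exists and is unique, and its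
  energy is finite (it is the \<open>p\<close>-capacity of \<open>A\<close>).\<close>

definition p_potential :: "real \<Rightarrow> vertex set \<Rightarrow> vertex \<Rightarrow> real" where
  "p_potential p A = (THE f. is_p_potential p A f)"

definition box :: "nat \<Rightarrow> vertex set" where
  "box M = {- int M..int M} \<times> {- int M..int M}"

text \<open>Configurations on the box are identified with their extensions by zero, so that all
  finite-volume measures live on the same space.\<close>

definition configs :: "nat \<Rightarrow> (vertex \<Rightarrow> int) set" where
  "configs M = {\<phi>. \<forall>x. x \<notin> box M \<longrightarrow> \<phi> x = 0}"

definition hamiltonian :: "real \<Rightarrow> nat \<Rightarrow> (vertex \<Rightarrow> int) \<Rightarrow> real" where
  "hamiltonian p M \<phi> =
     (\<Sum>(x, y) | (x, y) \<in> edges \<and> (x \<in> box M \<or> y \<in> box M). \<bar>real_of_int (\<phi> x - \<phi> y)\<bar> powr p)"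

definition partition_function :: "real \<Rightarrow> real \<Rightarrow> nat \<Rightarrow> real" where
  "partition_function p \<beta> M = (\<Sum>\<^sub>\<infinity>\<phi>\<in>configs M. exp (- \<beta> * hamiltonian p M \<phi>))"

definition finite_volume :: "real \<Rightarrow> real \<Rightarrow> nat \<Rightarrow> (vertex \<Rightarrow> int) measure" where
  "finite_volume p \<beta> M =
     distr (point_measure (configs M)
              (\<lambda>\<phi>. ennreal (exp (- \<beta> * hamiltonian p M \<phi>) / partition_function p \<beta> M)))
           borel (\<lambda>\<phi>. \<phi>)"

definition weak_limit :: "(nat \<Rightarrow> 'a::topological_space measure) \<Rightarrow> 'a measure \<Rightarrow> bool" where
  "weak_limit N \<mu> \<longleftrightarrow>
     (\<forall>f :: 'a \<Rightarrow> real. continuous_on UNIV f \<and> bounded (range f) \<longrightarrow>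
        (\<lambda>n. integral\<^sup>L (N n) f) \<longlonglongrightarrow> integral\<^sup>L \<mu> f)"

text \<open>The topology on configurations is the product of the discrete topologies on \<open>int\<close>.\<close>

definition is_infinite_volume :: "real \<Rightarrow> real \<Rightarrow> (vertex \<Rightarrow> int) measure \<Rightarrow> bool" where
  "is_infinite_volume p \<beta> \<mu> \<longleftrightarrow>
     prob_space \<mu> \<and> sets \<mu> = sets borel \<and> weak_limit (finite_volume p \<beta>) \<mu>"

end

theory Submission
  imports Defs
begin

text \<open>
  A \<open>p\<close>-harmonic profile is optimal: lifting the heights to \<open>h\<close> on \<open>A\<close> costs energy at least
  \<open>E h\<^sup>p\<close>, where \<open>E\<close> is the \<open>p\<close>-capacity of \<open>A\<close>, and rounding \<open>h\<close> times the potential almost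
  achieves this cost. The point of the proof is that entropy contributes only \<open>exp (o (h\<^sup>p))\<close>, with
  bounds that are uniform in the box and in the position of \<open>A\<close>.

  Capacity. For \<open>p < 2\<close> the lattice satisfies a Sobolev inequality (\<open>sobolev_inequality\<close>), so a set
  of \<open>n\<close> points has capacity at least a constant times \<open>n\<close> to the power \<open>(2 - p) / 2\<close>. Therefore
  the superlevel sets of functions of bounded energy have bounded size, a minimising sequence for the
  capacity has a limit that vanishes at infinity (\<open>capacity_attained\<close>), and near-optimal profiles
  can be cut off to a support whose size depends only on the cardinality of \<open>A\<close>
  (\<open>near_optimal_profile\<close>). By the maximum principle the minimiser is the potential.

  Upper bound. Consider the outermost level contours around the points of \<open>A\<close> at several levels,
  with holes filled in, and let \<open>\<psi>\<close> be the sum of the indicators of their interiors. Along each edge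
  \<open>\<psi>\<close> and \<open>\<phi> - \<psi>\<close> have slopes of the same sign, so that the energy of \<open>\<phi>\<close> is at least the sum of
  the energies of \<open>\<psi>\<close> and \<open>\<phi> - \<psi>\<close> (\<open>hamiltonian_peel\<close>), and the map from \<open>\<phi>\<close> to \<open>\<phi> - \<psi>\<close> is
  injective for given \<open>\<psi>\<close>. So the probability is at most the sum of \<open>exp (- \<beta> H \<psi>)\<close> over the
  possible \<open>\<psi>\<close>. The fluctuations inside the contours are left untouched, and only contours have to
  be counted. This is done twice. If some cluster at the level \<open>\<eta> h\<close> has more than \<open>n\<close> sites, then
  \<open>\<psi>\<close> has energy at least a multiple of \<open>(\<eta> h)\<^sup>p\<close> that grows with \<open>n\<close>; half of it suffices, and
  the other half makes the sum over contours converge for large \<open>\<beta>\<close> by a Peierls estimate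
  (\<open>large_cluster_unlikely\<close>). Otherwise the levels above \<open>\<eta> h\<close> have only boundedly many contours
  each, hence \<open>exp (O (h))\<close> choices in total, and each choice has energy at least
  \<open>E ((1 - \<eta>) h)\<^sup>p\<close> (\<open>small_clusters_bound\<close>). Since \<open>p > 1\<close>, the entropy is negligible.

  Lower bound. The heights vanish around a given set of bounded size with probability bounded below
  (\<open>vanishing_probability\<close>, which uses the tail bound that the crude estimate gives for a single
  site), and there the rounded near-optimal profile can be added
  (\<open>finite_volume_lower_bound\<close>).

  All bounds hold uniformly for large boxes, and the events are clopen cylinders, so the bounds pass
  to the weak limit.
\<close>

section \<open>Edges and energies of finitely supported functions\<close>

definition east :: "vertex \<Rightarrow> vertex" where "east v = (fst v + 1, snd v)"
definition north :: "vertex \<Rightarrow> vertex" where "north v = (fst v, snd v + 1)"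

lemma mem_edges_iff: "(x, y) \<in> edges \<longleftrightarrow> y = east x \<or> y = north x"
  by (cases x; cases y) (auto simp: edges_def nearest_nbr_def east_def north_def)

lemma nearest_nbr_iff_edge: "nearest_nbr x y \<longleftrightarrow> (x, y) \<in> edges \<or> (y, x) \<in> edges"
  by (cases x; cases y) (auto simp: edges_def nearest_nbr_def)

lemma nearest_nbr_sym: "nearest_nbr x y \<Longrightarrow> nearest_nbr y x"
  by (auto simp: nearest_nbr_iff_edge)

lemma edge_ends_distinct: "e \<in> edges \<Longrightarrow> fst e \<noteq> snd e"
  by (cases e) (auto simp: mem_edges_iff east_def north_def prod_eq_iff)

definition incident :: "vertex set \<Rightarrow> (vertex \<times> vertex) set" where
  "incident B = {e \<in> edges. fst e \<in> B \<or> snd e \<in> B}"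

lemma incident_single:
  "incident {(a, b)} =
     {((a, b), (a + 1, b)), ((a, b), (a, b + 1)), ((a - 1, b), (a, b)), ((a, b - 1), (a, b))}"
  unfolding incident_def by (auto simp: mem_edges_iff east_def north_def)

lemma finite_incident_single: "finite (incident {v})"
  by (cases v) (simp add: incident_single)

lemma card_incident_single: "card (incident {v}) \<le> 4"
proof (cases v)
  case (Pair a b)
  have "card (set [((a, b), (a + 1, b)), ((a, b), (a, b + 1)), ((a - 1, b), (a, b)),
      ((a, b - 1), (a, b))]) \<le> length [((a, b), (a + 1, b)), ((a, b), (a, b + 1)),
      ((a - 1, b), (a, b)), ((a, b - 1), (a, b))]"
    by (rule card_length)
  then show ?thesis by (simp add: Pair incident_single)
qed

lemma incident_UN: "incident B = (\<Union>v\<in>B. incident {v})"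
  by (auto simp: incident_def)

lemma finite_incident: "finite B \<Longrightarrow> finite (incident B)"
  by (subst incident_UN) (simp add: finite_incident_single)

lemma card_incident_le:
  assumes "finite B" shows "card (incident B) \<le> 4 * card B"
proof -
  have "card (incident B) \<le> (\<Sum>v\<in>B. card (incident {v}))"
    by (subst incident_UN) (rule card_UN_le[OF assms])
  also have "\<dots> \<le> (\<Sum>v\<in>B. 4)"
    by (rule sum_mono) (rule card_incident_single)
  finally show ?thesis by simp
qed

lemma incident_mono: "B \<subseteq> C \<Longrightarrow> incident B \<subseteq> incident C"
  by (auto simp: incident_def)

lemma incident_subset_edges: "incident B \<subseteq> edges"
  by (auto simp: incident_def)

lemma sum_incident_le:
  fixes G :: "vertex \<Rightarrow> real"
  assumes fin: "finite B" and zero: "\<And>v. v \<notin> B \<Longrightarrow> G v = 0" and nonneg: "\<And>v. 0 \<le> G v"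
  shows "(\<Sum>e\<in>incident B. G (fst e) + G (snd e)) \<le> 4 * (\<Sum>v\<in>B. G v)"
proof -
  have "(\<Sum>e\<in>incident B. G (fst e) + G (snd e))
      = (\<Sum>e\<in>incident B. \<Sum>v\<in>B. if e \<in> incident {v} then G v else 0)"
  proof (rule sum.cong[OF refl])
    fix e assume e: "e \<in> incident B"
    then have ne: "fst e \<noteq> snd e" and ed: "e \<in> edges"
      using edge_ends_distinct by (auto simp: incident_def)
    have "(\<Sum>v\<in>B. if e \<in> incident {v} then G v else 0)
        = (\<Sum>v\<in>B. (if v = fst e then G v else 0) + (if v = snd e then G v else 0))"
      by (rule sum.cong) (use ne ed in \<open>auto simp: incident_def\<close>)
    also have "\<dots> = G (fst e) + G (snd e)"
      using fin zero by (simp add: sum.distrib sum.delta')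
    finally show "G (fst e) + G (snd e) = (\<Sum>v\<in>B. if e \<in> incident {v} then G v else 0)" ..
  qed
  also have "\<dots> = (\<Sum>v\<in>B. \<Sum>e\<in>incident B. if e \<in> incident {v} then G v else 0)"
    by (rule sum.swap)
  also have "\<dots> \<le> (\<Sum>v\<in>B. 4 * G v)"
  proof (rule sum_mono)
    fix v assume "v \<in> B"
    then have sub: "incident B \<inter> incident {v} = incident {v}" by (auto simp: incident_def)
    have "(\<Sum>e\<in>incident B. if e \<in> incident {v} then G v else 0) = card (incident {v}) * G v"
      using finite_incident[OF fin] by (simp add: sum.inter_restrict[symmetric] sub)
    also have "\<dots> \<le> 4 * G v"
      by (rule mult_right_mono) (use card_incident_single[of v] nonneg in auto)
    finally show "(\<Sum>e\<in>incident B. if e \<in> incident {v} then G v else 0) \<le> 4 * G v" .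
  qed
  finally show ?thesis by (simp add: sum_distrib_left)
qed

definition fenergy :: "real \<Rightarrow> (vertex \<times> vertex) set \<Rightarrow> (vertex \<Rightarrow> real) \<Rightarrow> real" where
  "fenergy p F f = (\<Sum>e\<in>F. \<bar>f (fst e) - f (snd e)\<bar> powr p)"

lemma fenergy_nonneg: "0 \<le> fenergy p F f"
  unfolding fenergy_def by (rule sum_nonneg) simp

lemma hamiltonian_eq_fenergy:
  "hamiltonian p M \<phi> = fenergy p (incident (box M)) (\<lambda>x. real_of_int (\<phi> x))"
proof -
  have "{(x, y). (x, y) \<in> edges \<and> (x \<in> box M \<or> y \<in> box M)} = incident (box M)"
    by (auto simp: incident_def)
  then show ?thesis
    by (simp add: hamiltonian_def fenergy_def case_prod_unfold)
qed

lemma fenergy_le_energy: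
  assumes "finite F" "F \<subseteq> edges"
  shows "ennreal (fenergy p F f) \<le> energy p f"
proof -
  have "ennreal (fenergy p F f) = (\<Sum>\<^sub>\<infinity>e\<in>F. ennreal (\<bar>f (fst e) - f (snd e)\<bar> powr p))"
    using assms by (simp add: fenergy_def sum_ennreal)
  also have "\<dots> \<le> energy p f"
    unfolding energy_def case_prod_unfold
    by (rule infsum_mono_neutral) (use assms in \<open>auto intro: nonneg_summable_on_complete\<close>)
  finally show ?thesis .
qed

lemma energy_le_if_fenergy_le:
  assumes "\<And>F. finite F \<Longrightarrow> F \<subseteq> edges \<Longrightarrow> ennreal (fenergy p F f) \<le> c"
  shows "energy p f \<le> c"
  unfolding energy_def case_prod_unfold
proof (subst nonneg_infsum_complete)
  show "(SUP F\<in>{F. finite F \<and> F \<subseteq> edges}. \<Sum>e\<in>F. ennreal (\<bar>f (fst e) - f (snd e)\<bar> powr p)) \<le> c"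
    using assms by (intro SUP_least) (simp add: fenergy_def sum_ennreal)
qed auto

lemma energy_finite_support:
  assumes "finite B" and zero: "\<And>v. v \<notin> B \<Longrightarrow> f v = 0"
  shows "energy p f = ennreal (fenergy p (incident B) f)"
proof (rule antisym)
  show "energy p f \<le> ennreal (fenergy p (incident B) f)"
  proof (rule energy_le_if_fenergy_le, rule ennreal_leI)
    fix F assume F: "finite F" "F \<subseteq> edges"
    have "\<bar>f (fst e) - f (snd e)\<bar> powr p = 0" if "e \<in> F" "e \<notin> incident B" for e
      using that F zero[of "fst e"] zero[of "snd e"] by (auto simp: incident_def)
    then have "fenergy p F f = (\<Sum>e\<in>F \<inter> incident B. \<bar>f (fst e) - f (snd e)\<bar> powr p)"
      unfolding fenergy_def
      by (intro sum.mono_neutral_right) (use F in auto)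
    also have "\<dots> \<le> fenergy p (incident B) f"
      unfolding fenergy_def
      by (rule sum_mono2) (use finite_incident[OF assms(1)] in auto)
    finally show "fenergy p F f \<le> fenergy p (incident B) f" .
  qed
  show "ennreal (fenergy p (incident B) f) \<le> energy p f"
    by (rule fenergy_le_energy) (use finite_incident[OF assms(1)] incident_subset_edges in auto)
qed

lemma finite_box: "finite (box M)"
  by (simp add: box_def)

lemma box_mono: "M \<le> N \<Longrightarrow> box M \<subseteq> box N"
  by (auto simp: box_def)

lemma finite_subset_box:
  assumes "finite S" shows "\<exists>M. S \<subseteq> box M"
  using assms
proof induction
  case (insert v S)
  then obtain M where M: "S \<subseteq> box M" by blast
  obtain a b where v: "v = (a, b)" by (cases v)
  define N where "N = max M (nat (max \<bar>a\<bar> \<bar>b\<bar>))"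
  have "v \<in> box N" by (auto simp: v box_def N_def)
  moreover have "box M \<subseteq> box N" by (rule box_mono) (simp add: N_def)
  ultimately show ?case using M by blast
qed simp

section \<open>A Sobolev inequality\<close>

lemma telescope_bound:
  fixes u :: "int \<Rightarrow> real"
  assumes "u l = 0" "l \<le> a" "a \<le> r + 1"
  shows "\<bar>u a\<bar> \<le> (\<Sum>i\<in>{l..r}. \<bar>u i - u (i + 1)\<bar>)"
proof -
  have "\<bar>u a\<bar> \<le> (\<Sum>i\<in>{l..a - 1}. \<bar>u i - u (i + 1)\<bar>)"
    using \<open>l \<le> a\<close>
  proof (induction a rule: int_ge_induct)
    case base
    then show ?case using assms by simp
  next
    case (step a)
    have "{l..a + 1 - 1} = insert a {l..a - 1}" using step by auto
    then show ?case using step by auto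
  qed
  also have "(\<Sum>i\<in>{l..a - 1}. \<bar>u i - u (i + 1)\<bar>) \<le> (\<Sum>i\<in>{l..r}. \<bar>u i - u (i + 1)\<bar>)"
    by (rule sum_mono2) (use assms in auto)
  finally show ?thesis .
qed

text \<open>The case of exponent one. A finitely supported function is bounded at each point both by its
  variation along the row and by its variation along the column of that point; the product of
  these two bounds sums to a product of two total variations.\<close>

lemma sum_squares_le_variation:
  fixes g :: "vertex \<Rightarrow> real"
  assumes zero: "\<And>v. v \<notin> box M \<Longrightarrow> g v = 0"
  shows "(\<Sum>v\<in>box M. (g v)\<^sup>2) \<le> (\<Sum>e\<in>incident (box M). \<bar>g (fst e) - g (snd e)\<bar>)\<^sup>2"
proof -
  define I where "I = {- int M - 1..int M}"
  define J where "J = {- int M..int M}"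
  define T where "T = (\<Sum>e\<in>incident (box M). \<bar>g (fst e) - g (snd e)\<bar>)"
  define R where "R b = (\<Sum>i\<in>I. \<bar>g (i, b) - g (i + 1, b)\<bar>)" for b
  define C where "C a = (\<Sum>i\<in>I. \<bar>g (a, i) - g (a, i + 1)\<bar>)" for a
  have boxJ: "box M = J \<times> J" by (simp add: box_def J_def)
  have gR: "\<bar>g (a, b)\<bar> \<le> R b" and gC: "\<bar>g (a, b)\<bar> \<le> C a" if "a \<in> J" "b \<in> J" for a b
  proof -
    have "g (- int M - 1, b) = 0" "g (a, - int M - 1) = 0"
      by (rule zero; simp add: box_def)+
    then show "\<bar>g (a, b)\<bar> \<le> R b" "\<bar>g (a, b)\<bar> \<le> C a"
      using telescope_bound[of "\<lambda>i. g (i, b)" "- int M - 1" a "int M"]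
        telescope_bound[of "\<lambda>i. g (a, i)" "- int M - 1" b "int M"] that
      by (auto simp: R_def C_def I_def J_def)
  qed
  have R0: "0 \<le> R b" and C0: "0 \<le> C b" for b
    by (auto simp: R_def C_def sum_nonneg)
  have RT: "(\<Sum>b\<in>J. R b) \<le> T"
  proof -
    have "(\<Sum>b\<in>J. R b) = (\<Sum>(b, i)\<in>J \<times> I. \<bar>g (i, b) - g (i + 1, b)\<bar>)"
      by (simp add: R_def sum.cartesian_product)
    also have "\<dots> = (\<Sum>e\<in>(\<lambda>(b, i). ((i, b), (i + 1, b))) ` (J \<times> I). \<bar>g (fst e) - g (snd e)\<bar>)"
      by (subst sum.reindex) (auto simp: inj_on_def case_prod_unfold)
    also have "\<dots> \<le> T"
      unfolding T_def
      by (rule sum_mono2[OF finite_incident[OF finite_box]])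
        (auto simp: incident_def mem_edges_iff east_def north_def box_def I_def J_def)
    finally show ?thesis .
  qed
  have CT: "(\<Sum>a\<in>J. C a) \<le> T"
  proof -
    have "(\<Sum>a\<in>J. C a) = (\<Sum>(a, i)\<in>J \<times> I. \<bar>g (a, i) - g (a, i + 1)\<bar>)"
      by (simp add: C_def sum.cartesian_product)
    also have "\<dots> = (\<Sum>e\<in>(\<lambda>(a, i). ((a, i), (a, i + 1))) ` (J \<times> I). \<bar>g (fst e) - g (snd e)\<bar>)"
      by (subst sum.reindex) (auto simp: inj_on_def case_prod_unfold)
    also have "\<dots> \<le> T"
      unfolding T_def
      by (rule sum_mono2[OF finite_incident[OF finite_box]])
        (auto simp: incident_def mem_edges_iff east_def north_def box_def I_def J_def)
    finally show ?thesis .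
  qed
  have "(\<Sum>v\<in>box M. (g v)\<^sup>2) = (\<Sum>a\<in>J. \<Sum>b\<in>J. (g (a, b))\<^sup>2)"
    by (simp add: boxJ sum.cartesian_product)
  also have "\<dots> \<le> (\<Sum>a\<in>J. \<Sum>b\<in>J. C a * R b)"
  proof (intro sum_mono)
    fix a b assume "a \<in> J" "b \<in> J"
    then have "\<bar>g (a, b)\<bar> * \<bar>g (a, b)\<bar> \<le> C a * R b"
      by (intro mult_mono gR gC C0) auto
    then show "(g (a, b))\<^sup>2 \<le> C a * R b" by (simp add: power2_eq_square)
  qed
  also have "\<dots> = (\<Sum>a\<in>J. C a) * (\<Sum>b\<in>J. R b)"
    by (simp add: sum_product)
  also have "\<dots> \<le> T * T"
    using RT CT by (intro mult_mono sum_nonneg R0 C0) (auto simp: T_def sum_nonneg)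
  finally show ?thesis by (simp add: T_def power2_eq_square)
qed

lemma powr_diff_bound:
  fixes a b :: real
  assumes "0 \<le> a" "0 \<le> b" "1 \<le> q"
  shows "\<bar>a powr q - b powr q\<bar> \<le> q * (a powr (q - 1) + b powr (q - 1)) * \<bar>a - b\<bar>"
proof -
  have main: "a powr q - b powr q \<le> q * (a powr (q - 1) + b powr (q - 1)) * (a - b)"
    if "0 \<le> b" "b < a" for a b :: real
  proof -
    have cont: "continuous_on {b..a} (\<lambda>x. x powr q)"
      by (intro continuous_on_powr') (use assms that in \<open>auto intro!: continuous_intros\<close>)
    have deriv: "((\<lambda>x. x powr q) has_real_derivative q * x powr (q - 1)) (at x)"
      if "b < x" "x < a" for x
      using has_real_derivative_powr[of x q] \<open>0 \<le> b\<close> that by simp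
    obtain z where z: "b < z" "z < a" "a powr q - b powr q = (a - b) * (q * z powr (q - 1))"
      using MVT[OF \<open>b < a\<close> cont] deriv DERIV_unique real_differentiable_def by metis
    have "z powr (q - 1) \<le> a powr (q - 1)"
      by (rule powr_mono2) (use z that assms in auto)
    also have "\<dots> \<le> a powr (q - 1) + b powr (q - 1)" by simp
    finally have "(a - b) * (q * z powr (q - 1)) \<le> (a - b) * (q * (a powr (q - 1) + b powr (q - 1)))"
      using that assms by (intro mult_left_mono) auto
    then show ?thesis using z by (simp add: mult_ac)
  qed
  have "a powr q \<ge> b powr q" if "b < a" by (rule powr_mono2) (use assms that in auto)
  moreover have "b powr q \<ge> a powr q" if "a < b" by (rule powr_mono2) (use assms that in auto)
  ultimately show ?thesis
    using main[of b a] main[of a b] assms by (cases a b rule: linorder_cases) (auto simp: add_ac)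
qed

text \<open>Young's inequality with a free weight, which is optimised later.\<close>

lemma weighted_Young:
  fixes s t w p :: real
  assumes "1 < p" "0 \<le> s" "0 \<le> t" "0 < w"
  shows "s * t \<le> w * s powr (p / (p - 1)) + w powr (1 - p) * t powr p"
proof -
  define r where "r = p / (p - 1)"
  have r: "1 < r" "1 / r + 1 / p = 1" "r \<noteq> 0"
    using assms by (auto simp: r_def field_simps)
  define s' where "s' = w powr (1 / r) * s"
  define t' where "t' = w powr (- 1 / r) * t"
  have "s * t = s' * t'"
    using assms by (simp add: s'_def t'_def powr_minus field_simps)
  also have "\<dots> \<le> s' powr r / r + t' powr p / p"
    by (rule Youngs_inequality) (use r assms in \<open>auto simp: s'_def t'_def\<close>)
  also have "\<dots> \<le> s' powr r + t' powr p"
    using r assms by (intro add_mono) (auto simp: divide_le_eq mult_le_cancel_left1)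
  also have "s' powr r = w * s powr r"
    using r assms by (simp add: s'_def powr_mult powr_powr)
  also have "t' powr p = w powr (1 - p) * t powr p"
  proof -
    have "- (p / r) = 1 - p" using assms by (simp add: r_def)
    then show ?thesis by (simp add: t'_def powr_mult powr_powr)
  qed
  finally show ?thesis by (simp add: r_def)
qed

definition sobolev_exponent :: "real \<Rightarrow> real" where
  "sobolev_exponent p = p / (2 - p)"

definition sobolev_const :: "real \<Rightarrow> real" where
  "sobolev_const p = 4 * sobolev_exponent p * (8 * sobolev_exponent p) powr (p - 1)"

lemma sobolev_const_pos: "1 < p \<Longrightarrow> p < 2 \<Longrightarrow> 0 < sobolev_const p"
  by (simp add: sobolev_const_def sobolev_exponent_def)

text \<open>The inequality for exponent one is applied to $f^q$ with $q = p/(2-p)$. The value of $q$ is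
  chosen so that, after Young's inequality, the power of $f$ on the right is again $2q$, and
  $p < 2$ makes the inequality for the sum of $f^{2q}$ solvable.\<close>

lemma sobolev_inequality:
  fixes f :: "vertex \<Rightarrow> real"
  assumes p: "1 < p" "p < 2" and nonneg: "\<And>v. 0 \<le> f v" and zero: "\<And>v. v \<notin> box M \<Longrightarrow> f v = 0"
  shows "(\<Sum>v\<in>box M. f v powr (2 * sobolev_exponent p)) powr ((2 - p) / 2)
           \<le> sobolev_const p * fenergy p (incident (box M)) f"
proof -
  define q where "q = sobolev_exponent p"
  define S where "S = (\<Sum>v\<in>box M. f v powr (2 * q))"
  define E where "E = fenergy p (incident (box M)) f"
  have q1: "q - 1 = 2 * (p - 1) / (2 - p)"
    using p by (simp add: q_def sobolev_exponent_def field_simps)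
  have "(q - 1) * (p / (p - 1)) = 2 * q"
    unfolding q1 using p by (simp add: q_def sobolev_exponent_def frac_eq_eq)
  moreover have "1 < q" using p by (simp add: q_def sobolev_exponent_def field_simps)
  ultimately have q: "1 < q" "(q - 1) * (p / (p - 1)) = 2 * q" by simp_all
  have S0: "0 \<le> S" unfolding S_def by (rule sum_nonneg) simp
  show ?thesis
  proof (cases "S = 0")
    case True
    then show ?thesis
      using fenergy_nonneg sobolev_const_pos[OF p] by (simp add: S_def q_def)
  next
    case False
    with S0 have Spos: "0 < S" by simp
    \<comment> \<open>the weight for which the term with \<open>S\<close> becomes half of the left-hand side\<close>
    define w where "w = 1 / (8 * q * sqrt S)"
    have lpos: "0 < w" using q Spos by (simp add: w_def)
    have "S = (\<Sum>v\<in>box M. (f v powr q)\<^sup>2)"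
      unfolding S_def by (rule sum.cong) (auto simp: power2_eq_square powr_add[symmetric])
    also have "\<dots> \<le> (\<Sum>e\<in>incident (box M). \<bar>f (fst e) powr q - f (snd e) powr q\<bar>)\<^sup>2"
      using sum_squares_le_variation[of M "\<lambda>v. f v powr q"] zero q by simp
    finally have "sqrt S \<le> (\<Sum>e\<in>incident (box M). \<bar>f (fst e) powr q - f (snd e) powr q\<bar>)"
      by (rule real_le_lsqrt[rotated -1]) (auto intro: sum_nonneg S0)
    also have "\<dots> \<le> (\<Sum>e\<in>incident (box M). q * (w * (f (fst e) powr (2 * q) + f (snd e) powr (2 * q))
        + 2 * w powr (1 - p) * \<bar>f (fst e) - f (snd e)\<bar> powr p))"
    proof (rule sum_mono)
      fix e :: "vertex \<times> vertex"
      define a where "a = f (fst e)"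
      define b where "b = f (snd e)"
      have ab: "0 \<le> a" "0 \<le> b" by (auto simp: a_def b_def nonneg)
      have Y: "x powr (q - 1) * \<bar>a - b\<bar> \<le> w * x powr (2 * q) + w powr (1 - p) * \<bar>a - b\<bar> powr p"
        for x :: real
        using weighted_Young[of p "x powr (q - 1)" "\<bar>a - b\<bar>" w] p lpos q(2)
        by (simp add: powr_powr)
      have "\<bar>a powr q - b powr q\<bar> \<le> q * (a powr (q - 1) + b powr (q - 1)) * \<bar>a - b\<bar>"
        by (rule powr_diff_bound) (use ab q in auto)
      also have "\<dots> = q * (a powr (q - 1) * \<bar>a - b\<bar> + b powr (q - 1) * \<bar>a - b\<bar>)"
        by (simp add: algebra_simps)
      also have "\<dots> \<le> q * (w * (a powr (2 * q) + b powr (2 * q)) + 2 * w powr (1 - p) * \<bar>a - b\<bar> powr p)"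
        using q Y[of a] Y[of b] by (intro mult_left_mono) (auto simp: algebra_simps)
      finally show "\<bar>f (fst e) powr q - f (snd e) powr q\<bar> \<le> q * (w * (f (fst e) powr (2 * q)
          + f (snd e) powr (2 * q)) + 2 * w powr (1 - p) * \<bar>f (fst e) - f (snd e)\<bar> powr p)"
        by (simp add: a_def b_def)
    qed
    also have "\<dots> = q * w * (\<Sum>e\<in>incident (box M). f (fst e) powr (2 * q) + f (snd e) powr (2 * q))
        + 2 * q * w powr (1 - p) * E"
      by (simp add: E_def fenergy_def sum_distrib_left sum.distrib[symmetric] algebra_simps)
    also have "\<dots> \<le> q * w * (4 * S) + 2 * q * w powr (1 - p) * E"
      unfolding S_def using q lpos zero
      by (intro add_right_mono mult_left_mono sum_incident_le finite_box) auto
    also have "q * w * (4 * S) = sqrt S / 2"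
    proof -
      have "S = sqrt S * sqrt S" using Spos by simp
      then show ?thesis using q Spos unfolding w_def by (simp add: field_simps)
    qed
    finally have half: "sqrt S \<le> 4 * q * w powr (1 - p) * E" by simp
    have "w powr (1 - p) = (8 * q) powr (p - 1) * S powr ((p - 1) / 2)"
    proof -
      have "w = (8 * q * sqrt S) powr (-1)" using q Spos by (simp add: w_def)
      then have "w powr (1 - p) = ((8 * q * sqrt S) powr (-1)) powr (1 - p)" by (simp only:)
      also have "\<dots> = (8 * q * sqrt S) powr (p - 1)" by (subst powr_powr) simp
      also have "sqrt S = S powr (1 / 2)" using S0 by (simp add: powr_half_sqrt)
      finally show ?thesis using q by (simp add: powr_mult powr_powr mult_ac)
    qed
    with half have "S powr (1 / 2) \<le> S powr ((p - 1) / 2) * (sobolev_const p * E)"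
      using S0 by (simp add: powr_half_sqrt sobolev_const_def q_def mult_ac)
    moreover have "S powr (1 / 2) = S powr ((p - 1) / 2) * S powr ((2 - p) / 2)"
      by (simp add: powr_add[symmetric] field_simps)
    ultimately have "S powr ((2 - p) / 2) \<le> sobolev_const p * E"
      using Spos by simp
    then show ?thesis by (simp add: S_def E_def q_def)
  qed
qed

text \<open>The form in which the inequality is used: a large set has large \<open>p\<close>-capacity.\<close>

lemma card_superlevel_bound:
  fixes f :: "vertex \<Rightarrow> real"
  assumes p: "1 < p" "p < 2" and nonneg: "\<And>v. 0 \<le> f v" and zero: "\<And>v. v \<notin> box M \<Longrightarrow> f v = 0"
    and C: "C \<subseteq> box M" "\<And>v. v \<in> C \<Longrightarrow> 1 \<le> f v"
  shows "real (card C) powr ((2 - p) / 2) \<le> sobolev_const p * fenergy p (incident (box M)) f"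
proof -
  have q: "0 < sobolev_exponent p" using p by (simp add: sobolev_exponent_def)
  have "real (card C) = (\<Sum>v\<in>C. 1)" by simp
  also have "\<dots> \<le> (\<Sum>v\<in>C. f v powr (2 * sobolev_exponent p))"
    by (rule sum_mono) (use C q in \<open>auto intro: ge_one_powr_ge_zero\<close>)
  also have "\<dots> \<le> (\<Sum>v\<in>box M. f v powr (2 * sobolev_exponent p))"
    by (rule sum_mono2) (use C finite_box in auto)
  finally have "real (card C) powr ((2 - p) / 2)
      \<le> (\<Sum>v\<in>box M. f v powr (2 * sobolev_exponent p)) powr ((2 - p) / 2)"
    by (intro powr_mono2) (use p in auto)
  also have "\<dots> \<le> sobolev_const p * fenergy p (incident (box M)) f"
    by (rule sobolev_inequality[OF p nonneg zero])
  finally show ?thesis .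
qed

section \<open>The potential of a finite set\<close>

lemma tendsto_zero_cofinite_iff:
  fixes f :: "vertex \<Rightarrow> real"
  shows "(f \<longlongrightarrow> 0) cofinite \<longleftrightarrow> (\<forall>d>0. finite {x. d \<le> \<bar>f x\<bar>})"
  by (simp add: tendsto_iff eventually_cofinite not_less)

lemma le_powr_if_powr_le:
  fixes x y p :: real
  assumes "p < 2" "0 \<le> x" "x powr ((2 - p) / 2) \<le> y"
  shows "x \<le> y powr (2 / (2 - p))"
proof -
  have e: "(2 - p) / 2 * (2 / (2 - p)) = 1" using assms(1) by simp
  have "x = (x powr ((2 - p) / 2)) powr (2 / (2 - p))"
    unfolding powr_powr e using assms(2) by simp
  also have "\<dots> \<le> y powr (2 / (2 - p))"
    by (rule powr_mono2) (use assms in auto)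
  finally show ?thesis .
qed

text \<open>Cutting a function below at \<open>d\<close> and rescaling makes its support finite and costs only a
  factor close to one in the energy.\<close>

definition truncate_at :: "real \<Rightarrow> (vertex \<Rightarrow> real) \<Rightarrow> vertex \<Rightarrow> real" where
  "truncate_at d f x = max 0 (min 1 (f x) - d) / (1 - d)"

lemma truncate_at_bounds:
  assumes "0 < d" "d < 1"
  shows "0 \<le> truncate_at d f x" "truncate_at d f x \<le> 1" "1 \<le> f x \<Longrightarrow> truncate_at d f x = 1"
    "f x \<le> d \<Longrightarrow> truncate_at d f x = 0"
  using assms by (auto simp: truncate_at_def)

lemma truncate_at_contraction:
  assumes "0 < d" "d < 1"
  shows "\<bar>truncate_at d f x - truncate_at d f y\<bar> \<le> \<bar>f x - f y\<bar> / (1 - d)"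
proof -
  have "\<bar>max 0 (min 1 (f x) - d) - max 0 (min 1 (f y) - d)\<bar> \<le> \<bar>f x - f y\<bar>" by linarith
  then have "\<bar>max 0 (min 1 (f x) - d) - max 0 (min 1 (f y) - d)\<bar> / (1 - d) \<le> \<bar>f x - f y\<bar> / (1 - d)"
    using assms by (intro divide_right_mono) auto
  then show ?thesis
    using assms by (simp add: truncate_at_def diff_divide_distrib[symmetric] abs_divide)
qed

lemma fenergy_truncate_le:
  assumes "0 < d" "d < 1" "0 < p"
  shows "fenergy p F (truncate_at d f) \<le> fenergy p F f / (1 - d) powr p"
proof -
  have "fenergy p F (truncate_at d f) \<le> (\<Sum>e\<in>F. (\<bar>f (fst e) - f (snd e)\<bar> / (1 - d)) powr p)"
    unfolding fenergy_def
    by (intro sum_mono powr_mono2 truncate_at_contraction) (use assms in auto)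
  then show ?thesis by (simp add: fenergy_def powr_divide sum_divide_distrib)
qed

lemma finite_support_truncate:
  assumes "0 < d" "d < 1" "(f \<longlongrightarrow> 0) cofinite"
  shows "finite {x. truncate_at d f x \<noteq> 0}"
proof (rule finite_subset)
  show "{x. truncate_at d f x \<noteq> 0} \<subseteq> {x. d \<le> \<bar>f x\<bar>}"
    using truncate_at_bounds(4)[OF assms(1,2)] by (smt (verit) mem_Collect_eq subsetI)
  show "finite {x. d \<le> \<bar>f x\<bar>}" using assms by (auto simp: tendsto_zero_cofinite_iff)
qed

text \<open>Truncation at \<open>d / 2\<close> makes the support finite and leaves values at least \<open>d / 2\<close> on \<open>C\<close>.\<close>

lemma card_superlevel_bound_at_infinity:
  fixes f :: "vertex \<Rightarrow> real"
  assumes p: "1 < p" "p < 2" and f0: "(f \<longlongrightarrow> 0) cofinite" and c: "energy p f \<le> ennreal c" "0 \<le> c"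
    and d: "0 < d" "d \<le> 1" and C: "\<And>x. x \<in> C \<Longrightarrow> d \<le> f x"
  shows "real (card C) powr ((2 - p) / 2) \<le> sobolev_const p * (c * (4 / d) powr p)"
proof -
  define g where "g x = truncate_at (d / 2) f x / (d / 2)" for x
  have d2: "0 < d / 2" "d / 2 < 1" using d by auto
  have "finite {x. g x \<noteq> 0}"
    using finite_support_truncate[OF d2 f0] d by (simp add: g_def)
  then obtain M where M: "{x. g x \<noteq> 0} \<subseteq> box M" using finite_subset_box by blast
  have g0: "0 \<le> g x" for x using truncate_at_bounds(1)[OF d2, of f x] d by (simp add: g_def)
  have gz: "g v = 0" if "v \<notin> box M" for v using M that by auto
  have gC: "1 \<le> g x" if "x \<in> C" for x
  proof -
    have "d / 2 \<le> max 0 (min 1 (f x) - d / 2)" using C[OF that] d by auto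
    also have "\<dots> \<le> truncate_at (d / 2) f x"
    proof -
      have *: "t \<le> t / (1 - d / 2)" if "0 \<le> t" for t
        using that d by (simp add: pos_le_divide_eq mult_left_le)
      show ?thesis unfolding truncate_at_def by (rule *) simp
    qed
    finally show ?thesis using d by (simp add: g_def)
  qed
  have "C \<subseteq> {x. g x \<noteq> 0}" using gC by force
  with M have CM: "C \<subseteq> box M" by auto
  have "ennreal (fenergy p (incident (box M)) f) \<le> ennreal c"
    using fenergy_le_energy[of "incident (box M)" p f] c finite_incident[OF finite_box]
      incident_subset_edges by (meson order_trans)
  then have fc: "fenergy p (incident (box M)) f \<le> c" using c by (simp add: ennreal_le_iff)
  have "real (card C) powr ((2 - p) / 2) \<le> sobolev_const p * fenergy p (incident (box M)) g"
    by (rule card_superlevel_bound[OF p g0 gz CM gC])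
  also have "fenergy p (incident (box M)) g
      = fenergy p (incident (box M)) (truncate_at (d / 2) f) / (d / 2) powr p"
  proof -
    have "\<bar>g x - g y\<bar> = \<bar>truncate_at (d / 2) f x - truncate_at (d / 2) f y\<bar> / (d / 2)" for x y
      using d unfolding g_def diff_divide_distrib[symmetric] abs_divide by simp
    then show ?thesis by (simp only: fenergy_def powr_divide sum_divide_distrib)
  qed
  also have "\<dots> \<le> (c / (1 / 2) powr p) / (d / 2) powr p"
  proof (rule divide_right_mono)
    have "fenergy p (incident (box M)) (truncate_at (d / 2) f)
        \<le> fenergy p (incident (box M)) f / (1 - d / 2) powr p"
      using d2 p by (intro fenergy_truncate_le) auto
    also have "\<dots> \<le> c / (1 / 2) powr p"
      by (rule frac_le) (use fc c d p in \<open>auto intro!: powr_mono2\<close>)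
    finally show "fenergy p (incident (box M)) (truncate_at (d / 2) f) \<le> c / (1 / 2) powr p" .
  qed simp
  also have "\<dots> = c * (4 / d) powr p"
  proof -
    have "(4 / d) powr p = (1 / ((1 / 2) * (d / 2))) powr p" by simp
    also have "\<dots> = 1 / ((1 / 2) powr p * (d / 2) powr p)"
      by (simp only: powr_divide powr_mult powr_one_eq_one)
    finally show ?thesis by (simp only: divide_divide_eq_left) (simp add: mult.commute)
  qed
  finally show ?thesis using sobolev_const_pos[OF p] by simp
qed

definition admissible :: "vertex set \<Rightarrow> (vertex \<Rightarrow> real) \<Rightarrow> bool" where
  "admissible A g \<longleftrightarrow> finite {x. g x \<noteq> 0} \<and> (\<forall>x. 0 \<le> g x \<and> g x \<le> 1) \<and> (\<forall>x\<in>A. g x = 1)"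

definition capacity :: "real \<Rightarrow> vertex set \<Rightarrow> ennreal" where
  "capacity p A = (INF g\<in>{g. admissible A g}. energy p g)"

lemma capacity_le_card:
  assumes "finite A" "0 < p"
  shows "capacity p A \<le> ennreal (4 * real (card A))"
proof -
  define g :: "vertex \<Rightarrow> real" where "g = indicator A"
  have "capacity p A \<le> energy p g"
    unfolding capacity_def
    by (rule INF_lower) (use assms in \<open>auto simp: admissible_def g_def indicator_def\<close>)
  also have "\<dots> = ennreal (fenergy p (incident A) g)"
    by (rule energy_finite_support) (use assms in \<open>auto simp: g_def\<close>)
  also have "\<dots> \<le> ennreal (4 * real (card A))"
  proof (rule ennreal_leI)
    have "fenergy p (incident A) g \<le> (\<Sum>e\<in>incident A. 1)"
      unfolding fenergy_def
      by (intro sum_mono powr_le1) (use assms in \<open>auto simp: g_def indicator_def\<close>)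
    also have "\<dots> \<le> 4 * real (card A)" using card_incident_le[OF assms(1)] by simp
    finally show "fenergy p (incident A) g \<le> 4 * real (card A)" .
  qed
  finally show ?thesis .
qed

lemma energy_truncate_le:
  assumes "0 < d" "d < 1" "0 < p" and c: "energy p f \<le> ennreal c" "0 \<le> c"
  shows "energy p (truncate_at d f) \<le> ennreal (c / (1 - d) powr p)"
proof (rule energy_le_if_fenergy_le, rule ennreal_leI)
  fix F assume F: "finite F" "F \<subseteq> edges"
  have "ennreal (fenergy p F f) \<le> ennreal c" using fenergy_le_energy[OF F, of p f] c order_trans by blast
  then have "fenergy p F f \<le> c" using c by (simp add: ennreal_le_iff)
  then have "fenergy p F f / (1 - d) powr p \<le> c / (1 - d) powr p"
    by (intro divide_right_mono) auto
  then show "fenergy p F (truncate_at d f) \<le> c / (1 - d) powr p"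
    using fenergy_truncate_le[OF assms(1-3), of F f] by simp
qed

lemma admissible_truncate:
  assumes "0 < d" "d < 1" "(f \<longlongrightarrow> 0) cofinite" "\<And>x. x \<in> A \<Longrightarrow> 1 \<le> f x"
  shows "admissible A (truncate_at d f)"
  unfolding admissible_def
  using finite_support_truncate[OF assms(1-3)] truncate_at_bounds[OF assms(1,2)] assms(4) by blast

text \<open>Functions that only vanish at infinity do no better than finitely supported ones, because
  truncation at \<open>d\<close> costs a factor that tends to one as \<open>d\<close> tends to zero.\<close>

lemma capacity_le_energy:
  fixes f :: "vertex \<Rightarrow> real"
  assumes p: "0 < p" and f0: "(f \<longlongrightarrow> 0) cofinite" and A: "\<And>x. x \<in> A \<Longrightarrow> 1 \<le> f x"
  shows "capacity p A \<le> energy p f"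
proof (cases "energy p f")
  case (real e)
  have le: "capacity p A \<le> ennreal (e / (1 - d) powr p)" if d: "0 < d" "d < 1" for d
  proof -
    have "capacity p A \<le> energy p (truncate_at d f)"
      unfolding capacity_def using admissible_truncate[OF d f0 A] by (intro INF_lower) auto
    also have "\<dots> \<le> ennreal (e / (1 - d) powr p)"
      by (rule energy_truncate_le) (use d p real in auto)
    finally show ?thesis .
  qed
  have "((\<lambda>d. e / (1 - d) powr p) \<longlongrightarrow> e / (1 - 0) powr p) (at_right 0)"
    by (intro tendsto_intros) auto
  then have lim: "((\<lambda>d. ennreal (e / (1 - d) powr p)) \<longlongrightarrow> ennreal e) (at_right 0)"
    by (intro tendsto_ennrealI) simp
  have "eventually (\<lambda>d::real. capacity p A \<le> ennreal (e / (1 - d) powr p)) (at_right 0)"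
    using eventually_at_right_real[OF zero_less_one] by (rule eventually_mono) (auto intro: le)
  then have "capacity p A \<le> ennreal e"
    by (rule tendsto_lowerbound[OF lim]) simp
  then show ?thesis using real by simp
qed simp

lemma pointwise_convergent_subsequence:
  fixes g :: "nat \<Rightarrow> vertex \<Rightarrow> real"
  assumes "\<And>n x. 0 \<le> g n x \<and> g n x \<le> 1"
  obtains f r where "strict_mono r" "\<And>x. (\<lambda>n. g (r n) x) \<longlonglongrightarrow> f x"
proof -
  define K where "K = PiE (UNIV :: vertex set) (\<lambda>_. {0..1::real})"
  have "compactin (product_topology (\<lambda>_. euclidean) UNIV) K"
    unfolding K_def by (subst compactin_PiE) auto
  then have "compact K" by (simp add: euclidean_product_topology)
  then have "seq_compact K" by (rule compact_imp_seq_compact)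
  moreover have "\<forall>n. g n \<in> K" using assms by (auto simp: K_def)
  ultimately obtain f r where r: "strict_mono r" and f: "(g \<circ> r) \<longlonglongrightarrow> f"
    by (rule seq_compactE)
  have "(\<lambda>n. g (r n) x) \<longlonglongrightarrow> f x" for x
    using continuous_on_tendsto_compose[OF continuous_on_product_coordinates[of x] f]
    by (simp add: o_def)
  then show thesis using r that by blast
qed

lemma fenergy_tendsto:
  assumes "0 < p" "\<And>x. (\<lambda>n. g n x) \<longlonglongrightarrow> f x"
  shows "(\<lambda>n. fenergy p F (g n)) \<longlonglongrightarrow> fenergy p F f"
  unfolding fenergy_def
  by (intro tendsto_sum tendsto_powr' tendsto_intros assms) (use assms in auto)

text \<open>A minimising sequence has a pointwise limit, whose energy does not exceed the infimum. The
  limit vanishes at infinity because the superlevel sets along the sequence have bounded size.\<close>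

lemma capacity_attained:
  assumes p: "1 < p" "p < 2" and A: "finite A"
  obtains f where "\<And>x. x \<in> A \<Longrightarrow> f x = 1" "(f \<longlongrightarrow> 0) cofinite" "energy p f = capacity p A"
proof -
  obtain c where c: "capacity p A = ennreal c" "0 \<le> c"
    using capacity_le_card[OF A, of p] p by (cases "capacity p A") (auto simp: top_unique)
  have "\<exists>g. admissible A g \<and> energy p g < ennreal (c + 1 / (real n + 1))" for n
  proof -
    have "capacity p A < ennreal (c + 1 / (real n + 1))" using c by (simp add: ennreal_less_iff)
    then show ?thesis unfolding capacity_def INF_less_iff by auto
  qed
  then obtain g where g: "\<And>n. admissible A (g n)" "\<And>n. energy p (g n) < ennreal (c + 1 / (real n + 1))"
    by metis
  have g01: "\<And>n x. 0 \<le> g n x \<and> g n x \<le> 1" using g by (auto simp: admissible_def)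
  then obtain f r where r: "strict_mono r" and lim: "\<And>x. (\<lambda>n. g (r n) x) \<longlonglongrightarrow> f x"
    using pointwise_convergent_subsequence by blast
  have fA: "f x = 1" if "x \<in> A" for x
  proof -
    have "(\<lambda>n. g (r n) x) = (\<lambda>n. 1)" using g that by (auto simp: admissible_def)
    then show ?thesis using lim[of x] by (simp add: LIMSEQ_const_iff)
  qed
  have f_nonneg: "0 \<le> f x" for x
    by (rule LIMSEQ_le_const[OF lim]) (use g01 in blast)
  have energy_le: "energy p f \<le> ennreal c"
  proof (rule energy_le_if_fenergy_le, rule ennreal_leI)
    fix F assume F: "finite F" "F \<subseteq> edges"
    have "fenergy p F (g n) \<le> c + 1 / (real n + 1)" for n
    proof -
      have "ennreal (fenergy p F (g n)) \<le> ennreal (c + 1 / (real n + 1))"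
        using fenergy_le_energy[OF F] g(2)[of n] by (meson less_imp_le order_trans)
      then show ?thesis using c by (subst (asm) ennreal_le_iff) auto
    qed
    moreover have "(\<lambda>n. c + 1 / (real n + 1)) \<longlonglongrightarrow> c + 0"
      by (intro tendsto_add tendsto_const) real_asymp
    then have "(\<lambda>n. c + 1 / (real (r n) + 1)) \<longlonglongrightarrow> c + 0"
      using LIMSEQ_subseq_LIMSEQ[OF _ r] by (force simp: o_def)
    moreover have "(\<lambda>n. fenergy p F (g (r n))) \<longlonglongrightarrow> fenergy p F f"
      by (rule fenergy_tendsto) (use p lim in auto)
    ultimately show "fenergy p F f \<le> c" using LIMSEQ_le by force
  qed
  have "finite {x. d \<le> f x}" if d: "0 < d" "d \<le> 1" for d
  proof -
    define B where "B = (sobolev_const p * ((c + 1) * (4 / (d / 2)) powr p)) powr (2 / (2 - p))"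
    have "card C \<le> nat \<lceil>B\<rceil>" if C: "C \<subseteq> {x. d \<le> f x}" "finite C" for C
    proof -
      have "\<forall>x\<in>C. eventually (\<lambda>n. d / 2 < g (r n) x) sequentially"
        using C d by (intro ballI order_tendstoD(1)[OF lim]) auto
      then have "eventually (\<lambda>n. \<forall>x\<in>C. d / 2 < g (r n) x) sequentially"
        using C by (simp add: eventually_ball_finite)
      then obtain n where n: "\<forall>x\<in>C. d / 2 < g (r n) x"
        by (auto simp: eventually_sequentially)
      have "real (card C) powr ((2 - p) / 2) \<le> sobolev_const p * ((c + 1) * (4 / (d / 2)) powr p)"
      proof (rule card_superlevel_bound_at_infinity[OF p, of "g (r n)"])
        have "finite {x. g (r n) x \<noteq> 0}" using g by (simp add: admissible_def)
        then have "finite {x. e \<le> \<bar>g (r n) x\<bar>}" if "0 < e" for e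
          by (rule rev_finite_subset) (use that in auto)
        then show "(g (r n) \<longlongrightarrow> 0) cofinite" by (simp add: tendsto_zero_cofinite_iff)
        have "energy p (g (r n)) \<le> ennreal (c + 1 / (real (r n) + 1))"
          using g(2) by (simp add: less_imp_le)
        also have "\<dots> \<le> ennreal (c + 1)" by (intro ennreal_leI) auto
        finally show "energy p (g (r n)) \<le> ennreal (c + 1)" .
      qed (use c d n in auto)
      then have "real (card C) \<le> B"
        unfolding B_def by (intro le_powr_if_powr_le) (use p in auto)
      then show ?thesis by linarith
    qed
    then show ?thesis by (rule finite_if_finite_subsets_card_bdd[THEN conjunct1])
  qed
  then have fin: "finite {x. d \<le> \<bar>f x\<bar>}" if "0 < d" for d
  proof -
    have "finite {x. min d 1 \<le> f x}" using \<open>\<And>d. 0 < d \<Longrightarrow> d \<le> 1 \<Longrightarrow> finite {x. d \<le> f x}\<close> that by simp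
    then show ?thesis by (rule rev_finite_subset) (use f_nonneg in auto)
  qed
  then have f0: "(f \<longlongrightarrow> 0) cofinite" by (simp add: tendsto_zero_cofinite_iff)
  have "capacity p A \<le> energy p f" by (rule capacity_le_energy) (use p f0 fA in auto)
  then have "energy p f = capacity p A" using energy_le c by simp
  then show thesis using that fA f0 by blast
qed

lemma abs_powr_has_derivative:
  fixes s :: real
  assumes p: "1 < p"
  shows "((\<lambda>s. \<bar>s\<bar> powr p) has_real_derivative p * (sgn s * \<bar>s\<bar> powr (p - 1))) (at s)"
proof (cases s "0::real" rule: linorder_cases)
  case greater
  have "((\<lambda>s. s powr p) has_real_derivative p * s powr (p - 1)) (at s)"
    using has_real_derivative_powr[OF greater] .
  moreover have "eventually (\<lambda>s. s powr p = \<bar>s\<bar> powr p) (nhds s)"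
    using eventually_nhds_in_open[of "{0<..}" s] greater by (auto elim!: eventually_mono)
  ultimately show ?thesis using greater by (simp add: DERIV_cong_ev)
next
  case less
  have "((\<lambda>s. (- s) powr p) has_real_derivative p * (- s) powr (p - 1) * (- 1)) (at s)"
    by (rule DERIV_chain2[of "\<lambda>s. s powr p"])
      (use has_real_derivative_powr[of "- s" p] less in \<open>auto intro!: derivative_eq_intros\<close>)
  moreover have "eventually (\<lambda>s. (- s) powr p = \<bar>s\<bar> powr p) (nhds s)"
    using eventually_nhds_in_open[of "{..<0}" s] less by (auto elim!: eventually_mono)
  ultimately show ?thesis using less by (simp add: DERIV_cong_ev)
next
  case equal
  have "(\<lambda>h. \<bar>h\<bar> powr (p - 1)) \<midarrow>0\<rightarrow> \<bar>0\<bar> powr (p - 1)"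
    by (intro tendsto_powr' tendsto_intros) (use p in auto)
  then have "(\<lambda>h. \<bar>h\<bar> powr (p - 1)) \<midarrow>0\<rightarrow> 0" by simp
  then have "(\<lambda>h. \<bar>h\<bar> powr p / h) \<midarrow>0\<rightarrow> 0"
  proof (rule tendsto_0_le[where K = 1])
    have "norm (\<bar>h\<bar> powr p / h) = \<bar>h\<bar> powr (p - 1)" if "h \<noteq> 0" for h
      using that by (simp add: powr_diff)
    then show "eventually (\<lambda>h. norm (\<bar>h\<bar> powr p / h) \<le> norm (\<bar>h\<bar> powr (p - 1)) * 1) (at 0)"
      by (auto simp: eventually_at_filter)
  qed
  then show ?thesis using equal p by (simp add: DERIV_def)
qed

definition signed_power :: "real \<Rightarrow> real \<Rightarrow> real" where
  "signed_power r s = sgn s * \<bar>s\<bar> powr r"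

lemma signed_power_strict_mono:
  assumes "0 < r" "s < t" shows "signed_power r s < signed_power r t"
proof -
  consider "0 \<le> s" | "s < 0" "0 \<le> t" | "t < 0" by linarith
  then show ?thesis
  proof cases
    case 1
    then show ?thesis using assms powr_less_mono2[of r s t] by (auto simp: signed_power_def sgn_if)
  next
    case 2
    then have "signed_power r s < 0" "0 \<le> signed_power r t"
      by (auto simp: signed_power_def sgn_if)
    then show ?thesis by simp
  next
    case 3
    then show ?thesis using assms powr_less_mono2[of r "- t" "- s"]
      by (auto simp: signed_power_def sgn_if)
  qed
qed

lemma neighbours_eq:
  "{y. nearest_nbr (a, b) y} = {(a + 1, b), (a, b + 1), (a - 1, b), (a, b - 1)}"
  by (auto simp: nearest_nbr_def)

lemma finite_neighbours: "finite {y. nearest_nbr x y}"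
  by (cases x) (simp add: neighbours_eq)

text \<open>A minimiser is \<open>p\<close>-harmonic off \<open>A\<close>: moving its value at one site changes four terms of the
  energy, and their sum has a minimum, hence a vanishing derivative.\<close>

lemma minimizer_p_harmonic:
  assumes p: "1 < p" "p < 2" and A: "finite A"
    and f: "\<And>x. x \<in> A \<Longrightarrow> f x = 1" "(f \<longlongrightarrow> 0) cofinite" "energy p f = capacity p A" and x: "x \<notin> A"
  shows "p_harmonic_at p f x"
proof -
  obtain a b where xab: "x = (a, b)" by (cases x)
  obtain c where c: "capacity p A = ennreal c" "0 \<le> c"
    using capacity_le_card[OF A, of p] p by (cases "capacity p A") (auto simp: top_unique)
  define f' where "f' t = f(x := f x + t)" for t
  define loc where "loc t = fenergy p (incident {x}) (f' t)" for t
  have fin: "finite (incident {x})" by (rule finite_incident) simp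
  have loc_min: "loc 0 \<le> loc t" for t
  proof -
    have f'0: "f' 0 = f" by (simp add: f'_def)
    have le_c: "fenergy p F f \<le> c" if "finite F" "F \<subseteq> edges" for F
      using fenergy_le_energy[OF that, of p f] f c by (simp add: ennreal_le_iff)
    have loc0: "loc 0 \<le> c" unfolding loc_def f'0
      by (rule le_c) (use fin incident_subset_edges in auto)
    have "energy p (f' t) \<le> ennreal (c - loc 0 + loc t)"
    proof (rule energy_le_if_fenergy_le, rule ennreal_leI)
      fix F assume F: "finite F" "F \<subseteq> edges"
      have split: "fenergy p (F \<union> incident {x}) h
          = fenergy p (F - incident {x}) h + fenergy p (incident {x}) h" for h
      proof -
        have "F \<union> incident {x} = (F - incident {x}) \<union> incident {x}" by auto
        then show ?thesis unfolding fenergy_def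
          by (simp only:) (subst sum.union_disjoint, use F fin in auto)
      qed
      have same: "fenergy p (F - incident {x}) (f' t) = fenergy p (F - incident {x}) f"
        unfolding fenergy_def
        by (rule sum.cong) (use F in \<open>auto simp: f'_def incident_def\<close>)
      have "fenergy p F (f' t) \<le> fenergy p (F \<union> incident {x}) (f' t)"
        unfolding fenergy_def by (rule sum_mono2) (use F fin in auto)
      also have "\<dots> = fenergy p (F \<union> incident {x}) f - loc 0 + loc t"
        unfolding split same loc_def f'0 by simp
      also have "\<dots> \<le> c - loc 0 + loc t"
        using le_c[of "F \<union> incident {x}"] F fin incident_subset_edges by auto
      finally show "fenergy p F (f' t) \<le> c - loc 0 + loc t" .
    qed
    moreover have "capacity p A \<le> energy p (f' t)"
    proof (rule capacity_le_energy)
      have "finite {y. d \<le> \<bar>f' t y\<bar>}" if "0 < d" for d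
      proof (rule finite_subset)
        show "{y. d \<le> \<bar>f' t y\<bar>} \<subseteq> insert x {y. d \<le> \<bar>f y\<bar>}" by (auto simp: f'_def)
        show "finite (insert x {y. d \<le> \<bar>f y\<bar>})"
          using f that by (simp add: tendsto_zero_cofinite_iff)
      qed
      then show "(f' t \<longlongrightarrow> 0) cofinite" by (simp add: tendsto_zero_cofinite_iff)
    qed (use p f x in \<open>auto simp: f'_def\<close>)
    ultimately have "ennreal c \<le> ennreal (c - loc 0 + loc t)" using c by simp
    moreover have "0 \<le> c - loc 0 + loc t" using loc0 fenergy_nonneg by (simp add: loc_def)
    ultimately show ?thesis by (simp add: ennreal_le_iff)
  qed
  have loc_eq: "loc t = (\<Sum>y | nearest_nbr x y. \<bar>f y - f x - t\<bar> powr p)" for t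
    unfolding loc_def fenergy_def xab incident_single neighbours_eq f'_def
    by (simp add: abs_minus_commute diff_diff_eq)
  have "(loc has_real_derivative
      (\<Sum>y | nearest_nbr x y. - (p * (sgn (f y - f x - 0) * \<bar>f y - f x - 0\<bar> powr (p - 1))))) (at 0)"
    unfolding loc_eq[abs_def]
  proof (rule DERIV_sum)
    fix y
    have "((\<lambda>t. \<bar>f y - f x - t\<bar> powr p) has_real_derivative
        (p * (sgn (f y - f x - 0) * \<bar>f y - f x - 0\<bar> powr (p - 1))) * (- 1)) (at 0)"
      by (rule DERIV_chain2[of "\<lambda>s. \<bar>s\<bar> powr p" _ "\<lambda>t. f y - f x - t"])
        (use abs_powr_has_derivative[OF p(1)] in \<open>auto intro!: derivative_eq_intros\<close>)
    then show "((\<lambda>t. \<bar>f y - f x - t\<bar> powr p) has_real_derivative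
        - (p * (sgn (f y - f x - 0) * \<bar>f y - f x - 0\<bar> powr (p - 1)))) (at 0)" by simp
  qed
  then have "(\<Sum>y | nearest_nbr x y. - (p * (sgn (f y - f x - 0) * \<bar>f y - f x - 0\<bar> powr (p - 1)))) = 0"
    by (rule DERIV_local_min[of _ _ _ 1]) (use loc_min in auto)
  then show ?thesis
    using p by (simp add: p_harmonic_at_def sum_negf sum_distrib_left[symmetric])
qed

text \<open>The maximum principle: the finite set on which \<open>f - g\<close> attains a positive maximum would be
  closed under moving east.\<close>

lemma potential_le:
  assumes p: "1 < p" and f: "is_p_potential p A f" and g: "is_p_potential p A g"
  shows "f x \<le> g x"
proof (rule ccontr)
  assume "\<not> f x \<le> g x"
  define u where "u y = f y - g y" for y
  have ux: "0 < u x" using \<open>\<not> f x \<le> g x\<close> by (simp add: u_def)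
  have "(u \<longlongrightarrow> 0 - 0) cofinite"
    unfolding u_def by (rule tendsto_diff) (use f g in \<open>auto simp: is_p_potential_def\<close>)
  then have "finite {y. u x \<le> \<bar>u y\<bar>}" using ux by (simp add: tendsto_zero_cofinite_iff)
  then have finU: "finite {y. u x \<le> u y}" by (rule rev_finite_subset) auto
  define m where "m = Max (u ` {y. u x \<le> u y})"
  have "x \<in> {y. u x \<le> u y}" by simp
  then have "m \<in> u ` {y. u x \<le> u y}" unfolding m_def by (intro Max_in) (use finU in blast)+
  then obtain z where z: "u z = m" "u x \<le> m" by auto
  have u_le: "u y \<le> m" for y
  proof (cases "u x \<le> u y")
    case True
    then show ?thesis unfolding m_def using finU by (intro Max_ge) auto
  qed (use z in simp)
  define S where "S = {y. u y = m}"
  have finS: "finite S" by (rule finite_subset[OF _ finU]) (use z in \<open>auto simp: S_def\<close>)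
  have step: "east y \<in> S" if "y \<in> S" for y
  proof -
    have "y \<notin> A" using that f g ux z by (auto simp: S_def u_def is_p_potential_def)
    then have "p_harmonic_at p f y" "p_harmonic_at p g y"
      using f g unfolding is_p_potential_def by blast+
    then have eq: "(\<Sum>w | nearest_nbr y w. signed_power (p - 1) (g w - g y)
        - signed_power (p - 1) (f w - f y)) = 0"
      by (simp add: p_harmonic_at_def signed_power_def sum_subtractf)
    have ge: "f w - f y \<le> g w - g y" for w
      using u_le[of w] that by (simp add: S_def u_def)
    have "0 \<le> signed_power (p - 1) (g w - g y) - signed_power (p - 1) (f w - f y)" for w
      using ge[of w] signed_power_strict_mono[of "p - 1" "f w - f y" "g w - g y"] p
      by (cases "f w - f y = g w - g y") auto
    then have "signed_power (p - 1) (g w - g y) - signed_power (p - 1) (f w - f y) = 0"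
      if "nearest_nbr y w" for w
      using eq that sum_nonneg_eq_0_iff[OF finite_neighbours[of y],
          of "\<lambda>w. signed_power (p - 1) (g w - g y) - signed_power (p - 1) (f w - f y)"]
      by (cases w) auto
    moreover have "nearest_nbr y (east y)" by (simp add: nearest_nbr_def east_def)
    ultimately have "\<not> f (east y) - f y < g (east y) - g y"
      using signed_power_strict_mono[of "p - 1"] p by (metis diff_gt_0_iff_gt eq_iff_diff_eq_0 less_irrefl)
    then show ?thesis using ge[of "east y"] that by (simp add: S_def u_def)
  qed
  have "z \<in> S" using z by (simp add: S_def)
  have "Max (fst ` S) \<in> fst ` S" by (rule Max_in) (use finS \<open>z \<in> S\<close> in auto)
  then obtain y where y: "y \<in> S" "fst y = Max (fst ` S)" by auto
  have "fst (east y) \<le> Max (fst ` S)" by (rule Max_ge) (use finS step[OF y(1)] in auto)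
  then show False using y by (simp add: east_def)
qed

lemma p_potential_eqI:
  assumes "1 < p" "is_p_potential p A f"
  shows "p_potential p A = f"
  unfolding p_potential_def
proof (rule the_equality)
  show "g = f" if "is_p_potential p A g" for g
    using potential_le[OF assms(1) that assms(2)] potential_le[OF assms(1) assms(2) that]
    by (intro ext antisym) auto
qed (fact assms(2))

definition cap_energy :: "real \<Rightarrow> vertex set \<Rightarrow> real" where
  "cap_energy p A = enn2real (energy p (p_potential p A))"

lemma p_potential_facts:
  assumes p: "1 < p" "p < 2" and A: "finite A"
  shows "(p_potential p A \<longlongrightarrow> 0) cofinite" "\<And>x. x \<in> A \<Longrightarrow> p_potential p A x = 1"
    "energy p (p_potential p A) = capacity p A" "capacity p A = ennreal (cap_energy p A)"
    "0 \<le> cap_energy p A" "cap_energy p A \<le> 4 * real (card A)"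
proof -
  obtain f where f: "\<And>x. x \<in> A \<Longrightarrow> f x = 1" "(f \<longlongrightarrow> 0) cofinite" "energy p f = capacity p A"
    using capacity_attained[OF p A] by blast
  have "is_p_potential p A f"
    unfolding is_p_potential_def using f minimizer_p_harmonic[OF p A f] by auto
  then have eq: "p_potential p A = f" by (rule p_potential_eqI[OF p(1)])
  show "(p_potential p A \<longlongrightarrow> 0) cofinite" "\<And>x. x \<in> A \<Longrightarrow> p_potential p A x = 1"
    "energy p (p_potential p A) = capacity p A"
    using f by (simp_all add: eq)
  have le: "capacity p A \<le> ennreal (4 * real (card A))"
    using capacity_le_card[OF A] p by simp
  then have "capacity p A < top" using le_less_trans ennreal_less_top by blast
  then show cap: "capacity p A = ennreal (cap_energy p A)"
    unfolding cap_energy_def eq f(3) by simp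
  show "0 \<le> cap_energy p A" by (simp add: cap_energy_def)
  show "cap_energy p A \<le> 4 * real (card A)"
    using le unfolding cap by (subst (asm) ennreal_le_iff) auto
qed

lemma cap_energy_le_fenergy:
  assumes p: "1 < p" "p < 2" and A: "finite A"
    and g: "\<And>x. x \<in> A \<Longrightarrow> 1 \<le> g x" "\<And>x. x \<notin> box M \<Longrightarrow> g x = 0"
  shows "cap_energy p A \<le> fenergy p (incident (box M)) g"
proof -
  have "finite {x. d \<le> \<bar>g x\<bar>}" if "0 < d" for d
    by (rule finite_subset[OF _ finite_box[of M]]) (use g that in \<open>force simp: not_le\<close>)
  then have "(g \<longlongrightarrow> 0) cofinite" by (simp add: tendsto_zero_cofinite_iff)
  then have "capacity p A \<le> energy p g" by (intro capacity_le_energy) (use p g in auto)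
  also have "\<dots> = ennreal (fenergy p (incident (box M)) g)"
    by (rule energy_finite_support) (use g finite_box in auto)
  finally show ?thesis
    using p_potential_facts(4)[OF p A] fenergy_nonneg by (simp add: ennreal_le_iff)
qed

text \<open>Near-optimal profiles whose support has a size that depends on \<open>A\<close> only through its
  cardinality.\<close>

lemma near_optimal_profile:
  assumes p: "1 < p" "p < 2" and A: "finite A" and d: "0 < d" "d < 1"
  obtains g where "\<And>x. x \<in> A \<Longrightarrow> g x = 1" "finite {x. g x \<noteq> 0}"
    "real (card {x. g x \<noteq> 0}) \<le>
       (sobolev_const p * (4 * real (card A) * (4 / d) powr p)) powr (2 / (2 - p))"
    "\<And>F. finite F \<Longrightarrow> F \<subseteq> edges \<Longrightarrow> fenergy p F g \<le> cap_energy p A / (1 - d) powr p"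
proof
  let ?f = "p_potential p A"
  let ?g = "truncate_at d ?f"
  note facts = p_potential_facts[OF p A]
  show "?g x = 1" if "x \<in> A" for x using truncate_at_bounds(3)[OF d] facts(2)[OF that] by simp
  show "finite {x. ?g x \<noteq> 0}" by (rule finite_support_truncate[OF d facts(1)])
  have "real (card {x. ?g x \<noteq> 0}) powr ((2 - p) / 2)
      \<le> sobolev_const p * (4 * real (card A) * (4 / d) powr p)"
  proof (rule card_superlevel_bound_at_infinity[OF p facts(1)])
    show "energy p ?f \<le> ennreal (4 * real (card A))"
      using facts by (simp add: ennreal_le_iff)
    show "d \<le> ?f x" if "x \<in> {x. ?g x \<noteq> 0}" for x
      using truncate_at_bounds(4)[OF d, of ?f x] that by force
  qed (use d in auto)
  then show "real (card {x. ?g x \<noteq> 0}) \<le>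
       (sobolev_const p * (4 * real (card A) * (4 / d) powr p)) powr (2 / (2 - p))"
    by (intro le_powr_if_powr_le) (use p in auto)
  fix F assume F: "finite F" "F \<subseteq> edges"
  have "energy p ?g \<le> ennreal (cap_energy p A / (1 - d) powr p)"
    by (rule energy_truncate_le) (use d p facts in auto)
  then have "ennreal (fenergy p F ?g) \<le> ennreal (cap_energy p A / (1 - d) powr p)"
    using fenergy_le_energy[OF F] order_trans by blast
  then show "fenergy p F ?g \<le> cap_energy p A / (1 - d) powr p"
    using facts by (subst (asm) ennreal_le_iff) auto
qed

section \<open>Contours\<close>

text \<open>Connectedness of \<open>S\<close> for a symmetric relation, stated by the absence of a proper nonempty
  part that is closed under the relation; this is the form in which it is proved and used.\<close>

definition linked :: "('a \<Rightarrow> 'a \<Rightarrow> bool) \<Rightarrow> 'a set \<Rightarrow> bool" where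
  "linked r S \<longleftrightarrow> (\<forall>R. R \<subseteq> S \<and> R \<noteq> {} \<and> (\<forall>x\<in>R. \<forall>y\<in>S. r x y \<longrightarrow> y \<in> R) \<longrightarrow> R = S)"

lemma linkedD:
  assumes "linked r S" "R \<subseteq> S" "z \<in> R" "\<And>x y. x \<in> R \<Longrightarrow> y \<in> S \<Longrightarrow> r x y \<Longrightarrow> y \<in> R"
  shows "R = S"
  using assms unfolding linked_def by blast

definition boundary :: "vertex set \<Rightarrow> (vertex \<times> vertex) set" where
  "boundary K = {e \<in> edges. (fst e \<in> K) \<noteq> (snd e \<in> K)}"

lemma boundary_subset_incident: "boundary K \<subseteq> incident K"
  by (auto simp: boundary_def incident_def)

lemma finite_boundary: "finite K \<Longrightarrow> finite (boundary K)"
  using finite_subset[OF boundary_subset_incident finite_incident] .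

definition plaquette :: "vertex \<Rightarrow> (vertex \<times> vertex) set" where
  "plaquette v = {(v, east v), (v, north v), (north v, east (north v)), (east v, north (east v))}"

definition share_plaquette :: "vertex \<times> vertex \<Rightarrow> vertex \<times> vertex \<Rightarrow> bool" where
  "share_plaquette e e' \<longleftrightarrow> (\<exists>v. e \<in> plaquette v \<and> e' \<in> plaquette v)"

lemma east_north: "east (north v) = north (east v)"
  by (simp add: east_def north_def)

lemma parity_sum_exists:
  fixes c :: "int \<Rightarrow> bool"
  shows "\<exists>u. \<not> u 0 \<and> (\<forall>i. u (i + 1) \<longleftrightarrow> (u i \<noteq> c i))"
proof -
  define s :: "int \<Rightarrow> nat" where
    "s i = (\<Sum>j\<in>{0..<i}. of_bool (c j)) + (\<Sum>j\<in>{i..<0}. of_bool (c j))" for i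
  have "odd (s (i + 1)) \<longleftrightarrow> (odd (s i) \<noteq> c i)" for i
  proof (cases "0 \<le> i")
    case True
    then have "{0..<i + 1} = insert i {0..<i}" by auto
    then show ?thesis using True by (auto simp: s_def simp del: sum_of_bool_eq)
  next
    case False
    then have "{i..<0} = insert i {i + 1..<0}" by auto
    then show ?thesis using False by (auto simp: s_def simp del: sum_of_bool_eq)
  qed
  moreover have "\<not> odd (s 0)" by (simp add: s_def)
  ultimately show ?thesis by (intro exI[of _ "\<lambda>i. odd (s i)"]) blast
qed

text \<open>The Poincare lemma modulo two: a set of edges that meets every plaquette in an even number
  of edges is the set of edges across which some two-colouring of the vertices changes. The
  colour is found by summing along the horizontal axis and then along a column.\<close>

lemma even_edge_set_is_coboundary:
  assumes closed: "\<And>v. (P (v, east v) \<noteq> P (v, north v)) \<longleftrightarrow>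
      (P (north v, east (north v)) \<noteq> P (east v, north (east v)))"
  shows "\<exists>g :: vertex \<Rightarrow> bool. \<forall>e\<in>edges. P e \<longleftrightarrow> (g (fst e) \<noteq> g (snd e))"
proof -
  define h where "h a b = P ((a, b), (a + 1, b))" for a b :: int
  define k where "k a b = P ((a, b), (a, b + 1))" for a b :: int
  have cl: "(h a b \<noteq> k a b) \<longleftrightarrow> (h a (b + 1) \<noteq> k (a + 1) b)" for a b
    using closed[of "(a, b)"] by (simp add: h_def k_def east_def north_def)
  obtain u where u: "\<not> u 0" "\<And>i. u (i + 1) \<longleftrightarrow> (u i \<noteq> h i 0)"
    using parity_sum_exists[of "\<lambda>i. h i 0"] by blast
  have "\<forall>a. \<exists>w. \<not> w 0 \<and> (\<forall>j. w (j + 1) \<longleftrightarrow> (w j \<noteq> k a j))"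
    using parity_sum_exists by blast
  then obtain w where w: "\<And>a. \<not> w a 0" "\<And>a j. w a (j + 1) \<longleftrightarrow> (w a j \<noteq> k a j)"
    by metis
  define g :: "vertex \<Rightarrow> bool" where "g v = (u (fst v) \<noteq> w (fst v) (snd v))" for v
  have vert: "k a b \<longleftrightarrow> (g (a, b) \<noteq> g (a, b + 1))" for a b
    using w(2)[of a b] by (auto simp: g_def)
  have hor: "h a b \<longleftrightarrow> (g (a, b) \<noteq> g (a + 1, b))" for a b
  proof (induction b rule: int_induct[of _ 0])
    case base
    then show ?case using u(2)[of a] w(1) by (auto simp: g_def)
  next
    case (step1 b)
    then show ?case using cl[of a b] vert[of a b] vert[of "a + 1" b] by argo
  next
    case (step2 b)
    then show ?case using cl[of a "b - 1"] vert[of a "b - 1"] vert[of "a + 1" "b - 1"]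
      by (simp; argo)
  qed
  have "P e \<longleftrightarrow> (g (fst e) \<noteq> g (snd e))" if "e \<in> edges" for e
  proof -
    obtain a b y where e: "e = ((a, b), y)" by (metis prod.collapse)
    then have "y = (a + 1, b) \<or> y = (a, b + 1)"
      using that by (auto simp: mem_edges_iff east_def north_def)
    then show ?thesis using hor[of a b] vert[of a b] by (auto simp: e h_def k_def)
  qed
  then show ?thesis by blast
qed

text \<open>The boundary of a connected set with connected complement is connected through plaquettes.
  A plaquette contains an even number of boundary edges, and a part that is closed under sharing a
  plaquette contains all or none of them. So this part is an even edge set and separates two
  colours; as \<open>K\<close> and its complement are monochromatic, the part is everything.\<close>

lemma linked_boundary:
  assumes K: "linked nearest_nbr K" "linked nearest_nbr (- K)"
  shows "linked share_plaquette (boundary K)"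
  unfolding linked_def
proof (intro allI impI)
  fix R
  assume "R \<subseteq> boundary K \<and> R \<noteq> {} \<and> (\<forall>x\<in>R. \<forall>y\<in>boundary K. share_plaquette x y \<longrightarrow> y \<in> R)"
  then have R: "R \<subseteq> boundary K" "R \<noteq> {}"
    and cl: "\<And>x y. x \<in> R \<Longrightarrow> y \<in> boundary K \<Longrightarrow> share_plaquette x y \<Longrightarrow> y \<in> R" by blast+
  have "\<exists>g :: vertex \<Rightarrow> bool. \<forall>e\<in>edges. e \<in> R \<longleftrightarrow> (g (fst e) \<noteq> g (snd e))"
  proof (rule even_edge_set_is_coboundary)
    fix v
    have bd: "e \<in> boundary K \<longleftrightarrow> (fst e \<in> K) \<noteq> (snd e \<in> K)" if "e \<in> plaquette v" for e
      using that by (auto simp: boundary_def plaquette_def mem_edges_iff east_north)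
    have all: "e' \<in> R" if "e \<in> R" "e \<in> plaquette v" "e' \<in> plaquette v" "e' \<in> boundary K" for e e'
      using cl[OF that(1) that(4)] that unfolding share_plaquette_def by blast
    show "(((v, east v) \<in> R) \<noteq> ((v, north v) \<in> R)) =
        (((north v, east (north v)) \<in> R) \<noteq> ((east v, north (east v)) \<in> R))"
    proof (cases "R \<inter> plaquette v = {}")
      case True
      then show ?thesis by (auto simp: plaquette_def)
    next
      case False
      then have eq: "e \<in> R \<longleftrightarrow> (fst e \<in> K) \<noteq> (snd e \<in> K)" if "e \<in> plaquette v" for e
        using all[OF _ _ that] bd[OF that] R(1) by blast
      show ?thesis by (simp add: eq plaquette_def east_north) argo
    qed
  qed
  then obtain g :: "vertex \<Rightarrow> bool" where g: "\<And>e. e \<in> edges \<Longrightarrow> e \<in> R \<longleftrightarrow> (g (fst e) \<noteq> g (snd e))"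
    by blast
  have mono: "g x = g y"
    if L: "linked nearest_nbr L" "L = K \<or> L = - K" and xy: "x \<in> L" "y \<in> L" for L x y
  proof -
    have "{z \<in> L. g z = g x} = L"
    proof (rule linkedD[OF L(1), of _ x])
      fix s t assume s: "s \<in> {z \<in> L. g z = g x}" and t: "t \<in> L" "nearest_nbr s t"
      have "(s, t) \<notin> R" "(t, s) \<notin> R" using s t L(2) R(1) by (auto simp: boundary_def)
      then have "g s = g t" using g[of "(s, t)"] g[of "(t, s)"] t by (auto simp: nearest_nbr_iff_edge)
      then show "t \<in> {z \<in> L. g z = g x}" using s t by auto
    qed (use xy in auto)
    then show ?thesis using xy by auto
  qed
  obtain e0 where e0: "e0 \<in> R" using R by blast
  have e0b: "e0 \<in> edges" "(fst e0 \<in> K) \<noteq> (snd e0 \<in> K)" using e0 R by (auto simp: boundary_def)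
  have "g (fst e0) \<noteq> g (snd e0)" using g e0 e0b by blast
  then have diff: "g x \<noteq> g y" if "(x \<in> K) \<noteq> (y \<in> K)" for x y
    using that e0b(2) mono[OF K(1)] mono[OF K(2)] by (metis Compl_iff)
  have "e \<in> R" if "e \<in> boundary K" for e
    using that g[of e] diff[of "fst e" "snd e"] by (auto simp: boundary_def)
  then show "R = boundary K" using R by blast
qed

text \<open>The encoding by which connected sets are counted. A walk
  that misses a point is extended by an excursion to a neighbouring missed point and back.\<close>

lemma linked_covering_walk:
  assumes S: "finite S" "linked r S" "e \<in> S" and sym: "\<And>x y. r x y \<Longrightarrow> r y x"
  shows "\<exists>w. length w = 2 * card S - 1 \<and> hd w = e \<and> successively r w \<and> set w = S"
proof -
  have "\<exists>w. length w = 2 * k + 1 \<and> hd w = e \<and> successively r w \<and> set w \<subseteq> S \<and> card (set w) = Suc k"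
    if "k < card S" for k
    using that
  proof (induction k)
    case 0
    then show ?case using S by (intro exI[of _ "[e]"]) auto
  next
    case (Suc k)
    then obtain w where w: "length w = 2 * k + 1" "hd w = e" "successively r w" "set w \<subseteq> S"
      "card (set w) = Suc k" by auto
    have "set w \<noteq> S" using w Suc by auto
    moreover have "e \<in> set w" using w by (cases w) auto
    ultimately obtain x y where xy: "x \<in> set w" "y \<in> S" "r x y" "y \<notin> set w"
      using linkedD[OF S(2) w(4)] by blast
    obtain us vs where usvs: "w = us @ x # vs" using split_list[OF xy(1)] by blast
    let ?w = "us @ x # y # x # vs"
    have "successively r ?w"
      using w(3) xy(3) sym by (auto simp: usvs successively_append_iff successively_Cons)
    moreover have "hd ?w = e" using w(2) by (cases us) (auto simp: usvs)
    moreover have "set ?w = insert y (set w)" by (auto simp: usvs)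
    ultimately show ?case
      using w xy by (intro exI[of _ ?w]) (auto simp: usvs)
  qed
  moreover have "0 < card S" using S by (auto simp: card_gt_0_iff)
  ultimately obtain w where w: "length w = 2 * (card S - 1) + 1" "hd w = e" "successively r w"
    "set w \<subseteq> S" "card (set w) = Suc (card S - 1)" by (metis diff_less zero_less_one)
  then have "set w = S" using \<open>0 < card S\<close> S(1) by (intro card_subset_eq) auto
  then show ?thesis using w \<open>0 < card S\<close> by (intro exI[of _ w]) auto
qed

definition walks :: "('a \<Rightarrow> 'a \<Rightarrow> bool) \<Rightarrow> 'a \<Rightarrow> nat \<Rightarrow> 'a list set" where
  "walks r e n = {w. length w = Suc n \<and> hd w = e \<and> successively r w}"

lemma card_walks:
  assumes "\<And>x. finite {y. r x y} \<and> card {y. r x y} \<le> D"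
  shows "finite (walks r e n) \<and> card (walks r e n) \<le> D ^ n"
proof (induction n arbitrary: e)
  case 0
  have "walks r e 0 = {[e]}" by (auto simp: walks_def length_Suc_conv)
  then show ?case by simp
next
  case (Suc n)
  have sub: "walks r e (Suc n) \<subseteq> (\<Union>y\<in>{y. r e y}. (#) e ` walks r y n)"
  proof
    fix w assume "w \<in> walks r e (Suc n)"
    then obtain y v where "w = e # y # v" "length v = n" "r e y" "successively r (y # v)"
      by (auto simp: walks_def length_Suc_conv)
    then show "w \<in> (\<Union>y\<in>{y. r e y}. (#) e ` walks r y n)" by (auto simp: walks_def)
  qed
  have fin: "finite (\<Union>y\<in>{y. r e y}. (#) e ` walks r y n)" using Suc assms by blast
  have "card (walks r e (Suc n)) \<le> card (\<Union>y\<in>{y. r e y}. (#) e ` walks r y n)"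
    by (rule card_mono[OF fin sub])
  also have "\<dots> \<le> (\<Sum>y\<in>{y. r e y}. card ((#) e ` walks r y n))"
    using assms by (intro card_UN_le) blast
  also have "\<dots> \<le> (\<Sum>y\<in>{y. r e y}. D ^ n)"
    using Suc by (intro sum_mono) (meson card_image_le order_trans)
  also have "\<dots> \<le> D * D ^ n" using assms by simp
  finally show ?case using finite_subset[OF sub fin] by simp
qed

lemma share_plaquette_degree:
  "finite {e'. share_plaquette e e'} \<and> card {e'. share_plaquette e e'} \<le> 8"
proof -
  obtain a b y where e: "e = ((a, b), y)" by (metis prod.collapse)
  have pl: "finite (plaquette v)" "card (plaquette v) \<le> 4" for v
  proof -
    have "plaquette v = set [(v, east v), (v, north v), (north v, east (north v)), (east v, north (east v))]"
      by (simp add: plaquette_def)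
    then show "finite (plaquette v)" "card (plaquette v) \<le> 4"
      using card_length[of "[(v, east v), (v, north v), (north v, east (north v)),
        (east v, north (east v))]"] by simp_all
  qed
  define Q where "Q = (if y = (a + 1, b) then plaquette (a, b) \<union> plaquette (a, b - 1)
    else plaquette (a, b) \<union> plaquette (a - 1, b))"
  have "finite Q" using pl by (simp add: Q_def)
  moreover have "card Q \<le> 8"
    using card_Un_le[of "plaquette (a, b)" "plaquette (a, b - 1)"]
      card_Un_le[of "plaquette (a, b)" "plaquette (a - 1, b)"] pl[of "(a, b)"] pl[of "(a, b - 1)"]
      pl[of "(a - 1, b)"] unfolding Q_def by auto
  moreover have "{e'. share_plaquette e e'} \<subseteq> Q"
  proof
    fix e' assume "e' \<in> {e'. share_plaquette e e'}"
    then obtain v where v: "e \<in> plaquette v" "e' \<in> plaquette v" by (auto simp: share_plaquette_def)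
    have "v = (a, b) \<or> (if y = (a + 1, b) then v = (a, b - 1) else v = (a - 1, b))"
      using v(1) by (cases v) (auto simp: plaquette_def e east_def north_def split: if_splits)
    then show "e' \<in> Q" using v(2) by (auto simp: Q_def split: if_splits)
  qed
  ultimately show ?thesis by (meson card_mono finite_subset order_trans)
qed

text \<open>From \<open>x\<close> all of \<open>K\<close> is reached without crossing its boundary, hence without leaving \<open>L\<close>.\<close>

lemma boundary_determines:
  assumes K: "linked nearest_nbr K" "x \<in> K" and L: "x \<in> L" and eq: "boundary K = boundary L"
  shows "K \<subseteq> L"
proof -
  have "K \<inter> L = K"
  proof (rule linkedD[OF K(1), of _ x])
    fix s t assume st: "s \<in> K \<inter> L" "t \<in> K" "nearest_nbr s t"
    have "(s, t) \<notin> boundary K" "(t, s) \<notin> boundary K"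
      using st by (auto simp: boundary_def)
    then have "(s, t) \<notin> boundary L" "(t, s) \<notin> boundary L" by (simp_all add: eq)
    then show "t \<in> K \<inter> L" using st by (auto simp: boundary_def nearest_nbr_iff_edge)
  qed (use K L in auto)
  then show ?thesis by blast
qed

definition contour_at :: "vertex \<Rightarrow> vertex set \<Rightarrow> bool" where
  "contour_at x K \<longleftrightarrow> finite K \<and> x \<in> K \<and> linked nearest_nbr K \<and> linked nearest_nbr (- K)"

text \<open>The walk that encodes a contour needs a starting edge with few possibilities. Going east from
  \<open>(a, b)\<close>, the set is left for the first time after \<open>i\<close> steps inside it, and each of the \<open>i + 1\<close> columns
  visited contains a vertical boundary edge.\<close>

lemma boundary_anchor:
  assumes K: "finite K" "(a, b) \<in> K"
  shows "\<exists>i < card (boundary K). ((a + int i, b), (a + int i + 1, b)) \<in> boundary K"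
proof -
  have "\<exists>n. (a + int n, b) \<notin> K"
  proof (rule ccontr)
    assume "\<not> ?thesis"
    then have "range (\<lambda>n. (a + int n, b)) \<subseteq> K" by auto
    moreover have "inj (\<lambda>n. (a + int n, b))" by (auto simp: inj_on_def)
    ultimately show False using K(1) finite_subset range_inj_infinite by blast
  qed
  define n where "n = (LEAST n. (a + int n, b) \<notin> K)"
  have below: "(a + int t, b) \<in> K" if "t < n" for t
    using that not_less_Least[of t "\<lambda>n. (a + int n, b) \<notin> K"] by (auto simp: n_def)
  have n': "(a + int n, b) \<notin> K" unfolding n_def using \<open>\<exists>n. (a + int n, b) \<notin> K\<close> by (rule LeastI_ex)
  have "n \<noteq> 0" using n' K(2) by (intro notI) simp
  then obtain i where i: "n = Suc i" by (cases n) auto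
  have "\<exists>j. ((a + int t, j), (a + int t, j + 1)) \<in> boundary K" if "t \<le> i" for t
  proof (rule ccontr)
    assume none: "\<not> ?thesis"
    have "(a + int t, b + int s) \<in> K" for s
    proof (induction s)
      case 0
      then show ?case using below that i by simp
    next
      case (Suc s)
      have "((a + int t, b + int s), (a + int t, b + int s + 1)) \<notin> boundary K"
        using none by blast
      then have "(a + int t, b + int s + 1) \<in> K"
        using Suc by (simp add: boundary_def mem_edges_iff north_def)
      then show ?case by (simp add: add.commute add.left_commute)
    qed
    then have "range (\<lambda>s. (a + int t, b + int s)) \<subseteq> K" by auto
    moreover have "inj (\<lambda>s. (a + int t, b + int s))" by (auto simp: inj_on_def)
    ultimately show False using K(1) finite_subset range_inj_infinite by blast
  qed
  then obtain j where j: "\<And>t. t \<le> i \<Longrightarrow> ((a + int t, j t), (a + int t, j t + 1)) \<in> boundary K"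
    by metis
  have "card ((\<lambda>t. ((a + int t, j t), (a + int t, j t + 1))) ` {..i}) = Suc i"
    by (subst card_image) (auto simp: inj_on_def)
  moreover have "card ((\<lambda>t. ((a + int t, j t), (a + int t, j t + 1))) ` {..i}) \<le> card (boundary K)"
    by (rule card_mono[OF finite_boundary[OF K(1)]]) (use j in auto)
  moreover have "((a + int i, b), (a + int i + 1, b)) \<in> boundary K"
    using below[of i] n' by (auto simp: i boundary_def mem_edges_iff east_def algebra_simps)
  ultimately show ?thesis by (intro exI[of _ i]) auto
qed

text \<open>There are at most \<open>l\<close> starting edges, and at most eight continuations for each of the \<open>2 l - 2\<close>
  steps of the walk.\<close>

lemma card_contours:
  "finite {K. contour_at x K \<and> card (boundary K) = l} \<and>
   card {K. contour_at x K \<and> card (boundary K) = l} \<le> 128 ^ l"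
proof -
  obtain a b where x: "x = (a, b)" by (cases x)
  let ?Ks = "{K. contour_at x K \<and> card (boundary K) = l}"
  define Ws where "Ws = (\<Union>i<l. set ` walks share_plaquette ((a + int i, b), (a + int i + 1, b)) (2 * l - 2))"
  have walks: "finite (walks share_plaquette e n) \<and> card (walks share_plaquette e n) \<le> 8 ^ n" for e n
    by (rule card_walks) (rule share_plaquette_degree)
  have inj: "inj_on boundary ?Ks"
  proof (rule inj_onI)
    fix K L assume "K \<in> ?Ks" "L \<in> ?Ks" and eq: "boundary K = boundary L"
    then have "contour_at x K" "contour_at x L" by simp_all
    then show "K = L"
      unfolding contour_at_def
      using boundary_determines[of K x L] boundary_determines[of L x K] eq
      by (intro subset_antisym) simp_all
  qed
  have sub: "boundary ` ?Ks \<subseteq> Ws"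
  proof
    fix B assume "B \<in> boundary ` ?Ks"
    then obtain K where K: "contour_at x K" "card (boundary K) = l" "B = boundary K" by auto
    then obtain i where i: "i < l" "((a + int i, b), (a + int i + 1, b)) \<in> B"
      using boundary_anchor[of K a b] by (auto simp: contour_at_def x)
    have "\<exists>w. length w = 2 * card B - 1 \<and> hd w = ((a + int i, b), (a + int i + 1, b)) \<and>
        successively share_plaquette w \<and> set w = B"
    proof (rule linked_covering_walk)
      show "finite B" "linked share_plaquette B"
        using K(1) finite_boundary linked_boundary unfolding K(3) contour_at_def by blast+
      show "share_plaquette e' e" if "share_plaquette e e'" for e e'
        using that unfolding share_plaquette_def by blast
    qed (fact i(2))
    moreover have "card B = l" using K by simp
    ultimately obtain w where w: "length w = 2 * l - 1"
      "hd w = ((a + int i, b), (a + int i + 1, b))" "successively share_plaquette w" "set w = B"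
      by blast
    then have "w \<in> walks share_plaquette ((a + int i, b), (a + int i + 1, b)) (2 * l - 2)"
      using i by (auto simp: walks_def)
    then show "B \<in> Ws" unfolding Ws_def using i(1) w(4) by blast
  qed
  have finW: "finite Ws" unfolding Ws_def using walks by (intro finite_UN_I finite_imageI) simp_all
  have "card Ws \<le> (\<Sum>i<l. card (set ` walks share_plaquette ((a + int i, b), (a + int i + 1, b)) (2 * l - 2)))"
    unfolding Ws_def by (rule card_UN_le) simp
  also have "\<dots> \<le> (\<Sum>i<l. 8 ^ (2 * l - 2))"
    by (intro sum_mono order_trans[OF card_image_le]) (use walks in simp_all)
  also have "\<dots> = l * 8 ^ (2 * l - 2)" by simp
  also have "\<dots> \<le> 2 ^ l * 8 ^ (2 * l)"
  proof (intro mult_mono)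
    show "l \<le> 2 ^ l" using less_exp[of l] by simp
    show "(8::nat) ^ (2 * l - 2) \<le> 8 ^ (2 * l)" by (rule power_increasing) simp_all
  qed simp_all
  also have "\<dots> = (128::nat) ^ l"
    using power_mult[of "8::nat" 2 l] power_mult_distrib[of "2::nat" 64 l] by simp
  finally have "card Ws \<le> 128 ^ l" .
  moreover have "card ?Ks \<le> card Ws"
    using card_image[OF inj] card_mono[OF finW sub] by simp
  moreover have "finite ?Ks" using finite_imageD[OF finite_subset[OF sub finW] inj] .
  ultimately show ?thesis by simp
qed

text \<open>The Peierls estimate. The value \<open>256\<close> is twice the growth rate in the count of contours, which
  gives a geometric series with ratio one half that starts at length one.\<close>

lemma contour_sum_le_1:
  assumes fin: "finite \<K>" and cont: "\<And>K. K \<in> \<K> \<Longrightarrow> contour_at x K" and b: "ln 256 \<le> b"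
  shows "(\<Sum>K\<in>\<K>. exp (- b * real (card (boundary K)))) \<le> 1"
proof -
  define len where "len K = card (boundary K)" for K
  define L where "L = len ` \<K>"
  have finL: "finite L" using fin by (simp add: L_def)
  have pos: "l \<noteq> 0" if l: "l \<in> L" for l
  proof -
    obtain K where K: "K \<in> \<K>" "l = card (boundary K)" using l by (auto simp: L_def len_def)
    then have "contour_at x K" using cont by blast
    then show ?thesis using boundary_anchor[of K "fst x" "snd x"] K
      by (auto simp: contour_at_def)
  qed
  have "(\<Sum>K\<in>\<K>. exp (- b * real (card (boundary K))))
      = (\<Sum>l\<in>L. \<Sum>K | K \<in> \<K> \<and> len K = l. exp (- b * real (len K)))"
    unfolding L_def len_def[symmetric] by (rule sum.image_gen[OF fin])
  also have "\<dots> \<le> (\<Sum>l\<in>L. (1 / 2) ^ l)"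
  proof (rule sum_mono)
    fix l
    have "card {K \<in> \<K>. len K = l} \<le> card {K. contour_at x K \<and> card (boundary K) = l}"
      by (rule card_mono) (use card_contours cont in \<open>auto simp: len_def\<close>)
    also have "\<dots> \<le> 128 ^ l" using card_contours by blast
    finally have le: "real (card {K \<in> \<K>. len K = l}) \<le> 128 ^ l"
      by (metis of_nat_le_iff of_nat_numeral of_nat_power)
    have "exp (- b) \<le> exp (- ln 256)" using b by simp
    then have "exp (- b) \<le> 1 / 256" by (simp add: exp_minus)
    then have e: "exp (- b) ^ l \<le> (1 / 256) ^ l" by (intro power_mono) auto
    have "(\<Sum>K | K \<in> \<K> \<and> len K = l. exp (- b * real (len K)))
        = real (card {K \<in> \<K>. len K = l}) * exp (- b) ^ l"
      by (simp add: exp_of_nat_mult[symmetric] mult.commute)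
    also have "\<dots> \<le> 128 ^ l * (1 / 256) ^ l"
      by (rule mult_mono[OF le e]) auto
    also have "\<dots> = (1 / 2) ^ l" by (simp add: power_mult_distrib[symmetric])
    finally show "(\<Sum>K | K \<in> \<K> \<and> len K = l. exp (- b * real (len K))) \<le> (1 / 2) ^ l" .
  qed
  also have "\<dots> \<le> (\<Sum>l\<in>{1..<Suc (Max L)}. (1 / 2) ^ l)"
    by (rule sum_mono2) (use finL pos Max_ge[OF finL] in \<open>auto simp: less_Suc_eq_le Suc_le_eq\<close>)
  also have "\<dots> \<le> 1"
  proof -
    have "(\<Sum>l\<in>{1..<Suc n}. (1 / 2 :: real) ^ l) = 1 - (1 / 2) ^ n" for n
      by (induction n) auto
    then show ?thesis by simp
  qed
  finally show ?thesis .
qed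

section \<open>Level contours of a height function\<close>

definition exterior :: "nat \<Rightarrow> (vertex \<Rightarrow> int) \<Rightarrow> int \<Rightarrow> vertex set" where
  "exterior M \<phi> j = {y. \<exists>x. x \<notin> box M \<and> (\<lambda>u v. nearest_nbr u v \<and> \<phi> v < j)\<^sup>*\<^sup>* x y}"

definition component :: "vertex set \<Rightarrow> vertex \<Rightarrow> vertex set" where
  "component S x = {y. (\<lambda>u v. nearest_nbr u v \<and> v \<in> S)\<^sup>*\<^sup>* x y}"

text \<open>The level-\<open>j\<close> cluster of \<open>x\<close> with its holes filled in; its boundary is the outermost contour
  around \<open>x\<close> that separates heights at least \<open>j\<close> from heights below \<open>j\<close>.\<close>

definition filled_cluster :: "nat \<Rightarrow> (vertex \<Rightarrow> int) \<Rightarrow> int \<Rightarrow> vertex \<Rightarrow> vertex set" where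
  "filled_cluster M \<phi> j x = component (- exterior M \<phi> j) x"

lemma exterior_outside: "x \<notin> box M \<Longrightarrow> x \<in> exterior M \<phi> j"
  unfolding exterior_def by blast

lemma exterior_step:
  assumes "x \<in> exterior M \<phi> j" "nearest_nbr x y" "\<phi> y < j"
  shows "y \<in> exterior M \<phi> j"
proof -
  obtain z where "z \<notin> box M" "(\<lambda>u v. nearest_nbr u v \<and> \<phi> v < j)\<^sup>*\<^sup>* z x"
    using assms(1) unfolding exterior_def by blast
  then show ?thesis
    using assms(2,3) rtranclp.rtrancl_into_rtrancl[of "\<lambda>u v. nearest_nbr u v \<and> \<phi> v < j" z x y]
    unfolding exterior_def by blast
qed

lemma exterior_low:
  assumes "\<phi> \<in> configs M" "1 \<le> j" "x \<in> exterior M \<phi> j"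
  shows "\<phi> x < j"
proof -
  obtain z where "z \<notin> box M" and path: "(\<lambda>u v. nearest_nbr u v \<and> \<phi> v < j)\<^sup>*\<^sup>* z x"
    using assms(3) unfolding exterior_def by blast
  then have "\<phi> z = 0" using assms(1) unfolding configs_def by blast
  then have "\<phi> z < j" using assms(2) by simp
  with path show ?thesis by (cases rule: rtranclp.cases) auto
qed

lemma exterior_mono:
  assumes "i \<le> j" shows "exterior M \<phi> i \<subseteq> exterior M \<phi> j"
proof -
  have "(\<lambda>u v. nearest_nbr u v \<and> \<phi> v < i)\<^sup>*\<^sup>* \<le> (\<lambda>u v. nearest_nbr u v \<and> \<phi> v < j)\<^sup>*\<^sup>*"
    by (rule rtranclp_mono) (use assms in auto)
  then show ?thesis unfolding exterior_def by blast
qed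

lemma component_self: "x \<in> component S x"
  by (simp add: component_def)

lemma component_step: "u \<in> component S x \<Longrightarrow> nearest_nbr u v \<Longrightarrow> v \<in> S \<Longrightarrow> v \<in> component S x"
  unfolding component_def by (auto intro: rtranclp.rtrancl_into_rtrancl)

lemma component_subset:
  assumes "x \<in> S" shows "component S x \<subseteq> S"
proof
  fix y assume "y \<in> component S x"
  then have "(\<lambda>u v. nearest_nbr u v \<and> v \<in> S)\<^sup>*\<^sup>* x y" by (simp add: component_def)
  then show "y \<in> S" using assms by (cases rule: rtranclp.cases) auto
qed

lemma component_mono:
  assumes "S \<subseteq> T" shows "component S x \<subseteq> component T x"
proof -
  have "(\<lambda>u v. nearest_nbr u v \<and> v \<in> S)\<^sup>*\<^sup>* \<le> (\<lambda>u v. nearest_nbr u v \<and> v \<in> T)\<^sup>*\<^sup>*"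
    by (rule rtranclp_mono) (use assms in auto)
  then show ?thesis unfolding component_def by blast
qed

text \<open>This covers both a component, with \<open>X\<close> a single point, and an exterior, with \<open>X\<close> the
  complement of the box, which is connected by itself.\<close>

lemma linked_reachable:
  assumes reach: "\<And>y. y \<in> S \<Longrightarrow> \<exists>x\<in>X. (\<lambda>u v. nearest_nbr u v \<and> v \<in> S)\<^sup>*\<^sup>* x y"
    and X: "X \<subseteq> S" "\<And>R. R \<subseteq> S \<Longrightarrow> R \<inter> X \<noteq> {} \<Longrightarrow>
      (\<And>x y. x \<in> R \<Longrightarrow> y \<in> S \<Longrightarrow> nearest_nbr x y \<Longrightarrow> y \<in> R) \<Longrightarrow> X \<subseteq> R"
  shows "linked nearest_nbr S"
  unfolding linked_def
proof (intro allI impI)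
  fix R assume "R \<subseteq> S \<and> R \<noteq> {} \<and> (\<forall>x\<in>R. \<forall>y\<in>S. nearest_nbr x y \<longrightarrow> y \<in> R)"
  then have R: "R \<subseteq> S" "R \<noteq> {}" and cl: "\<And>x y. x \<in> R \<Longrightarrow> y \<in> S \<Longrightarrow> nearest_nbr x y \<Longrightarrow> y \<in> R"
    by blast+
  have backward: "x \<in> R" if "(\<lambda>u v. nearest_nbr u v \<and> v \<in> S)\<^sup>*\<^sup>* x y" "x \<in> S" "y \<in> R" for x y
    using that
  proof (induction rule: rtranclp_induct)
    case (step y z)
    have "y \<in> S" using step.hyps(1) step.prems(1) by (cases rule: rtranclp.cases) auto
    then have "y \<in> R" using cl[of z y] step nearest_nbr_sym by blast
    then show ?case using step by blast
  qed
  have forward: "y \<in> R" if "(\<lambda>u v. nearest_nbr u v \<and> v \<in> S)\<^sup>*\<^sup>* x y" "x \<in> R" for x y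
    using that by (induction rule: rtranclp_induct) (use cl in blast)+
  obtain r where r: "r \<in> R" using R by blast
  then obtain x where x: "x \<in> X" "(\<lambda>u v. nearest_nbr u v \<and> v \<in> S)\<^sup>*\<^sup>* x r"
    using reach[of r] R(1) by blast
  have "x \<in> R" using backward[OF x(2) _ r] x(1) X(1) by blast
  then have "R \<inter> X \<noteq> {}" using x(1) by blast
  from X(2)[OF R(1) this cl] have XR: "X \<subseteq> R" .
  have "S \<subseteq> R"
  proof
    fix y assume "y \<in> S"
    then obtain x where "x \<in> X" "(\<lambda>u v. nearest_nbr u v \<and> v \<in> S)\<^sup>*\<^sup>* x y" using reach by blast
    then show "y \<in> R" using forward XR by blast
  qed
  then show "R = S" using R(1) by blast
qed

lemma linked_component:
  assumes "x \<in> S" shows "linked nearest_nbr (component S x)"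
proof (rule linked_reachable[of _ "{x}"])
  fix y assume "y \<in> component S x"
  then have "(\<lambda>u v. nearest_nbr u v \<and> v \<in> S)\<^sup>*\<^sup>* x y" by (simp add: component_def)
  then have "(\<lambda>u v. nearest_nbr u v \<and> v \<in> component S x)\<^sup>*\<^sup>* x y"
  proof (induction rule: rtranclp_induct)
    case (step y z)
    have "z \<in> component S x"
      using step.hyps unfolding component_def by (auto intro: rtranclp.rtrancl_into_rtrancl)
    then show ?case using step by (auto intro: rtranclp.rtrancl_into_rtrancl)
  qed simp
  then show "\<exists>x'\<in>{x}. (\<lambda>u v. nearest_nbr u v \<and> v \<in> component S x)\<^sup>*\<^sup>* x' y" by simp
qed (auto simp: component_self)

lemma int_line_connected:
  fixes Q :: "int \<Rightarrow> bool"
  assumes "\<And>i. Q i \<longleftrightarrow> Q (i + 1)" shows "Q i \<longleftrightarrow> Q j"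
proof -
  have "Q i \<longleftrightarrow> Q 0" for i
  proof (induction i rule: int_induct[of _ 0])
    case (step2 i)
    then show ?case using assms[of "i - 1"] by simp
  qed (use assms in auto)
  then show ?thesis by blast
qed

text \<open>Every point off the box can move freely along its row or its column, and then to a common
  corner.\<close>

lemma linked_box_complement: "linked nearest_nbr (- box M)"
  unfolding linked_def
proof (intro allI impI)
  fix R assume "R \<subseteq> - box M \<and> R \<noteq> {} \<and> (\<forall>x\<in>R. \<forall>y\<in>- box M. nearest_nbr x y \<longrightarrow> y \<in> R)"
  then have R: "R \<subseteq> - box M" "R \<noteq> {}"
    and cl: "\<And>x y. x \<in> R \<Longrightarrow> y \<notin> box M \<Longrightarrow> nearest_nbr x y \<Longrightarrow> y \<in> R" by blast+
  have iff: "x \<in> R \<longleftrightarrow> y \<in> R" if "x \<notin> box M" "y \<notin> box M" "nearest_nbr x y" for x y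
    using cl that nearest_nbr_sym by blast
  have col: "(a, b) \<in> R \<longleftrightarrow> (a, b') \<in> R" if "int M < \<bar>a\<bar>" for a b b'
    by (rule int_line_connected[of "\<lambda>b. (a, b) \<in> R"], rule iff)
      (use that in \<open>auto simp: box_def nearest_nbr_def\<close>)
  have row: "(a, b) \<in> R \<longleftrightarrow> (a', b) \<in> R" if "int M < \<bar>b\<bar>" for a a' b
    by (rule int_line_connected[of "\<lambda>a. (a, b) \<in> R"], rule iff)
      (use that in \<open>auto simp: box_def nearest_nbr_def\<close>)
  define c where "c = int M + 1"
  have corner: "(a, b) \<in> R \<longleftrightarrow> (c, c) \<in> R" if "(a, b) \<notin> box M" for a b
  proof -
    have "int M < \<bar>a\<bar> \<or> int M < \<bar>b\<bar>" using that by (auto simp: box_def)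
    then show ?thesis
      using col[of a b c] row[of c a c] row[of b a c] col[of c b c] by (auto simp: c_def)
  qed
  obtain r where r: "r \<in> R" using R by blast
  have "y \<in> R" if "y \<notin> box M" for y
    using corner[of "fst y" "snd y"] corner[of "fst r" "snd r"] r R that by auto
  then show "R = - box M" using R by blast
qed

lemma linked_exterior: "linked nearest_nbr (exterior M \<phi> j)"
proof (rule linked_reachable[of _ "- box M"])
  fix y assume "y \<in> exterior M \<phi> j"
  then obtain x where x: "x \<notin> box M" and path: "(\<lambda>u v. nearest_nbr u v \<and> \<phi> v < j)\<^sup>*\<^sup>* x y"
    unfolding exterior_def by blast
  from path have "(\<lambda>u v. nearest_nbr u v \<and> v \<in> exterior M \<phi> j)\<^sup>*\<^sup>* x y"
  proof (induction rule: rtranclp_induct)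
    case (step y z)
    have "y \<in> exterior M \<phi> j" using x step.hyps(1) unfolding exterior_def by blast
    then have "z \<in> exterior M \<phi> j" using step.hyps(2) exterior_step by blast
    then show ?case using step by (auto intro: rtranclp.rtrancl_into_rtrancl)
  qed simp
  then show "\<exists>x\<in>- box M. (\<lambda>u v. nearest_nbr u v \<and> v \<in> exterior M \<phi> j)\<^sup>*\<^sup>* x y" using x by blast
next
  show sub: "- box M \<subseteq> exterior M \<phi> j" using exterior_outside by blast
  fix R assume R: "R \<inter> - box M \<noteq> {}"
    and cl: "\<And>x y. x \<in> R \<Longrightarrow> y \<in> exterior M \<phi> j \<Longrightarrow> nearest_nbr x y \<Longrightarrow> y \<in> R"
  then obtain r where r: "r \<in> R \<inter> - box M" by blast
  have "R \<inter> - box M = - box M"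
  proof (rule linkedD[OF linked_box_complement _ r])
    show "t \<in> R \<inter> - box M" if "s \<in> R \<inter> - box M" "t \<in> - box M" "nearest_nbr s t" for s t
      using cl[of s t] that sub by blast
  qed blast
  then show "- box M \<subseteq> R" by blast
qed

text \<open>The complement of a filled cluster is connected because every part of it that is closed under
  taking neighbours reaches the exterior: otherwise an easternmost point of that part would have its
  eastern neighbour in the part as well.\<close>

lemma filled_cluster_facts:
  assumes x: "x \<notin> exterior M \<phi> j"
  shows "filled_cluster M \<phi> j x \<subseteq> box M"
    and "filled_cluster M \<phi> j x \<inter> exterior M \<phi> j = {}"
    and "contour_at x (filled_cluster M \<phi> j x)"
    and "\<And>u v. u \<in> filled_cluster M \<phi> j x \<Longrightarrow> v \<notin> filled_cluster M \<phi> j x \<Longrightarrow> nearest_nbr u v \<Longrightarrow>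
           v \<in> exterior M \<phi> j \<and> j \<le> \<phi> u"
proof -
  let ?O = "exterior M \<phi> j" and ?K = "filled_cluster M \<phi> j x"
  have xO: "x \<in> - ?O" using x by simp
  show disj: "?K \<inter> ?O = {}" using component_subset[OF xO] by (auto simp: filled_cluster_def)
  then show sub: "?K \<subseteq> box M" using exterior_outside by blast
  have step: "v \<in> ?K" if "u \<in> ?K" "nearest_nbr u v" "v \<notin> ?O" for u v
    using component_step[of u "- ?O" x v] that by (simp add: filled_cluster_def)
  show "v \<in> ?O \<and> j \<le> \<phi> u" if "u \<in> ?K" "v \<notin> ?K" "nearest_nbr u v" for u v
  proof -
    have v: "v \<in> ?O" using step that by blast
    moreover have "u \<notin> ?O" using that disj by blast
    ultimately have "\<not> \<phi> u < j" using exterior_step[OF v nearest_nbr_sym[OF that(3)]] by blast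
    with v show ?thesis by simp
  qed
  have meets: "R \<inter> ?O \<noteq> {}"
    if R: "R \<subseteq> - ?K" "R \<noteq> {}" "\<And>s t. s \<in> R \<Longrightarrow> t \<notin> ?K \<Longrightarrow> nearest_nbr s t \<Longrightarrow> t \<in> R" for R
  proof
    assume empty: "R \<inter> ?O = {}"
    then have "R \<subseteq> box M" using exterior_outside by blast
    then have fin: "finite R" using finite_box finite_subset by blast
    have "Max (fst ` R) \<in> fst ` R" by (rule Max_in[OF finite_imageI[OF fin]]) (simp add: R(2))
    then obtain r where r: "r \<in> R" "fst r = Max (fst ` R)" by auto
    have nn: "nearest_nbr r (east r)" by (simp add: nearest_nbr_def east_def)
    have "east r \<notin> ?K"
    proof
      assume "east r \<in> ?K"
      moreover have "r \<notin> ?O" using r empty by blast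
      ultimately show False using step[OF _ nearest_nbr_sym[OF nn]] r R(1) by blast
    qed
    then have east: "east r \<in> R" using R(3) r nn by blast
    have "fst (east r) \<le> Max (fst ` R)" by (rule Max_ge[OF finite_imageI[OF fin] imageI[OF east]])
    then show False using r by (simp add: east_def)
  qed
  have "linked nearest_nbr (- ?K)"
    unfolding linked_def
  proof (intro allI impI)
    fix R assume "R \<subseteq> - ?K \<and> R \<noteq> {} \<and> (\<forall>x\<in>R. \<forall>y\<in>- ?K. nearest_nbr x y \<longrightarrow> y \<in> R)"
    then have R: "R \<subseteq> - ?K" "R \<noteq> {}"
      and cl: "\<And>s t. s \<in> R \<Longrightarrow> t \<notin> ?K \<Longrightarrow> nearest_nbr s t \<Longrightarrow> t \<in> R" by blast+
    have "R \<inter> ?O \<noteq> {}" using R cl by (rule meets)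
    then obtain z where z: "z \<in> R \<inter> ?O" by (meson ex_in_conv)
    have "R \<inter> ?O = ?O"
    proof (rule linkedD[OF linked_exterior _ z])
      show "t \<in> R \<inter> ?O" if "s \<in> R \<inter> ?O" "t \<in> ?O" "nearest_nbr s t" for s t
        using cl[of s t] that disj by blast
    qed blast
    then have OR: "?O \<subseteq> R" by blast
    have "- ?K - R = {}"
    proof (rule ccontr)
      assume ne: "- ?K - R \<noteq> {}"
      have "(- ?K - R) \<inter> ?O \<noteq> {}"
      proof (rule meets[OF _ ne])
        fix s t assume st: "s \<in> - ?K - R" "t \<notin> ?K" "nearest_nbr s t"
        have "t \<notin> R" using cl[of t s] nearest_nbr_sym[OF st(3)] st(1) by blast
        then show "t \<in> - ?K - R" using st(2) by simp
      qed blast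
      then show False using OR by blast
    qed
    then show "R = - ?K" using R by blast
  qed
  moreover have "linked nearest_nbr ?K" unfolding filled_cluster_def by (rule linked_component[OF xO])
  moreover have "finite ?K" using sub finite_box finite_subset by blast
  moreover have "x \<in> ?K" by (simp add: filled_cluster_def component_self)
  ultimately show "contour_at x ?K" by (simp add: contour_at_def)
qed

lemma filled_cluster_antimono:
  assumes "i \<le> j" shows "filled_cluster M \<phi> j x \<subseteq> filled_cluster M \<phi> i x"
  unfolding filled_cluster_def by (rule component_mono) (use exterior_mono[OF assms] in blast)

section \<open>Peeling off layers\<close>

definition layered :: "(vertex \<Rightarrow> int) \<Rightarrow> int set \<Rightarrow> (int \<Rightarrow> vertex set) \<Rightarrow> bool" where
  "layered \<phi> J \<kappa> \<longleftrightarrow>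
     (\<forall>j\<in>J. \<forall>u v. u \<in> \<kappa> j \<and> v \<notin> \<kappa> j \<and> nearest_nbr u v \<longrightarrow> \<phi> v < j \<and> j \<le> \<phi> u)"

definition layer_sum :: "int set \<Rightarrow> (int \<Rightarrow> vertex set) \<Rightarrow> vertex \<Rightarrow> int" where
  "layer_sum J \<kappa> x = int (card {j \<in> J. x \<in> \<kappa> j})"

lemma powr_superadditive:
  fixes a b p :: real
  assumes "0 \<le> a" "0 \<le> b" "1 \<le> p"
  shows "a powr p + b powr p \<le> (a + b) powr p"
proof -
  have split: "t powr p = t * t powr (p - 1)" if "0 \<le> t" for t :: real
    using powr_mult_base[OF that, of "p - 1"] by simp
  have "a powr p + b powr p \<le> a * (a + b) powr (p - 1) + b * (a + b) powr (p - 1)"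
    unfolding split[OF assms(1)] split[OF assms(2)]
    by (intro add_mono mult_left_mono powr_mono2) (use assms in auto)
  also have "\<dots> = (a + b) powr p" using assms by (simp add: split[of "a + b"] algebra_simps)
  finally show ?thesis .
qed

text \<open>Layers cross an edge only in the direction in which \<open>\<phi>\<close> descends, and each of them uses up one
  of the levels between the two heights.\<close>

lemma layer_slope:
  assumes J: "finite J" and lay: "layered \<phi> J \<kappa>" and xy: "nearest_nbr x y" and le: "\<phi> y \<le> \<phi> x"
  shows "layer_sum J \<kappa> x - layer_sum J \<kappa> y = int (card {j \<in> J. (x \<in> \<kappa> j) \<noteq> (y \<in> \<kappa> j)})"
    and "int (card {j \<in> J. (x \<in> \<kappa> j) \<noteq> (y \<in> \<kappa> j)}) \<le> \<phi> x - \<phi> y"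
proof -
  have yx: "x \<in> \<kappa> j" if "j \<in> J" "y \<in> \<kappa> j" for j
  proof (rule ccontr)
    assume "x \<notin> \<kappa> j"
    then have "\<phi> x < j \<and> j \<le> \<phi> y"
      using lay nearest_nbr_sym[OF xy] that unfolding layered_def by blast
    with le show False by simp
  qed
  define D where "D = {j \<in> J. x \<in> \<kappa> j \<and> y \<notin> \<kappa> j}"
  have D: "{j \<in> J. (x \<in> \<kappa> j) \<noteq> (y \<in> \<kappa> j)} = D" using yx by (auto simp: D_def)
  have "{j \<in> J. x \<in> \<kappa> j} = {j \<in> J. y \<in> \<kappa> j} \<union> D" using yx by (auto simp: D_def)
  then have "card {j \<in> J. x \<in> \<kappa> j} = card {j \<in> J. y \<in> \<kappa> j} + card D"
    by (simp only:) (rule card_Un_disjoint, use J in \<open>auto simp: D_def\<close>)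
  then show "layer_sum J \<kappa> x - layer_sum J \<kappa> y = int (card {j \<in> J. (x \<in> \<kappa> j) \<noteq> (y \<in> \<kappa> j)})"
    unfolding layer_sum_def D by simp
  have "\<phi> y < j \<and> j \<le> \<phi> x" if "j \<in> D" for j
    using lay xy that unfolding D_def layered_def by blast
  then have "D \<subseteq> {\<phi> y <.. \<phi> x}" by auto
  then have "card D \<le> card {\<phi> y <.. \<phi> x}" by (intro card_mono) auto
  then show "int (card {j \<in> J. (x \<in> \<kappa> j) \<noteq> (y \<in> \<kappa> j)}) \<le> \<phi> x - \<phi> y" using le unfolding D by simp
qed

text \<open>So the slopes of the layer sum and of the remainder have the same sign and add up to the slope
  of \<open>\<phi>\<close>, and superadditivity of the power applies. As slopes are integers, their powers are at
  least their absolute values.\<close>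

lemma layer_edge:
  assumes p: "1 \<le> p" and J: "finite J" and lay: "layered \<phi> J \<kappa>" and xy: "nearest_nbr x y"
  defines "\<psi> \<equiv> layer_sum J \<kappa>"
  shows "\<bar>real_of_int (\<psi> x) - real_of_int (\<psi> y)\<bar> powr p
      + \<bar>real_of_int (\<phi> x - \<psi> x) - real_of_int (\<phi> y - \<psi> y)\<bar> powr p
      \<le> \<bar>real_of_int (\<phi> x) - real_of_int (\<phi> y)\<bar> powr p"
    and "real (card {j \<in> J. (x \<in> \<kappa> j) \<noteq> (y \<in> \<kappa> j)}) \<le> \<bar>real_of_int (\<psi> x) - real_of_int (\<psi> y)\<bar> powr p"
proof -
  let ?n = "card {j \<in> J. (x \<in> \<kappa> j) \<noteq> (y \<in> \<kappa> j)}"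
  have *: "\<bar>real_of_int (\<psi> x) - real_of_int (\<psi> y)\<bar> = real ?n \<and>
    \<bar>real_of_int (\<phi> x - \<psi> x) - real_of_int (\<phi> y - \<psi> y)\<bar>
      = \<bar>real_of_int (\<phi> x) - real_of_int (\<phi> y)\<bar> - real ?n \<and>
    real ?n \<le> \<bar>real_of_int (\<phi> x) - real_of_int (\<phi> y)\<bar>"
  proof (cases "\<phi> y \<le> \<phi> x")
    case True
    show ?thesis using layer_slope[OF J lay xy True] by (simp add: \<psi>_def)
  next
    case False
    then have le: "\<phi> x \<le> \<phi> y" by simp
    have "{j \<in> J. (y \<in> \<kappa> j) \<noteq> (x \<in> \<kappa> j)} = {j \<in> J. (x \<in> \<kappa> j) \<noteq> (y \<in> \<kappa> j)}" by auto
    then show ?thesis using layer_slope[OF J lay nearest_nbr_sym[OF xy] le] by (simp add: \<psi>_def)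
  qed
  then show "\<bar>real_of_int (\<psi> x) - real_of_int (\<psi> y)\<bar> powr p
      + \<bar>real_of_int (\<phi> x - \<psi> x) - real_of_int (\<phi> y - \<psi> y)\<bar> powr p
      \<le> \<bar>real_of_int (\<phi> x) - real_of_int (\<phi> y)\<bar> powr p"
    using powr_superadditive[of "real ?n" "\<bar>real_of_int (\<phi> x) - real_of_int (\<phi> y)\<bar> - real ?n" p] p
    by simp
  have "real ?n \<le> real ?n powr p"
  proof (cases "?n = 0")
    case False
    then have "real ?n powr 1 \<le> real ?n powr p" by (intro powr_mono) (use p in auto)
    then show ?thesis by simp
  qed simp
  then show "real ?n \<le> \<bar>real_of_int (\<psi> x) - real_of_int (\<psi> y)\<bar> powr p" using * by simp
qed

lemma hamiltonian_peel:
  assumes p: "1 \<le> p" and J: "finite J" and lay: "layered \<phi> J \<kappa>"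
  shows "hamiltonian p M (layer_sum J \<kappa>) + hamiltonian p M (\<lambda>x. \<phi> x - layer_sum J \<kappa> x)
      \<le> hamiltonian p M \<phi>"
  unfolding hamiltonian_eq_fenergy fenergy_def sum.distrib[symmetric]
  by (intro sum_mono layer_edge(1)[OF p J lay])
    (auto simp: incident_def nearest_nbr_iff_edge)

lemma hamiltonian_layer_sum_ge:
  assumes p: "1 \<le> p" and J: "finite J" and lay: "layered \<phi> J \<kappa>" and box: "\<And>j. j \<in> J \<Longrightarrow> \<kappa> j \<subseteq> box M"
  shows "(\<Sum>j\<in>J. real (card (boundary (\<kappa> j)))) \<le> hamiltonian p M (layer_sum J \<kappa>)"
proof -
  let ?I = "incident (box M)"
  have finI: "finite ?I" by (rule finite_incident[OF finite_box])
  have "(\<Sum>j\<in>J. real (card (boundary (\<kappa> j))))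
      = (\<Sum>j\<in>J. \<Sum>e\<in>?I. if e \<in> boundary (\<kappa> j) then 1 else 0)"
  proof (rule sum.cong[OF refl])
    fix j assume "j \<in> J"
    then have "?I \<inter> boundary (\<kappa> j) = boundary (\<kappa> j)"
      using boundary_subset_incident incident_mono[OF box] by blast
    then show "real (card (boundary (\<kappa> j))) = (\<Sum>e\<in>?I. if e \<in> boundary (\<kappa> j) then 1 else 0)"
      using finI by (simp add: sum.inter_restrict[symmetric])
  qed
  also have "\<dots> = (\<Sum>e\<in>?I. \<Sum>j\<in>J. if e \<in> boundary (\<kappa> j) then 1 else 0)"
    by (rule sum.swap)
  also have "\<dots> = (\<Sum>e\<in>?I. real (card {j \<in> J. (fst e \<in> \<kappa> j) \<noteq> (snd e \<in> \<kappa> j)}))"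
  proof (rule sum.cong[OF refl])
    fix e assume "e \<in> ?I"
    then have "{j \<in> J. e \<in> boundary (\<kappa> j)} = {j \<in> J. (fst e \<in> \<kappa> j) \<noteq> (snd e \<in> \<kappa> j)}"
      by (auto simp: boundary_def incident_def)
    moreover have "(\<Sum>j\<in>J. if e \<in> boundary (\<kappa> j) then 1 else 0) = real (card {j \<in> J. e \<in> boundary (\<kappa> j)})"
      using sum.inter_filter[OF J, of "\<lambda>_. 1::real" "\<lambda>j. e \<in> boundary (\<kappa> j)"] by simp
    ultimately show "(\<Sum>j\<in>J. if e \<in> boundary (\<kappa> j) then 1 else 0)
        = real (card {j \<in> J. (fst e \<in> \<kappa> j) \<noteq> (snd e \<in> \<kappa> j)})" by simp
  qed
  also have "\<dots> \<le> hamiltonian p M (layer_sum J \<kappa>)"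
    unfolding hamiltonian_eq_fenergy fenergy_def
    by (intro sum_mono layer_edge(2)[OF p J lay]) (auto simp: incident_def nearest_nbr_iff_edge)
  finally show ?thesis .
qed

section \<open>The shift argument\<close>

text \<open>The finite-volume measure on a space in which every set of configurations is measurable.\<close>

definition gibbs :: "real \<Rightarrow> real \<Rightarrow> nat \<Rightarrow> (vertex \<Rightarrow> int) measure" where
  "gibbs p \<beta> M = point_measure (configs M)
     (\<lambda>\<phi>. ennreal (exp (- \<beta> * hamiltonian p M \<phi>) / partition_function p \<beta> M))"

text \<open>If the partition function diverges then its value and all quotients by it are zero, and so is the
  mass; otherwise the mass is one. Bounds relative to the mass hold in both cases.\<close>

definition mass :: "real \<Rightarrow> real \<Rightarrow> nat \<Rightarrow> real" where
  "mass p \<beta> M = measure (gibbs p \<beta> M) (configs M)"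

lemma sets_gibbs: "sets (gibbs p \<beta> M) = Pow (configs M)"
  by (simp add: gibbs_def sets_point_measure)

lemma mass_nonneg: "0 \<le> mass p \<beta> M"
  by (simp add: mass_def)

lemma emeasure_gibbs:
  assumes "S \<subseteq> configs M"
  shows "emeasure (gibbs p \<beta> M) S = (\<integral>\<^sup>+ \<phi>. ennreal (exp (- \<beta> * hamiltonian p M \<phi>)
      / partition_function p \<beta> M) \<partial>count_space S)"
proof -
  let ?w = "\<lambda>\<phi>. ennreal (exp (- \<beta> * hamiltonian p M \<phi>) / partition_function p \<beta> M)"
  have "emeasure (gibbs p \<beta> M) S = (\<integral>\<^sup>+ \<phi>. ?w \<phi> * indicator S \<phi> \<partial>count_space (configs M))"
    unfolding gibbs_def point_measure_def by (rule emeasure_density) (use assms in auto)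
  also have "\<dots> = (\<integral>\<^sup>+ \<phi>. ?w \<phi> * indicator S \<phi> * indicator (configs M) \<phi> \<partial>count_space UNIV)"
    by (subst nn_integral_count_space_indicator) simp_all
  also have "\<dots> = (\<integral>\<^sup>+ \<phi>. ?w \<phi> * indicator S \<phi> \<partial>count_space UNIV)"
    by (rule nn_integral_cong) (use assms in \<open>auto simp: indicator_def\<close>)
  also have "\<dots> = (\<integral>\<^sup>+ \<phi>. ?w \<phi> \<partial>count_space S)"
    by (subst (2) nn_integral_count_space_indicator) simp_all
  finally show ?thesis .
qed

text \<open>An injective map that lowers the energy by at least \<open>c\<close> gives a bound on probabilities. The
  value of the normalising constant cancels.\<close>

lemma gibbs_shift:
  assumes fin: "finite_measure (gibbs p \<beta> M)" and b: "0 \<le> \<beta>"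
    and S: "S \<subseteq> configs M" and inj: "inj_on T S" and T: "\<And>\<phi>. \<phi> \<in> S \<Longrightarrow> T \<phi> \<in> S'" and S': "S' \<subseteq> configs M"
    and low: "\<And>\<phi>. \<phi> \<in> S \<Longrightarrow> c + hamiltonian p M (T \<phi>) \<le> hamiltonian p M \<phi>"
  shows "measure (gibbs p \<beta> M) S \<le> exp (- \<beta> * c) * measure (gibbs p \<beta> M) S'"
proof -
  interpret finite_measure "gibbs p \<beta> M" by (rule fin)
  let ?Z = "partition_function p \<beta> M"
  have Z: "0 \<le> ?Z" unfolding partition_function_def by (rule infsum_nonneg) simp
  have TS: "T ` S \<subseteq> S'" using T by blast
  have "emeasure (gibbs p \<beta> M) S
      \<le> (\<integral>\<^sup>+ \<phi>. ennreal (exp (- \<beta> * c)) * ennreal (exp (- \<beta> * hamiltonian p M (T \<phi>)) / ?Z) \<partial>count_space S)"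
    unfolding emeasure_gibbs[OF S]
  proof (rule nn_integral_mono)
    fix \<phi> assume "\<phi> \<in> space (count_space S)"
    then have "\<beta> * (c + hamiltonian p M (T \<phi>)) \<le> \<beta> * hamiltonian p M \<phi>"
      using low b by (intro mult_left_mono) auto
    then have "exp (- \<beta> * hamiltonian p M \<phi>) \<le> exp (- \<beta> * c) * exp (- \<beta> * hamiltonian p M (T \<phi>))"
      by (simp add: mult_exp_exp algebra_simps)
    then have "exp (- \<beta> * hamiltonian p M \<phi>) / ?Z
        \<le> exp (- \<beta> * c) * (exp (- \<beta> * hamiltonian p M (T \<phi>)) / ?Z)"
      using Z by (simp add: divide_right_mono)
    then show "ennreal (exp (- \<beta> * hamiltonian p M \<phi>) / ?Z)
        \<le> ennreal (exp (- \<beta> * c)) * ennreal (exp (- \<beta> * hamiltonian p M (T \<phi>)) / ?Z)"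
      using Z by (simp add: ennreal_mult[symmetric] ennreal_leI)
  qed
  also have "\<dots> = ennreal (exp (- \<beta> * c))
      * (\<integral>\<^sup>+ \<phi>. ennreal (exp (- \<beta> * hamiltonian p M (T \<phi>)) / ?Z) \<partial>count_space S)"
    by (rule nn_integral_cmult) simp
  also have "(\<integral>\<^sup>+ \<phi>. ennreal (exp (- \<beta> * hamiltonian p M (T \<phi>)) / ?Z) \<partial>count_space S)
      = emeasure (gibbs p \<beta> M) (T ` S)"
    unfolding emeasure_gibbs[OF subset_trans[OF TS S']]
    by (rule nn_integral_bij_count_space[OF inj_on_imp_bij_betw[OF inj]])
  also have "\<dots> \<le> emeasure (gibbs p \<beta> M) S'"
    by (rule emeasure_mono[OF TS]) (use S' in \<open>simp add: sets_gibbs\<close>)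
  finally have "ennreal (measure (gibbs p \<beta> M) S)
      \<le> ennreal (exp (- \<beta> * c)) * ennreal (measure (gibbs p \<beta> M) S')"
    by (simp add: emeasure_eq_measure mult_left_mono)
  then show ?thesis by (simp add: ennreal_mult[symmetric] ennreal_le_iff)
qed

lemma gibbs_union_bound:
  assumes fin: "finite_measure (gibbs p \<beta> M)" and I: "finite I"
    and S: "S \<subseteq> (\<Union>i\<in>I. A i)" and A: "\<And>i. i \<in> I \<Longrightarrow> A i \<subseteq> configs M"
    and bound: "\<And>i. i \<in> I \<Longrightarrow> measure (gibbs p \<beta> M) (A i) \<le> b i"
  shows "measure (gibbs p \<beta> M) S \<le> (\<Sum>i\<in>I. b i)"
proof -
  interpret finite_measure "gibbs p \<beta> M" by (rule fin)
  have "measure (gibbs p \<beta> M) S \<le> measure (gibbs p \<beta> M) (\<Union>i\<in>I. A i)"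
    by (rule finite_measure_mono[OF S]) (use A in \<open>auto simp: sets_gibbs\<close>)
  also have "\<dots> \<le> (\<Sum>i\<in>I. measure (gibbs p \<beta> M) (A i))"
    by (rule finite_measure_subadditive_finite[OF I]) (use A in \<open>auto simp: sets_gibbs\<close>)
  also have "\<dots> \<le> (\<Sum>i\<in>I. b i)" by (rule sum_mono[OF bound])
  finally show ?thesis .
qed

lemma gibbs_mono:
  assumes "finite_measure (gibbs p \<beta> M)" "S \<subseteq> S'" "S' \<subseteq> configs M"
  shows "measure (gibbs p \<beta> M) S \<le> measure (gibbs p \<beta> M) S'"
  using finite_measure.finite_measure_mono[OF assms(1,2)] assms(3) by (simp add: sets_gibbs)

section \<open>Upper bounds\<close>

lemma layer_sum_outside:
  assumes "\<And>j. j \<in> J \<Longrightarrow> \<kappa> j \<subseteq> B" "x \<notin> B"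
  shows "layer_sum J \<kappa> x = 0"
proof -
  have none: "{j \<in> J. x \<in> \<kappa> j} = {}" using assms by blast
  show ?thesis unfolding layer_sum_def none by simp
qed

lemma layer_sum_full:
  assumes "\<And>j. j \<in> J \<Longrightarrow> x \<in> \<kappa> j"
  shows "layer_sum J \<kappa> x = int (card J)"
proof -
  have all: "{j \<in> J. x \<in> \<kappa> j} = J" using assms by blast
  show ?thesis unfolding layer_sum_def all ..
qed

text \<open>Subtracting a fixed layer sum is injective and gains its energy.\<close>

lemma gibbs_layers:
  assumes fin: "finite_measure (gibbs p \<beta> M)" and p: "1 < p" and b: "0 \<le> \<beta>"
    and S: "S \<subseteq> configs M" and J: "finite J" and box: "\<And>j. j \<in> J \<Longrightarrow> \<kappa> j \<subseteq> box M"
    and lay: "\<And>\<phi>. \<phi> \<in> S \<Longrightarrow> layered \<phi> J \<kappa>"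
  shows "measure (gibbs p \<beta> M) S \<le> exp (- \<beta> * hamiltonian p M (layer_sum J \<kappa>)) * mass p \<beta> M"
  unfolding mass_def
proof (rule gibbs_shift[OF fin b S, where T = "\<lambda>\<phi> x. \<phi> x - layer_sum J \<kappa> x"])
  show "inj_on (\<lambda>\<phi> x. \<phi> x - layer_sum J \<kappa> x) S"
    by (rule inj_onI) (simp add: fun_eq_iff)
  show "(\<lambda>x. \<phi> x - layer_sum J \<kappa> x) \<in> configs M" if "\<phi> \<in> S" for \<phi>
    using S that layer_sum_outside[OF box] unfolding configs_def by auto
  show "hamiltonian p M (layer_sum J \<kappa>) + hamiltonian p M (\<lambda>x. \<phi> x - layer_sum J \<kappa> x)
      \<le> hamiltonian p M \<phi>" if "\<phi> \<in> S" for \<phi>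
    by (rule hamiltonian_peel) (use p J lay that in auto)
qed simp

lemma hamiltonian_scaled:
  assumes "0 < t"
  shows "fenergy p (incident (box M)) (\<lambda>x. real_of_int (\<psi> x) / t) = hamiltonian p M \<psi> / t powr p"
proof -
  have "\<bar>real_of_int a / t - real_of_int b / t\<bar> powr p = \<bar>real_of_int a - real_of_int b\<bar> powr p / t powr p"
    for a b
    using assms by (simp add: diff_divide_distrib[symmetric] abs_divide powr_divide)
  then show ?thesis
    unfolding hamiltonian_eq_fenergy fenergy_def by (simp add: sum_divide_distrib)
qed

lemma filled_cluster_layered:
  assumes "\<phi> \<in> configs M" and J: "\<And>j. j \<in> J \<Longrightarrow> 1 \<le> j" and x: "\<And>j x. j \<in> J \<Longrightarrow> x \<in> X \<Longrightarrow> x \<notin> exterior M \<phi> j"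
  shows "layered \<phi> J (\<lambda>j. \<Union>x\<in>X. filled_cluster M \<phi> j x)"
  unfolding layered_def
proof (intro ballI allI impI)
  fix j u v
  assume j: "j \<in> J" and uv: "u \<in> (\<Union>x\<in>X. filled_cluster M \<phi> j x) \<and>
      v \<notin> (\<Union>x\<in>X. filled_cluster M \<phi> j x) \<and> nearest_nbr u v"
  then obtain x where "x \<in> X" "u \<in> filled_cluster M \<phi> j x" "v \<notin> filled_cluster M \<phi> j x" by blast
  then have "v \<in> exterior M \<phi> j \<and> j \<le> \<phi> u"
    using filled_cluster_facts(4)[OF x[OF j]] uv by blast
  then show "\<phi> v < j \<and> j \<le> \<phi> u" using exterior_low[OF assms(1) J[OF j]] by blast
qed

lemma layered_cong: "(\<And>j. j \<in> J \<Longrightarrow> \<kappa> j = \<kappa>' j) \<Longrightarrow> layered \<phi> J \<kappa> \<longleftrightarrow> layered \<phi> J \<kappa>'"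
  by (simp add: layered_def)

text \<open>The Sobolev lower bound for the \<open>p\<close>-capacity of a set of \<open>n\<close> points.\<close>

definition decay_rate :: "real \<Rightarrow> nat \<Rightarrow> real" where
  "decay_rate p n = real n powr ((2 - p) / 2) / sobolev_const p"

text \<open>A crude bound with the right power of the height. Half of the energy of the peeled layers
  pays for the choice of the \<open>m\<close> contours, and the other half is at least the capacity of a set of
  \<open>n\<close> points times \<open>m\<close> to the power \<open>p\<close>.\<close>

lemma large_cluster_unlikely:
  assumes fin: "finite_measure (gibbs p \<beta> M)" and p: "1 < p" "p < 2" and b: "2 * ln 256 \<le> \<beta>"
    and m: "1 \<le> m"
  shows "measure (gibbs p \<beta> M)
      {\<phi> \<in> configs M. x \<notin> exterior M \<phi> m \<and> n \<le> card (filled_cluster M \<phi> m x)}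
    \<le> exp (- (\<beta> / 2) * (decay_rate p n * real_of_int m powr p)) * mass p \<beta> M"
proof -
  define S where "S = {\<phi> \<in> configs M. x \<notin> exterior M \<phi> m \<and> n \<le> card (filled_cluster M \<phi> m x)}"
  define J where "J = {1..m}"
  define Ks where "Ks = {K. contour_at x K \<and> K \<subseteq> box M}"
  define D where "D = decay_rate p n * real_of_int m powr p"
  define S' where "S' \<kappa> = {\<phi> \<in> S. \<forall>j\<in>J. filled_cluster M \<phi> j x = \<kappa> j}" for \<kappa>
  define w where "w K = exp (- (\<beta> / 2) * real (card (boundary K)))" for K
  have finJ: "finite J" by (simp add: J_def)
  have finK: "finite Ks" by (rule finite_subset[of _ "Pow (box M)"]) (auto simp: Ks_def finite_box)
  have b0: "0 \<le> \<beta>" using b ln_ge_zero[of 256] by linarith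
  have ext: "x \<notin> exterior M \<phi> j" if "\<phi> \<in> S" "j \<in> J" for \<phi> j
    using that exterior_mono[of j m M \<phi>] by (auto simp: S_def J_def)
  have "measure (gibbs p \<beta> M) S
      \<le> (\<Sum>\<kappa>\<in>PiE J (\<lambda>_. Ks). exp (- (\<beta> / 2) * D) * mass p \<beta> M * (\<Prod>j\<in>J. w (\<kappa> j)))"
  proof (rule gibbs_union_bound[OF fin, where A = S'])
    show "finite (PiE J (\<lambda>_. Ks))" by (intro finite_PiE finJ finK)
    show "S \<subseteq> (\<Union>\<kappa>\<in>PiE J (\<lambda>_. Ks). S' \<kappa>)"
    proof
      fix \<phi> assume phi: "\<phi> \<in> S"
      define \<kappa> where "\<kappa> = restrict (\<lambda>j. filled_cluster M \<phi> j x) J"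
      have "\<kappa> \<in> PiE J (\<lambda>_. Ks)"
        using filled_cluster_facts(1,3)[OF ext[OF phi]] by (auto simp: \<kappa>_def Ks_def)
      moreover have "\<phi> \<in> S' \<kappa>" using phi by (simp add: S'_def \<kappa>_def)
      ultimately show "\<phi> \<in> (\<Union>\<kappa>\<in>PiE J (\<lambda>_. Ks). S' \<kappa>)" by blast
    qed
    show "S' \<kappa> \<subseteq> configs M" for \<kappa> by (auto simp: S'_def S_def)
    show "measure (gibbs p \<beta> M) (S' \<kappa>) \<le> exp (- (\<beta> / 2) * D) * mass p \<beta> M * (\<Prod>j\<in>J. w (\<kappa> j))"
      if \<kappa>: "\<kappa> \<in> PiE J (\<lambda>_. Ks)" for \<kappa>
    proof (cases "S' \<kappa> = {}")
      case True
      then show ?thesis using mass_nonneg by (simp add: w_def prod_nonneg)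
    next
      case False
      then obtain \<phi>0 where phi0: "\<phi>0 \<in> S" "\<And>j. j \<in> J \<Longrightarrow> filled_cluster M \<phi>0 j x = \<kappa> j"
        by (auto simp: S'_def)
      have box: "\<kappa> j \<subseteq> box M" if "j \<in> J" for j using \<kappa> that by (auto simp: Ks_def PiE_iff)
      have lay: "layered \<phi> J \<kappa>" if "\<phi> \<in> S' \<kappa>" for \<phi>
      proof -
        have phi: "\<phi> \<in> S" and eq: "\<And>j. j \<in> J \<Longrightarrow> filled_cluster M \<phi> j x = \<kappa> j"
          using that by (simp_all add: S'_def)
        have "layered \<phi> J (\<lambda>j. \<Union>y\<in>{x}. filled_cluster M \<phi> j y)"
        proof (rule filled_cluster_layered)
          show "\<phi> \<in> configs M" using phi by (simp add: S_def)
          show "1 \<le> j" if "j \<in> J" for j using that by (simp add: J_def)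
          show "y \<notin> exterior M \<phi> j" if "j \<in> J" "y \<in> {x}" for j y
            using ext[OF phi that(1)] that(2) by simp
        qed
        moreover have "layered \<phi> J (\<lambda>j. \<Union>y\<in>{x}. filled_cluster M \<phi> j y) \<longleftrightarrow> layered \<phi> J \<kappa>"
          by (rule layered_cong) (simp add: eq)
        ultimately show ?thesis by simp
      qed
      define \<psi> where "\<psi> = layer_sum J \<kappa>"
      define H where "H = hamiltonian p M \<psi>"
      have lay0: "layered \<phi>0 J \<kappa>" using lay phi0 by (simp add: S'_def)
      have H1: "(\<Sum>j\<in>J. real (card (boundary (\<kappa> j)))) \<le> H"
        unfolding H_def \<psi>_def by (rule hamiltonian_layer_sum_ge[OF _ finJ lay0 box]) (use p in auto)
      have mJ: "m \<in> J" using m by (simp add: J_def)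
      have top: "real_of_int (\<psi> y) / real_of_int m = 1" if "y \<in> \<kappa> m" for y
      proof -
        have "y \<in> \<kappa> j" if "j \<in> J" for j
        proof -
          have "filled_cluster M \<phi>0 m x \<subseteq> filled_cluster M \<phi>0 j x"
            by (rule filled_cluster_antimono) (use that in \<open>simp add: J_def\<close>)
          then have "\<kappa> m \<subseteq> \<kappa> j" by (simp only: phi0(2)[OF that] phi0(2)[OF mJ])
          then show ?thesis using \<open>y \<in> \<kappa> m\<close> by blast
        qed
        then have "\<psi> y = int (card J)" unfolding \<psi>_def by (rule layer_sum_full)
        then show ?thesis using m by (simp add: J_def)
      qed
      have "real n powr ((2 - p) / 2) \<le> real (card (\<kappa> m)) powr ((2 - p) / 2)"
        using phi0 mJ p by (intro powr_mono2) (auto simp: S_def)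
      also have "\<dots> \<le> sobolev_const p * fenergy p (incident (box M)) (\<lambda>y. real_of_int (\<psi> y) / real_of_int m)"
      proof (rule card_superlevel_bound[OF p])
        show "0 \<le> real_of_int (\<psi> v) / real_of_int m" for v
          using m by (simp add: \<psi>_def layer_sum_def)
        show "real_of_int (\<psi> v) / real_of_int m = 0" if "v \<notin> box M" for v
          using layer_sum_outside[OF box that] by (simp add: \<psi>_def)
      qed (use box[OF mJ] top in auto)
      also have "\<dots> = sobolev_const p * (H / real_of_int m powr p)"
        using m by (simp add: hamiltonian_scaled H_def)
      finally have H2: "D \<le> H"
        using m sobolev_const_pos[OF p] by (simp add: D_def decay_rate_def field_simps)
      have "measure (gibbs p \<beta> M) (S' \<kappa>) \<le> exp (- \<beta> * H) * mass p \<beta> M"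
        unfolding H_def \<psi>_def
        by (rule gibbs_layers[OF fin p(1) b0 _ finJ box lay]) (auto simp: S'_def S_def)
      also have "exp (- \<beta> * H) \<le> exp (- (\<beta> / 2) * D) * (\<Prod>j\<in>J. w (\<kappa> j))"
      proof -
        have "(\<beta> / 2) * (D + (\<Sum>j\<in>J. real (card (boundary (\<kappa> j))))) \<le> (\<beta> / 2) * (H + H)"
          using b0 H1 H2 by (intro mult_left_mono add_mono) auto
        then have "exp (- \<beta> * H) \<le> exp (- (\<beta> / 2) * D + - (\<beta> / 2) * (\<Sum>j\<in>J. real (card (boundary (\<kappa> j)))))"
          by (simp add: algebra_simps)
        also have "\<dots> = exp (- (\<beta> / 2) * D) * (\<Prod>j\<in>J. w (\<kappa> j))"
          unfolding w_def exp_sum[OF finJ, symmetric] sum_distrib_left exp_add ..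
        finally show ?thesis .
      qed
      finally show ?thesis using mass_nonneg by (simp add: mult_right_mono mult_ac)
    qed
  qed
  also have "\<dots> = exp (- (\<beta> / 2) * D) * mass p \<beta> M * (\<Prod>j\<in>J. \<Sum>K\<in>Ks. w K)"
    by (subst prod_sum_PiE[OF finJ finK]) (rule sum_distrib_left[symmetric])
  also have "\<dots> \<le> exp (- (\<beta> / 2) * D) * mass p \<beta> M * 1"
  proof (rule mult_left_mono)
    show "(\<Prod>j\<in>J. \<Sum>K\<in>Ks. w K) \<le> 1"
    proof (rule prod_le_1)
      have "(\<Sum>K\<in>Ks. w K) \<le> 1"
        unfolding w_def by (rule contour_sum_le_1[OF finK]) (use b in \<open>auto simp: Ks_def\<close>)
      then show "0 \<le> (\<Sum>K\<in>Ks. w K) \<and> (\<Sum>K\<in>Ks. w K) \<le> 1"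
        by (simp add: w_def sum_nonneg)
    qed
  qed (simp add: mass_nonneg)
  finally show ?thesis by (simp add: S_def D_def)
qed

lemma high_not_exterior: "\<phi> \<in> configs M \<Longrightarrow> 1 \<le> j \<Longrightarrow> j \<le> \<phi> x \<Longrightarrow> x \<notin> exterior M \<phi> j"
  using exterior_low[of \<phi> M j x] by force

lemma high_point_unlikely:
  assumes fin: "finite_measure (gibbs p \<beta> M)" and p: "1 < p" "p < 2" and b: "2 * ln 256 \<le> \<beta>"
    and m: "1 \<le> m"
  shows "measure (gibbs p \<beta> M) {\<phi> \<in> configs M. m \<le> \<phi> x}
    \<le> exp (- (\<beta> / 2) * (decay_rate p 1 * real_of_int m powr p)) * mass p \<beta> M"
proof -
  have "measure (gibbs p \<beta> M) {\<phi> \<in> configs M. m \<le> \<phi> x} \<le> measure (gibbs p \<beta> M)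
      {\<phi> \<in> configs M. x \<notin> exterior M \<phi> m \<and> 1 \<le> card (filled_cluster M \<phi> m x)}"
  proof (rule gibbs_mono[OF fin])
    show "{\<phi> \<in> configs M. m \<le> \<phi> x}
        \<subseteq> {\<phi> \<in> configs M. x \<notin> exterior M \<phi> m \<and> 1 \<le> card (filled_cluster M \<phi> m x)}"
    proof clarify
      fix \<phi> assume phi: "\<phi> \<in> configs M" "m \<le> \<phi> x"
      have ext: "x \<notin> exterior M \<phi> m" by (rule high_not_exterior[OF phi(1) m phi(2)])
      have "contour_at x (filled_cluster M \<phi> m x)" by (rule filled_cluster_facts(3)[OF ext])
      then have "0 < card (filled_cluster M \<phi> m x)" by (auto simp: contour_at_def card_gt_0_iff)
      then show "x \<notin> exterior M \<phi> m \<and> 1 \<le> card (filled_cluster M \<phi> m x)" using ext by simp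
    qed
  qed auto
  also have "\<dots> \<le> exp (- (\<beta> / 2) * (decay_rate p 1 * real_of_int m powr p)) * mass p \<beta> M"
    by (rule large_cluster_unlikely[OF fin p b m])
  finally show ?thesis .
qed

lemma low_point_unlikely:
  assumes fin: "finite_measure (gibbs p \<beta> M)" and p: "1 < p" "p < 2" and b: "2 * ln 256 \<le> \<beta>"
    and m: "1 \<le> m"
  shows "measure (gibbs p \<beta> M) {\<phi> \<in> configs M. \<phi> x \<le> - m}
    \<le> exp (- (\<beta> / 2) * (decay_rate p 1 * real_of_int m powr p)) * mass p \<beta> M"
proof -
  have b0: "0 \<le> \<beta>" using b ln_ge_zero[of 256] by linarith
  have "measure (gibbs p \<beta> M) {\<phi> \<in> configs M. \<phi> x \<le> - m}
      \<le> exp (- \<beta> * 0) * measure (gibbs p \<beta> M) {\<phi> \<in> configs M. m \<le> \<phi> x}"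
  proof (rule gibbs_shift[OF fin b0, where T = "\<lambda>\<phi> y. - \<phi> y"])
    show "inj_on (\<lambda>\<phi> y. - \<phi> y) {\<phi> \<in> configs M. \<phi> x \<le> - m}"
      by (rule inj_onI) (simp add: fun_eq_iff)
    show "(\<lambda>y. - \<phi> y) \<in> {\<phi> \<in> configs M. m \<le> \<phi> x}" if "\<phi> \<in> {\<phi> \<in> configs M. \<phi> x \<le> - m}" for \<phi>
      using that unfolding configs_def by auto
    show "0 + hamiltonian p M (\<lambda>y. - \<phi> y) \<le> hamiltonian p M \<phi>" for \<phi>
      unfolding hamiltonian_eq_fenergy fenergy_def by (simp add: abs_minus_commute)
  qed auto
  then show ?thesis using high_point_unlikely[OF fin p b m, of x] by simp
qed

text \<open>A bound for the number of contours around a given point that enclose at most \<open>n\<close> points,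
  because \<open>n\<close> points have at most \<open>4 n\<close> incident edges.\<close>

definition short_contours :: "nat \<Rightarrow> nat" where
  "short_contours n = (\<Sum>l\<le>4 * n. 128 ^ l)"

lemma card_small_contours:
  "finite {K. contour_at x K \<and> card K \<le> n} \<and> card {K. contour_at x K \<and> card K \<le> n} \<le> short_contours n"
proof -
  let ?U = "\<Union>l\<le>4 * n. {K. contour_at x K \<and> card (boundary K) = l}"
  have sub: "{K. contour_at x K \<and> card K \<le> n} \<subseteq> ?U"
  proof clarify
    fix K assume K: "contour_at x K" "card K \<le> n"
    then have fin: "finite K" by (simp add: contour_at_def)
    have "card (boundary K) \<le> card (incident K)"
      by (rule card_mono[OF finite_incident[OF fin] boundary_subset_incident])
    also have "\<dots> \<le> 4 * n" using card_incident_le[OF fin] K(2) by simp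
    finally show "K \<in> ?U" using K(1) by simp
  qed
  have finU: "finite ?U" using card_contours by blast
  have "card ?U \<le> (\<Sum>l\<le>4 * n. card {K. contour_at x K \<and> card (boundary K) = l})"
    by (rule card_UN_le) simp
  also have "\<dots> \<le> short_contours n"
    unfolding short_contours_def using card_contours by (intro sum_mono) blast
  finally show ?thesis using card_mono[OF finU sub] finite_subset[OF sub finU] by simp
qed

text \<open>When the clusters of the points of \<open>A\<close> above level \<open>m\<close> are small there are few
  possibilities for the layers above \<open>m\<close>, and the full energy of these layers is gained.\<close>

lemma small_clusters_bound:
  assumes fin: "finite_measure (gibbs p \<beta> M)" and p: "1 < p" "p < 2" and b: "0 \<le> \<beta>"
    and A: "finite A" and m: "0 \<le> m" "m < h"
  shows "measure (gibbs p \<beta> M)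
      {\<phi> \<in> configs M. \<forall>x\<in>A. h \<le> \<phi> x \<and> card (filled_cluster M \<phi> (m + 1) x) \<le> n}
    \<le> real (short_contours n) ^ (nat (h - m) * card A)
      * exp (- \<beta> * (cap_energy p A * real_of_int (h - m) powr p)) * mass p \<beta> M"
proof -
  define S where "S = {\<phi> \<in> configs M. \<forall>x\<in>A. h \<le> \<phi> x \<and> card (filled_cluster M \<phi> (m + 1) x) \<le> n}"
  define J where "J = {m + 1..h}"
  define Ks where "Ks x = {K. contour_at x K \<and> card K \<le> n}" for x
  define S' where "S' \<kappa> = {\<phi> \<in> S. \<forall>j\<in>J. \<forall>x\<in>A. filled_cluster M \<phi> j x = \<kappa> (j, x)}" for \<kappa>
  define I where "I = PiE (J \<times> A) (\<lambda>(j, x). Ks x)"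
  define B where "B = exp (- \<beta> * (cap_energy p A * real_of_int (h - m) powr p)) * mass p \<beta> M"
  have finJ: "finite J" by (simp add: J_def)
  have ext: "x \<notin> exterior M \<phi> j" if "\<phi> \<in> S" "j \<in> J" "x \<in> A" for \<phi> j x
    using that m high_not_exterior[of \<phi> M j x] by (force simp: S_def J_def)
  have "measure (gibbs p \<beta> M) S \<le> (\<Sum>\<kappa>\<in>I. B)"
  proof (rule gibbs_union_bound[OF fin, where A = S'])
    show "finite I"
      unfolding I_def using card_small_contours finJ A by (intro finite_PiE) (auto simp: Ks_def)
    show "S \<subseteq> (\<Union>\<kappa>\<in>I. S' \<kappa>)"
    proof
      fix \<phi> assume phi: "\<phi> \<in> S"
      define \<kappa> where "\<kappa> = restrict (\<lambda>(j, x). filled_cluster M \<phi> j x) (J \<times> A)"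
      have "filled_cluster M \<phi> j x \<in> Ks x" if jx: "j \<in> J" "x \<in> A" for j x
      proof -
        have m1: "m + 1 \<in> J" using m by (simp add: J_def)
        have "contour_at x (filled_cluster M \<phi> (m + 1) x)"
          by (rule filled_cluster_facts(3)[OF ext[OF phi m1 jx(2)]])
        then have "card (filled_cluster M \<phi> j x) \<le> card (filled_cluster M \<phi> (m + 1) x)"
          by (intro card_mono filled_cluster_antimono) (use jx in \<open>auto simp: contour_at_def J_def\<close>)
        also have "\<dots> \<le> n" using phi jx by (simp add: S_def)
        finally show ?thesis
          using filled_cluster_facts(3)[OF ext[OF phi jx]] by (simp add: Ks_def)
      qed
      then have "\<kappa> \<in> I" unfolding I_def \<kappa>_def by auto
      moreover have "\<phi> \<in> S' \<kappa>" using phi by (simp add: S'_def \<kappa>_def)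
      ultimately show "\<phi> \<in> (\<Union>\<kappa>\<in>I. S' \<kappa>)" by blast
    qed
    show "S' \<kappa> \<subseteq> configs M" for \<kappa> by (auto simp: S'_def S_def)
    show "measure (gibbs p \<beta> M) (S' \<kappa>) \<le> B" for \<kappa>
    proof (cases "S' \<kappa> = {}")
      case True
      then show ?thesis using mass_nonneg by (simp add: B_def)
    next
      case False
      then obtain \<phi>0 where phi0: "\<phi>0 \<in> S" "\<And>j x. j \<in> J \<Longrightarrow> x \<in> A \<Longrightarrow> filled_cluster M \<phi>0 j x = \<kappa> (j, x)"
        by (auto simp: S'_def)
      define \<kappa>' where "\<kappa>' j = (\<Union>x\<in>A. \<kappa> (j, x))" for j
      have box: "\<kappa>' j \<subseteq> box M" if "j \<in> J" for j
        unfolding \<kappa>'_def using filled_cluster_facts(1)[OF ext[OF phi0(1) that]] phi0(2)[OF that] by blast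
      have lay: "layered \<phi> J \<kappa>'" if "\<phi> \<in> S' \<kappa>" for \<phi>
      proof -
        have phi: "\<phi> \<in> S"
          and eq: "\<And>j x. j \<in> J \<Longrightarrow> x \<in> A \<Longrightarrow> filled_cluster M \<phi> j x = \<kappa> (j, x)"
          using that by (simp_all add: S'_def)
        have "layered \<phi> J (\<lambda>j. \<Union>y\<in>A. filled_cluster M \<phi> j y)"
        proof (rule filled_cluster_layered)
          show "\<phi> \<in> configs M" using phi by (simp add: S_def)
          show "1 \<le> j" if "j \<in> J" for j using that m by (simp add: J_def)
          show "y \<notin> exterior M \<phi> j" if "j \<in> J" "y \<in> A" for j y
            by (rule ext[OF phi that])
        qed
        moreover have "layered \<phi> J (\<lambda>j. \<Union>y\<in>A. filled_cluster M \<phi> j y) \<longleftrightarrow> layered \<phi> J \<kappa>'"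
          by (rule layered_cong) (simp add: eq \<kappa>'_def)
        ultimately show ?thesis by simp
      qed
      define \<psi> where "\<psi> = layer_sum J \<kappa>'"
      have top: "real_of_int (\<psi> x) / real_of_int (h - m) = 1" if x: "x \<in> A" for x
      proof -
        have "x \<in> \<kappa>' j" if j: "j \<in> J" for j
        proof -
          have "contour_at x (filled_cluster M \<phi>0 j x)"
            by (rule filled_cluster_facts(3)[OF ext[OF phi0(1) j x]])
          then show ?thesis using x phi0(2)[OF j x] by (auto simp: contour_at_def \<kappa>'_def)
        qed
        then have "\<psi> x = int (card J)" unfolding \<psi>_def by (rule layer_sum_full)
        then show ?thesis using m by (simp add: J_def)
      qed
      have "cap_energy p A \<le> fenergy p (incident (box M)) (\<lambda>x. real_of_int (\<psi> x) / real_of_int (h - m))"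
      proof (rule cap_energy_le_fenergy[OF p A])
        show "1 \<le> real_of_int (\<psi> x) / real_of_int (h - m)" if "x \<in> A" for x using top[OF that] by simp
        show "real_of_int (\<psi> x) / real_of_int (h - m) = 0" if "x \<notin> box M" for x
          using layer_sum_outside[OF box that] by (simp add: \<psi>_def)
      qed
      also have "\<dots> = hamiltonian p M \<psi> / real_of_int (h - m) powr p"
        by (rule hamiltonian_scaled) (use m in simp)
      finally have H: "cap_energy p A * real_of_int (h - m) powr p \<le> hamiltonian p M \<psi>"
        using m by (simp add: field_simps)
      have "measure (gibbs p \<beta> M) (S' \<kappa>) \<le> exp (- \<beta> * hamiltonian p M \<psi>) * mass p \<beta> M"
        unfolding \<psi>_def
        by (rule gibbs_layers[OF fin p(1) b _ finJ box lay]) (auto simp: S'_def S_def)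
      also have "\<dots> \<le> B"
        unfolding B_def using H b by (intro mult_right_mono) (auto simp: mult_left_mono mass_nonneg)
      finally show ?thesis .
    qed
  qed
  also have "(\<Sum>\<kappa>\<in>I. B) = real (card I) * B" by simp
  also have "\<dots> \<le> real (short_contours n) ^ (nat (h - m) * card A) * B"
  proof (rule mult_right_mono)
    have "card I = (\<Prod>jx\<in>J \<times> A. card (Ks (snd jx)))"
      unfolding I_def using finJ A by (subst card_PiE) (auto simp: case_prod_unfold)
    also have "\<dots> \<le> (\<Prod>jx\<in>J \<times> A. short_contours n)"
      using card_small_contours by (intro prod_mono) (auto simp: Ks_def)
    also have "\<dots> = short_contours n ^ (nat (h - m) * card A)"
      by (simp add: J_def card_cartesian_product)
    finally show "real (card I) \<le> real (short_contours n) ^ (nat (h - m) * card A)"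
      by (metis of_nat_le_iff of_nat_power)
  qed (simp add: B_def mass_nonneg)
  finally show ?thesis by (simp add: S_def B_def mult.assoc)
qed

lemma finite_volume_upper_bound:
  assumes fin: "finite_measure (gibbs p \<beta> M)" and p: "1 < p" "p < 2" and b: "2 * ln 256 \<le> \<beta>"
    and A: "finite A" and m: "0 \<le> m" "m < h"
  shows "measure (gibbs p \<beta> M) {\<phi> \<in> configs M. \<forall>x\<in>A. h \<le> \<phi> x}
    \<le> (real (short_contours n) ^ (nat (h - m) * card A)
        * exp (- \<beta> * (cap_energy p A * real_of_int (h - m) powr p))
      + real (card A) * exp (- (\<beta> / 2) * (decay_rate p (Suc n) * real_of_int (m + 1) powr p)))
      * mass p \<beta> M"
proof -
  have b0: "0 \<le> \<beta>" using b ln_ge_zero[of 256] by linarith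
  let ?good = "{\<phi> \<in> configs M. \<forall>x\<in>A. h \<le> \<phi> x \<and> card (filled_cluster M \<phi> (m + 1) x) \<le> n}"
  define bad where "bad x = {\<phi> \<in> configs M. x \<notin> exterior M \<phi> (m + 1) \<and>
      Suc n \<le> card (filled_cluster M \<phi> (m + 1) x)}" for x
  define c where "c = exp (- (\<beta> / 2) * (decay_rate p (Suc n) * real_of_int (m + 1) powr p)) * mass p \<beta> M"
  have bad_le: "measure (gibbs p \<beta> M) (\<Union>x\<in>A. bad x) \<le> (\<Sum>x\<in>A. c)"
  proof (rule gibbs_union_bound[OF fin A, where A = bad])
    show "measure (gibbs p \<beta> M) (bad x) \<le> c" for x
      unfolding bad_def c_def by (rule large_cluster_unlikely[OF fin p b]) (use m in simp)
  qed (auto simp: bad_def)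
  have "{\<phi> \<in> configs M. \<forall>x\<in>A. h \<le> \<phi> x} \<subseteq> ?good \<union> (\<Union>x\<in>A. bad x)"
  proof
    fix \<phi> assume phi: "\<phi> \<in> {\<phi> \<in> configs M. \<forall>x\<in>A. h \<le> \<phi> x}"
    have "x \<notin> exterior M \<phi> (m + 1)" if "x \<in> A" for x
      by (rule high_not_exterior) (use phi m that in force)+
    then show "\<phi> \<in> ?good \<union> (\<Union>x\<in>A. bad x)" using phi by (auto simp: bad_def not_less_eq_eq)
  qed
  then have "measure (gibbs p \<beta> M) {\<phi> \<in> configs M. \<forall>x\<in>A. h \<le> \<phi> x}
      \<le> measure (gibbs p \<beta> M) (?good \<union> (\<Union>x\<in>A. bad x))"
    by (rule gibbs_mono[OF fin]) (auto simp: bad_def)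
  also have "\<dots> \<le> measure (gibbs p \<beta> M) ?good + measure (gibbs p \<beta> M) (\<Union>x\<in>A. bad x)"
    by (rule measure_subadditive) (auto simp: sets_gibbs bad_def finite_measure.emeasure_finite[OF fin])
  also have "\<dots> \<le> real (short_contours n) ^ (nat (h - m) * card A)
      * exp (- \<beta> * (cap_energy p A * real_of_int (h - m) powr p)) * mass p \<beta> M + (\<Sum>x\<in>A. c)"
    by (rule add_mono[OF small_clusters_bound[OF fin p b0 A m] bad_le])
  finally show ?thesis by (simp add: c_def algebra_simps)
qed

section \<open>Lower bounds\<close>

definition nbhd :: "vertex set \<Rightarrow> vertex set" where
  "nbhd B = B \<union> {y. \<exists>x\<in>B. nearest_nbr x y}"

lemma card_nbhd:
  assumes "finite B" shows "finite (nbhd B) \<and> card (nbhd B) \<le> 5 * card B"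
proof -
  have eq: "nbhd B = (\<Union>x\<in>B. insert x {y. nearest_nbr x y})" by (auto simp: nbhd_def)
  have card4: "card (insert x {y. nearest_nbr x y}) \<le> 5" for x
  proof (cases x)
    case (Pair a b)
    have "card (set [(a, b), (a + 1, b), (a, b + 1), (a - 1, b), (a, b - 1)])
        \<le> length [(a, b), (a + 1, b), (a, b + 1), (a - 1, b), (a, b - 1)]"
      by (rule card_length)
    then show ?thesis by (simp add: Pair neighbours_eq)
  qed
  have "card (nbhd B) \<le> (\<Sum>x\<in>B. card (insert x {y. nearest_nbr x y}))"
    unfolding eq by (rule card_UN_le[OF assms])
  also have "\<dots> \<le> (\<Sum>x\<in>B. 5)" by (rule sum_mono[OF card4])
  finally show ?thesis using assms finite_neighbours by (simp add: eq mult.commute)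
qed

lemma incident_ends_nbhd:
  assumes "e \<in> incident B" shows "fst e \<in> nbhd B" "snd e \<in> nbhd B"
proof -
  obtain x y where e: "e = (x, y)" by (cases e)
  have "nearest_nbr x y" "nearest_nbr y x" and "x \<in> B \<or> y \<in> B"
    using assms by (auto simp: e incident_def nearest_nbr_iff_edge)
  then show "fst e \<in> nbhd B" "snd e \<in> nbhd B" unfolding e nbhd_def by auto
qed

text \<open>Heights near a set of bounded size are bounded with probability at least one half, and
  resetting bounded heights on the set to zero has bounded cost.\<close>

lemma vanishing_probability:
  assumes p: "1 < p" "p < 2" and b: "2 * ln 256 \<le> \<beta>"
  shows "\<exists>c>0. \<forall>M B. finite_measure (gibbs p \<beta> M) \<and> finite B \<and> card B \<le> N \<and> B \<subseteq> box M \<longrightarrow>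
    c * mass p \<beta> M \<le> measure (gibbs p \<beta> M) {\<phi> \<in> configs M. \<forall>x\<in>B. \<phi> x = 0}"
proof -
  have b0: "0 < \<beta>" using b ln_gt_zero[of 256] by linarith
  define a where "a = \<beta> / 2 * decay_rate p 1"
  have a: "0 < a" using b0 sobolev_const_pos[OF p] by (simp add: a_def decay_rate_def)
  have "(\<lambda>L::nat. real (10 * N) * exp (- a * real L powr p)) \<longlonglongrightarrow> 0"
    using a p by real_asymp
  then have "eventually (\<lambda>L::nat. real (10 * N) * exp (- a * real L powr p) < 1 / 2) sequentially"
    by (rule order_tendstoD) simp
  then obtain L0 where L0: "\<And>L. L0 \<le> L \<Longrightarrow> real (10 * N) * exp (- a * real L powr p) < 1 / 2"
    unfolding eventually_sequentially by blast
  define L where "L = Suc L0"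
  have L: "real (10 * N) * exp (- a * real L powr p) < 1 / 2" using L0[of L] by (simp add: L_def)
  define K where "K = real (2 * L + 1) ^ N * exp (\<beta> * (real (4 * N) * real L powr p))"
  have K: "0 < K" by (simp add: K_def)
  show ?thesis
  proof (intro exI[of _ "1 / (2 * K)"] conjI allI impI)
    show "0 < 1 / (2 * K)" using K by simp
    fix M B
    assume "finite_measure (gibbs p \<beta> M) \<and> finite B \<and> card B \<le> N \<and> B \<subseteq> box M"
    then have fin: "finite_measure (gibbs p \<beta> M)" and B: "finite B" "card B \<le> N" "B \<subseteq> box M" by auto
    interpret finite_measure "gibbs p \<beta> M" by (rule fin)
    let ?P = "measure (gibbs p \<beta> M)"
    let ?Z = "{\<phi> \<in> configs M. \<forall>x\<in>B. \<phi> x = 0}"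
    define U where "U = nbhd B"
    have U: "finite U" "card U \<le> 5 * N" using card_nbhd[OF B(1)] B(2) by (auto simp: U_def)
    \<comment> \<open>heights are also bounded at the neighbours of \<open>B\<close>, to control the edges leaving \<open>B\<close>\<close>
    define S where "S = {\<phi> \<in> configs M. \<forall>y\<in>U. \<bar>\<phi> y\<bar> < int L}"
    have L1: "1 \<le> int L" by (simp add: L_def)
    have "?P (configs M - S) \<le> (\<Sum>y\<in>U. 2 * exp (- a * real L powr p) * mass p \<beta> M)"
    proof (rule gibbs_union_bound[OF fin U(1),
        where A = "\<lambda>y. {\<phi> \<in> configs M. int L \<le> \<phi> y} \<union> {\<phi> \<in> configs M. \<phi> y \<le> - int L}"])
      fix y
      have "?P ({\<phi> \<in> configs M. int L \<le> \<phi> y} \<union> {\<phi> \<in> configs M. \<phi> y \<le> - int L})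
          \<le> ?P {\<phi> \<in> configs M. int L \<le> \<phi> y} + ?P {\<phi> \<in> configs M. \<phi> y \<le> - int L}"
        by (rule measure_subadditive) (auto simp: sets_gibbs)
      also have "\<dots> \<le> exp (- a * real L powr p) * mass p \<beta> M + exp (- a * real L powr p) * mass p \<beta> M"
        using high_point_unlikely[OF fin p b L1, of y] low_point_unlikely[OF fin p b L1, of y]
        by (intro add_mono) (simp_all add: a_def mult.assoc)
      finally show "?P ({\<phi> \<in> configs M. int L \<le> \<phi> y} \<union> {\<phi> \<in> configs M. \<phi> y \<le> - int L})
          \<le> 2 * exp (- a * real L powr p) * mass p \<beta> M" by (simp add: mult_ac)
    qed (auto simp: S_def)
    also have "\<dots> = real (card U) * (2 * exp (- a * real L powr p)) * mass p \<beta> M" by simp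
    also have "\<dots> \<le> real (5 * N) * (2 * exp (- a * real L powr p)) * mass p \<beta> M"
      using U(2) by (intro mult_right_mono mass_nonneg of_nat_mono) auto
    also have "\<dots> \<le> 1 / 2 * mass p \<beta> M"
      using L by (intro mult_right_mono mass_nonneg) simp
    finally have "?P (configs M - S) \<le> 1 / 2 * mass p \<beta> M" .
    moreover have "?P (configs M - S) = mass p \<beta> M - ?P S"
      unfolding mass_def by (rule finite_measure_Diff) (auto simp: sets_gibbs S_def)
    ultimately have half: "mass p \<beta> M / 2 \<le> ?P S" by simp
    define I where "I = PiE B (\<lambda>_. {- int L..int L})"
    have "?P S \<le> (\<Sum>\<sigma>\<in>I. exp (\<beta> * (real (4 * N) * real L powr p)) * ?P ?Z)"
    proof (rule gibbs_union_bound[OF fin, where A = "\<lambda>\<sigma>. {\<phi> \<in> S. \<forall>x\<in>B. \<phi> x = \<sigma> x}"])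
      show "finite I" unfolding I_def by (rule finite_PiE[OF B(1)]) simp
      show "S \<subseteq> (\<Union>\<sigma>\<in>I. {\<phi> \<in> S. \<forall>x\<in>B. \<phi> x = \<sigma> x})"
      proof
        fix \<phi> assume phi: "\<phi> \<in> S"
        have "- int L \<le> \<phi> x \<and> \<phi> x \<le> int L" if "x \<in> B" for x
        proof -
          have "x \<in> U" using that by (simp add: U_def nbhd_def)
          then show ?thesis using phi by (force simp: S_def)
        qed
        then have "restrict \<phi> B \<in> I" unfolding I_def by (intro restrict_PiE_iff[THEN iffD2]) simp
        then show "\<phi> \<in> (\<Union>\<sigma>\<in>I. {\<phi> \<in> S. \<forall>x\<in>B. \<phi> x = \<sigma> x})"
          using phi by (intro UN_I[of "restrict \<phi> B"]) simp_all
      qed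
      show "{\<phi> \<in> S. \<forall>x\<in>B. \<phi> x = \<sigma> x} \<subseteq> configs M" for \<sigma> by (auto simp: S_def)
      show "?P {\<phi> \<in> S. \<forall>x\<in>B. \<phi> x = \<sigma> x} \<le> exp (\<beta> * (real (4 * N) * real L powr p)) * ?P ?Z" for \<sigma>
      proof -
        define T where "T \<phi> x = (if x \<in> B then 0 else \<phi> x)" for \<phi> :: "vertex \<Rightarrow> int" and x
        have "?P {\<phi> \<in> S. \<forall>x\<in>B. \<phi> x = \<sigma> x} \<le> exp (- \<beta> * (- (real (4 * N) * real L powr p))) * ?P ?Z"
        proof (rule gibbs_shift[OF fin less_imp_le[OF b0], where T = T])
          show "inj_on T {\<phi> \<in> S. \<forall>x\<in>B. \<phi> x = \<sigma> x}"
          proof (rule inj_onI, rule ext)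
            fix f g x
            assume fg: "f \<in> {\<phi> \<in> S. \<forall>x\<in>B. \<phi> x = \<sigma> x}" "g \<in> {\<phi> \<in> S. \<forall>x\<in>B. \<phi> x = \<sigma> x}" and "T f = T g"
            then have "T f x = T g x" by simp
            then show "f x = g x" using fg by (cases "x \<in> B") (simp_all add: T_def)
          qed
          show "T \<phi> \<in> ?Z" if "\<phi> \<in> {\<phi> \<in> S. \<forall>x\<in>B. \<phi> x = \<sigma> x}" for \<phi>
            using that unfolding S_def configs_def T_def by auto
          show "- (real (4 * N) * real L powr p) + hamiltonian p M (T \<phi>) \<le> hamiltonian p M \<phi>"
            if "\<phi> \<in> {\<phi> \<in> S. \<forall>x\<in>B. \<phi> x = \<sigma> x}" for \<phi>
          proof -
            have phi: "\<phi> \<in> S" using that by simp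
            let ?I = "incident (box M)"
            have finI: "finite ?I" by (rule finite_incident[OF finite_box])
            have edge: "\<bar>real_of_int (T \<phi> (fst e)) - real_of_int (T \<phi> (snd e))\<bar> powr p
                \<le> \<bar>real_of_int (\<phi> (fst e)) - real_of_int (\<phi> (snd e))\<bar> powr p
                  + (if e \<in> incident B then real L powr p else 0)" if e: "e \<in> ?I" for e
            proof (cases "e \<in> incident B")
              case True
              have "\<bar>\<phi> (fst e)\<bar> < int L" "\<bar>\<phi> (snd e)\<bar> < int L"
                using incident_ends_nbhd[OF True] phi by (auto simp: S_def U_def)
              moreover have "fst e \<in> B \<or> snd e \<in> B" using True by (simp add: incident_def)
              ultimately have "\<bar>T \<phi> (fst e) - T \<phi> (snd e)\<bar> \<le> int L" by (auto simp: T_def)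
              then have "\<bar>real_of_int (T \<phi> (fst e)) - real_of_int (T \<phi> (snd e))\<bar> \<le> real L" by linarith
              then have "\<bar>real_of_int (T \<phi> (fst e)) - real_of_int (T \<phi> (snd e))\<bar> powr p \<le> real L powr p"
                using p by (intro powr_mono2) auto
              then show ?thesis using True by (simp add: add_increasing)
            next
              case False
              then have "fst e \<notin> B" "snd e \<notin> B" using e by (auto simp: incident_def)
              then show ?thesis using False by (simp add: T_def)
            qed
            have "hamiltonian p M (T \<phi>) \<le> hamiltonian p M \<phi> + (\<Sum>e\<in>?I. if e \<in> incident B then real L powr p else 0)"
              unfolding hamiltonian_eq_fenergy fenergy_def sum.distrib[symmetric]
              by (rule sum_mono[OF edge])
            also have "(\<Sum>e\<in>?I. if e \<in> incident B then real L powr p else 0)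
                = real (card (?I \<inter> incident B)) * real L powr p"
              using finI by (simp add: sum.inter_restrict[symmetric])
            also have "\<dots> \<le> real (4 * N) * real L powr p"
            proof (intro mult_right_mono of_nat_mono)
              have "card (?I \<inter> incident B) \<le> card (incident B)"
                by (rule card_mono[OF finite_incident[OF B(1)]]) simp
              then show "card (?I \<inter> incident B) \<le> 4 * N" using card_incident_le[OF B(1)] B(2) by simp
            qed simp
            finally show ?thesis by simp
          qed
        qed (auto simp: S_def)
        then show ?thesis by simp
      qed
    qed
    also have "\<dots> = real (card I) * (exp (\<beta> * (real (4 * N) * real L powr p)) * ?P ?Z)" by simp
    also have "\<dots> \<le> real (2 * L + 1) ^ N * (exp (\<beta> * (real (4 * N) * real L powr p)) * ?P ?Z)"
    proof (rule mult_right_mono)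
      have "int L - - int L + 1 = int (2 * L + 1)" by simp
      then have "card {- int L..int L} = 2 * L + 1" by (metis card_atLeastAtMost_int nat_int)
      then have "card I = (2 * L + 1) ^ card B"
        unfolding I_def by (subst card_PiE[OF B(1)]) (simp only: prod_constant)
      also have "\<dots> \<le> (2 * L + 1) ^ N" by (rule power_increasing[OF B(2)]) simp
      finally show "real (card I) \<le> real (2 * L + 1) ^ N" by (metis of_nat_le_iff of_nat_power)
    qed simp
    finally have "?P S \<le> K * ?P ?Z" by (simp add: K_def mult.assoc)
    then have "mass p \<beta> M / 2 \<le> K * ?P ?Z" using half by simp
    then show "1 / (2 * K) * mass p \<beta> M \<le> ?P ?Z" using K by (simp add: field_simps)
  qed
qed

lemma powr_add_le_convex:
  fixes a b t p :: real
  assumes "0 \<le> a" "0 \<le> b" "0 < t" "t < 1" "1 \<le> p"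
  shows "(a + b) powr p \<le> (1 - t) powr (1 - p) * a powr p + t powr (1 - p) * b powr p"
proof -
  have ge1: "1 \<le> s powr (1 - p)" if "0 < s" "s < 1" for s
    using powr_mono'[of "1 - p" 0 s] assms that by simp
  consider "a = 0" | "b = 0" | "0 < a" "0 < b" using assms by linarith
  then show ?thesis
  proof cases
    case 1
    have "1 * b powr p \<le> t powr (1 - p) * b powr p" by (intro mult_right_mono ge1) (use assms in auto)
    then show ?thesis using 1 assms by simp
  next
    case 2
    have "1 * a powr p \<le> (1 - t) powr (1 - p) * a powr p"
      by (intro mult_right_mono ge1) (use assms in auto)
    then show ?thesis using 2 assms by simp
  next
    case 3
    have scale: "s * (u / s) powr p = s powr (1 - p) * u powr p" if "0 < s" "0 < u" for s u
      using that by (simp add: powr_divide powr_diff)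
    have "((1 - t) *\<^sub>R (a / (1 - t)) + t *\<^sub>R (b / t)) powr p
        \<le> (1 - t) * (a / (1 - t)) powr p + t * (b / t) powr p"
      by (rule convex_onD[OF powr_convex[OF assms(5)]]) (use 3 assms in auto)
    then show ?thesis using 3 assms scale[of "1 - t" a] scale[of t b] by simp
  qed
qed

text \<open>Rounding \<open>h\<close> times a profile to integers changes slopes by at most one, on a number of edges
  that does not depend on \<open>h\<close>. Convexity splits off this change at the price of a factor close to
  one in front of the main term.\<close>

lemma rounded_profile_energy:
  fixes g :: "vertex \<Rightarrow> real"
  assumes p: "1 < p" and d: "0 < d" "d < 1" and h: "0 < h"
    and B: "finite B" "\<And>x. x \<notin> B \<Longrightarrow> g x = 0" "B \<subseteq> box M"
  shows "hamiltonian p M (\<lambda>x. \<lfloor>real_of_int h * g x\<rfloor>)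
      \<le> (1 - d) powr (1 - p) * (real_of_int h powr p * fenergy p (incident B) g)
        + d powr (1 - p) * real (4 * card B)"
proof -
  define \<psi> where "\<psi> x = \<lfloor>real_of_int h * g x\<rfloor>" for x
  have finI: "finite (incident B)" by (rule finite_incident[OF B(1)])
  have "hamiltonian p M \<psi> = (\<Sum>e\<in>incident B. \<bar>real_of_int (\<psi> (fst e)) - real_of_int (\<psi> (snd e))\<bar> powr p)"
    unfolding hamiltonian_eq_fenergy fenergy_def
  proof (rule sum.mono_neutral_right[OF finite_incident[OF finite_box] incident_mono[OF B(3)]], rule ballI)
    fix e assume "e \<in> incident (box M) - incident B"
    then have "fst e \<notin> B" "snd e \<notin> B" by (auto simp: incident_def)
    then show "\<bar>real_of_int (\<psi> (fst e)) - real_of_int (\<psi> (snd e))\<bar> powr p = 0"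
      using B(2) by (simp add: \<psi>_def)
  qed
  also have "\<dots> \<le> (\<Sum>e\<in>incident B. (1 - d) powr (1 - p) * (real_of_int h powr p
      * \<bar>g (fst e) - g (snd e)\<bar> powr p) + d powr (1 - p))"
  proof (rule sum_mono)
    fix e :: "vertex \<times> vertex"
    have "\<bar>real_of_int (\<psi> (fst e)) - real_of_int (\<psi> (snd e))\<bar>
        \<le> \<bar>real_of_int h * g (fst e) - real_of_int h * g (snd e)\<bar> + 1"
      unfolding \<psi>_def by linarith
    also have "\<bar>real_of_int h * g (fst e) - real_of_int h * g (snd e)\<bar>
        = real_of_int h * \<bar>g (fst e) - g (snd e)\<bar>"
      using h by (simp add: right_diff_distrib[symmetric] abs_mult)
    finally have "\<bar>real_of_int (\<psi> (fst e)) - real_of_int (\<psi> (snd e))\<bar> powr p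
        \<le> (real_of_int h * \<bar>g (fst e) - g (snd e)\<bar> + 1) powr p"
      by (intro powr_mono2) (use p in auto)
    also have "\<dots> \<le> (1 - d) powr (1 - p) * (real_of_int h * \<bar>g (fst e) - g (snd e)\<bar>) powr p
        + d powr (1 - p) * 1 powr p"
      by (rule powr_add_le_convex) (use p d h in auto)
    finally show "\<bar>real_of_int (\<psi> (fst e)) - real_of_int (\<psi> (snd e))\<bar> powr p
        \<le> (1 - d) powr (1 - p) * (real_of_int h powr p * \<bar>g (fst e) - g (snd e)\<bar> powr p)
          + d powr (1 - p)"
      by (simp add: powr_mult)
  qed
  also have "\<dots> = (1 - d) powr (1 - p) * (real_of_int h powr p * fenergy p (incident B) g)
      + d powr (1 - p) * real (card (incident B))"
    by (simp add: sum.distrib fenergy_def sum_distrib_left mult.commute)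
  also have "\<dots> \<le> (1 - d) powr (1 - p) * (real_of_int h powr p * fenergy p (incident B) g)
        + d powr (1 - p) * real (4 * card B)"
    using card_incident_le[OF B(1)] by (intro add_left_mono mult_left_mono of_nat_mono) auto
  finally show ?thesis by (simp add: \<psi>_def[abs_def])
qed

text \<open>When \<open>\<phi>\<close> vanishes around the support of the rounded profile, no edge has slope in both, and the
  energies add up exactly.\<close>

lemma finite_volume_lower_bound:
  assumes p: "1 < p" "p < 2" and b: "2 * ln 256 \<le> \<beta>" and d: "0 < d" "d < 1"
  shows "\<exists>c>0. \<exists>D. \<forall>A h. finite A \<and> card A = k \<and> 1 \<le> h \<longrightarrow> (\<exists>M0. \<forall>M\<ge>M0.
    finite_measure (gibbs p \<beta> M) \<longrightarrow>
    c * exp (- \<beta> * ((1 - d) powr (1 - 2 * p) * cap_energy p A * real_of_int h powr p + D)) * mass p \<beta> M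
      \<le> measure (gibbs p \<beta> M) {\<phi> \<in> configs M. \<forall>x\<in>A. \<phi> x = h})"
proof -
  have b0: "0 \<le> \<beta>" using b ln_ge_zero[of 256] by linarith
  define N where "N = nat \<lfloor>(sobolev_const p * (4 * real k * (4 / d) powr p)) powr (2 / (2 - p))\<rfloor>"
  obtain c where c: "0 < c" and vanish: "\<And>M B. finite_measure (gibbs p \<beta> M) \<Longrightarrow> finite B \<Longrightarrow>
      card B \<le> 5 * N \<Longrightarrow> B \<subseteq> box M \<Longrightarrow>
      c * mass p \<beta> M \<le> measure (gibbs p \<beta> M) {\<phi> \<in> configs M. \<forall>x\<in>B. \<phi> x = 0}"
    using vanishing_probability[OF p b, of "5 * N"] by blast
  define D where "D = d powr (1 - p) * real (4 * N)"
  show ?thesis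
  proof (rule exI[of _ c], rule conjI[OF c], rule exI[of _ D], intro allI impI)
    fix A :: "vertex set" and h :: int
    assume "finite A \<and> card A = k \<and> 1 \<le> h"
    then have A: "finite A" "card A = k" and h: "1 \<le> h" by auto
    obtain g where gA: "\<And>x. x \<in> A \<Longrightarrow> g x = 1" and fin_g: "finite {x. g x \<noteq> 0}"
      and card_g: "real (card {x. g x \<noteq> 0}) \<le>
        (sobolev_const p * (4 * real (card A) * (4 / d) powr p)) powr (2 / (2 - p))"
      and energy_g: "\<And>F. finite F \<Longrightarrow> F \<subseteq> edges \<Longrightarrow> fenergy p F g \<le> cap_energy p A / (1 - d) powr p"
      using near_optimal_profile[OF p A(1) d] by metis
    define B where "B = {x. g x \<noteq> 0}"
    have B: "finite B" "card B \<le> N" using fin_g card_g A by (auto simp: B_def N_def le_nat_floor)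
    have U: "finite (nbhd B)" "card (nbhd B) \<le> 5 * N" using card_nbhd[OF B(1)] B(2) by auto
    obtain M0 where M0: "nbhd B \<subseteq> box M0" using finite_subset_box[OF U(1)] by blast
    define \<psi> where "\<psi> x = \<lfloor>real_of_int h * g x\<rfloor>" for x
    have psi0: "\<psi> x = 0" if "x \<notin> B" for x using that by (simp add: \<psi>_def B_def)
    define E where "E = (1 - d) powr (1 - 2 * p) * cap_energy p A * real_of_int h powr p + D"
    show "\<exists>M0. \<forall>M\<ge>M0. finite_measure (gibbs p \<beta> M) \<longrightarrow>
      c * exp (- \<beta> * ((1 - d) powr (1 - 2 * p) * cap_energy p A * real_of_int h powr p + D)) * mass p \<beta> M
      \<le> measure (gibbs p \<beta> M) {\<phi> \<in> configs M. \<forall>x\<in>A. \<phi> x = h}"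
    proof (intro exI[of _ M0] allI impI)
      fix M assume M: "M0 \<le> M" and fin: "finite_measure (gibbs p \<beta> M)"
      have UM: "nbhd B \<subseteq> box M" using M0 box_mono[OF M] by blast
      have BM: "B \<subseteq> box M" using UM by (auto simp: nbhd_def)
      have H: "hamiltonian p M \<psi> \<le> E"
      proof -
        have "hamiltonian p M \<psi> \<le> (1 - d) powr (1 - p) * (real_of_int h powr p * fenergy p (incident B) g)
            + d powr (1 - p) * real (4 * card B)"
          unfolding \<psi>_def
          by (rule rounded_profile_energy) (use p d h B BM in \<open>auto simp: B_def\<close>)
        also have "\<dots> \<le> (1 - d) powr (1 - p) * (real_of_int h powr p * (cap_energy p A / (1 - d) powr p))
            + d powr (1 - p) * real (4 * N)"
          using B(2) finite_incident[OF B(1)] incident_subset_edges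
          by (intro add_mono mult_left_mono energy_g of_nat_mono) auto
        also have "(1 - d) powr (1 - p) * (real_of_int h powr p * (cap_energy p A / (1 - d) powr p))
            = (1 - d) powr (1 - 2 * p) * cap_energy p A * real_of_int h powr p"
        proof -
          have "(1 - d) powr (1 - 2 * p) = (1 - d) powr (1 - p) / (1 - d) powr p"
            using d by (simp add: powr_diff[symmetric])
          then show ?thesis by simp
        qed
        finally show ?thesis by (simp add: E_def D_def)
      qed
      have "c * mass p \<beta> M \<le> measure (gibbs p \<beta> M) {\<phi> \<in> configs M. \<forall>x\<in>nbhd B. \<phi> x = 0}"
        by (rule vanish[OF fin U UM])
      also have "\<dots> \<le> exp (- \<beta> * (- hamiltonian p M \<psi>))
          * measure (gibbs p \<beta> M) {\<phi> \<in> configs M. \<forall>x\<in>A. \<phi> x = h}"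
      proof (rule gibbs_shift[OF fin b0, where T = "\<lambda>\<phi> x. \<phi> x + \<psi> x"])
        show "inj_on (\<lambda>\<phi> x. \<phi> x + \<psi> x) {\<phi> \<in> configs M. \<forall>x\<in>nbhd B. \<phi> x = 0}"
          by (rule inj_onI) (simp add: fun_eq_iff)
        show "(\<lambda>x. \<phi> x + \<psi> x) \<in> {\<phi> \<in> configs M. \<forall>x\<in>A. \<phi> x = h}"
          if phi: "\<phi> \<in> {\<phi> \<in> configs M. \<forall>x\<in>nbhd B. \<phi> x = 0}" for \<phi>
        proof -
          have "\<phi> x + \<psi> x = 0" if "x \<notin> box M" for x
          proof -
            have "x \<notin> B" using that BM by blast
            moreover have "\<phi> x = 0" using phi that by (cases x) (simp add: configs_def)
            ultimately show ?thesis by (simp add: psi0)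
          qed
          moreover have "\<phi> x + \<psi> x = h" if "x \<in> A" for x
          proof -
            have "x \<in> nbhd B" using gA[OF that] by (simp add: nbhd_def B_def)
            then show ?thesis using phi gA[OF that] by (simp add: \<psi>_def)
          qed
          ultimately show ?thesis by (simp add: configs_def)
        qed
        show "- hamiltonian p M \<psi> + hamiltonian p M (\<lambda>x. \<phi> x + \<psi> x) \<le> hamiltonian p M \<phi>"
          if phi: "\<phi> \<in> {\<phi> \<in> configs M. \<forall>x\<in>nbhd B. \<phi> x = 0}" for \<phi>
        proof -
          have "hamiltonian p M (\<lambda>x. \<phi> x + \<psi> x) \<le> hamiltonian p M \<phi> + hamiltonian p M \<psi>"
            unfolding hamiltonian_eq_fenergy fenergy_def sum.distrib[symmetric]
          proof (rule sum_mono)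
            fix e assume e: "e \<in> incident (box M)"
            show "\<bar>real_of_int (\<phi> (fst e) + \<psi> (fst e)) - real_of_int (\<phi> (snd e) + \<psi> (snd e))\<bar> powr p
                \<le> \<bar>real_of_int (\<phi> (fst e)) - real_of_int (\<phi> (snd e))\<bar> powr p
                  + \<bar>real_of_int (\<psi> (fst e)) - real_of_int (\<psi> (snd e))\<bar> powr p"
            proof (cases "e \<in> incident B")
              case True
              then have "\<phi> (fst e) = 0" "\<phi> (snd e) = 0" using incident_ends_nbhd[OF True] phi by auto
              then show ?thesis by simp
            next
              case False
              then have "fst e \<notin> B" "snd e \<notin> B" using e by (auto simp: incident_def)
              then show ?thesis by (simp add: psi0)
            qed
          qed
          then show ?thesis by simp
        qed
      qed auto
      also have "\<dots> \<le> exp (\<beta> * E) * measure (gibbs p \<beta> M) {\<phi> \<in> configs M. \<forall>x\<in>A. \<phi> x = h}"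
        using H b0 by (intro mult_right_mono) (auto simp: mult_left_mono)
      finally have "exp (- \<beta> * E) * (c * mass p \<beta> M)
          \<le> exp (- \<beta> * E) * (exp (\<beta> * E) * measure (gibbs p \<beta> M) {\<phi> \<in> configs M. \<forall>x\<in>A. \<phi> x = h})"
        by (intro mult_left_mono) auto
      then show "c * exp (- \<beta> * ((1 - d) powr (1 - 2 * p) * cap_energy p A * real_of_int h powr p + D))
          * mass p \<beta> M \<le> measure (gibbs p \<beta> M) {\<phi> \<in> configs M. \<forall>x\<in>A. \<phi> x = h}"
        unfolding E_def[symmetric] by (simp add: exp_minus field_simps)
    qed
  qed
qed

section \<open>The infinite-volume limit\<close>

lemma closed_cylinder:
  fixes B :: "int set"
  shows "closed {\<phi> :: vertex \<Rightarrow> int. \<forall>x\<in>A. \<phi> x \<in> B}"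
proof -
  have "closed ((\<lambda>\<phi> :: vertex \<Rightarrow> int. \<phi> x) -` B)" for x
    by (rule closed_vimage[OF _ continuous_on_product_coordinates]) (simp add: closed_def discrete_topology_class.open_discrete)
  then have "closed (\<Inter>x\<in>A. (\<lambda>\<phi> :: vertex \<Rightarrow> int. \<phi> x) -` B)" by (intro closed_INT) auto
  moreover have "(\<Inter>x\<in>A. (\<lambda>\<phi> :: vertex \<Rightarrow> int. \<phi> x) -` B) = {\<phi>. \<forall>x\<in>A. \<phi> x \<in> B}" by auto
  ultimately show ?thesis by simp
qed

lemma open_cylinder:
  fixes B :: "int set"
  assumes "finite A"
  shows "open {\<phi> :: vertex \<Rightarrow> int. \<forall>x\<in>A. \<phi> x \<in> B}"
proof -
  have "open ((\<lambda>\<phi> :: vertex \<Rightarrow> int. \<phi> x) -` B)" for x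
    by (rule open_vimage[OF _ continuous_on_product_coordinates]) (simp add: discrete_topology_class.open_discrete)
  then have "open (\<Inter>x\<in>A. (\<lambda>\<phi> :: vertex \<Rightarrow> int. \<phi> x) -` B)" by (intro open_INT assms) auto
  moreover have "(\<Inter>x\<in>A. (\<lambda>\<phi> :: vertex \<Rightarrow> int. \<phi> x) -` B) = {\<phi>. \<forall>x\<in>A. \<phi> x \<in> B}" by auto
  ultimately show ?thesis by simp
qed

lemma weak_limit_clopen:
  assumes lim: "weak_limit N \<mu>" and sets: "sets \<mu> = sets borel" "\<And>n. sets (N n) = sets borel"
    and S: "open S" "closed S"
  shows "(\<lambda>n. measure (N n) S) \<longlonglongrightarrow> measure \<mu> S"
proof -
  have cont: "continuous_on (S \<union> - S) (\<lambda>x. if x \<in> S then 1 else 0 :: real)"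
    by (rule continuous_on_cases) (use S in auto)
  have "(\<lambda>x. if x \<in> S then 1 else 0 :: real) = indicator S" by (auto simp: indicator_def)
  then have "continuous_on UNIV (indicator S :: _ \<Rightarrow> real)" using cont by (simp only: Compl_partition)
  moreover have "bounded (range (indicator S :: _ \<Rightarrow> real))"
    by (rule boundedI[of _ 1]) (auto simp: indicator_def)
  ultimately have "(\<lambda>n. integral\<^sup>L (N n) (indicator S :: _ \<Rightarrow> real)) \<longlonglongrightarrow> integral\<^sup>L \<mu> (indicator S)"
    using lim unfolding weak_limit_def by blast
  moreover have "S \<inter> space K = S" if "sets K = sets borel" for K :: "'a measure"
    using sets_eq_imp_space_eq[OF that] by simp
  ultimately show ?thesis using sets by simp
qed

lemma sets_finite_volume: "sets (finite_volume p \<beta> M) = sets borel"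
  by (simp add: finite_volume_def)

lemma emeasure_finite_volume:
  assumes "S \<in> sets borel"
  shows "emeasure (finite_volume p \<beta> M) S = emeasure (gibbs p \<beta> M) (S \<inter> configs M)"
  unfolding finite_volume_def gibbs_def
  by (subst emeasure_distr) (use assms in \<open>auto simp: space_point_measure\<close>)

lemma measure_finite_volume:
  assumes "S \<in> sets borel"
  shows "measure (finite_volume p \<beta> M) S = measure (gibbs p \<beta> M) (S \<inter> configs M)"
  using emeasure_finite_volume[OF assms] by (simp add: measure_def)

text \<open>The limit is a probability measure, so the test function one shows that the masses converge to
  one. In particular they are positive for large boxes, and there the measures are finite, because a
  set of infinite measure has \<open>measure\<close> zero.\<close>

lemma mass_tendsto:
  assumes "is_infinite_volume p \<beta> \<mu>"
  shows "(\<lambda>M. mass p \<beta> M) \<longlonglongrightarrow> 1" "eventually (\<lambda>M. finite_measure (gibbs p \<beta> M)) sequentially"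
proof -
  have mu: "prob_space \<mu>" "sets \<mu> = sets borel" "weak_limit (finite_volume p \<beta>) \<mu>"
    using assms by (auto simp: is_infinite_volume_def)
  interpret prob_space \<mu> by (rule mu(1))
  have "(\<lambda>M. measure (finite_volume p \<beta> M) UNIV) \<longlonglongrightarrow> measure \<mu> UNIV"
    by (rule weak_limit_clopen[OF mu(3,2) sets_finite_volume]) auto
  moreover have "measure \<mu> UNIV = 1"
    using prob_space sets_eq_imp_space_eq[OF mu(2)] by simp
  ultimately show lim: "(\<lambda>M. mass p \<beta> M) \<longlonglongrightarrow> 1"
    by (simp add: measure_finite_volume mass_def)
  have "eventually (\<lambda>M. 0 < mass p \<beta> M) sequentially"
    by (rule order_tendstoD(1)[OF lim]) simp
  then show "eventually (\<lambda>M. finite_measure (gibbs p \<beta> M)) sequentially"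
  proof (rule eventually_mono)
    fix M assume "0 < mass p \<beta> M"
    then have "emeasure (gibbs p \<beta> M) (configs M) \<noteq> \<infinity>"
      by (auto simp: mass_def measure_def)
    then show "finite_measure (gibbs p \<beta> M)"
      by (intro finite_measureI) (simp add: gibbs_def space_point_measure)
  qed
qed

lemma cylinder_limit:
  assumes mu: "is_infinite_volume p \<beta> \<mu>" and A: "finite A"
  shows "(\<lambda>M. measure (gibbs p \<beta> M) {\<phi> \<in> configs M. \<forall>x\<in>A. \<phi> x \<in> B})
    \<longlonglongrightarrow> measure \<mu> {\<phi>. \<forall>x\<in>A. \<phi> x \<in> B}"
proof -
  let ?S = "{\<phi> :: vertex \<Rightarrow> int. \<forall>x\<in>A. \<phi> x \<in> B}"
  have "(\<lambda>M. measure (finite_volume p \<beta> M) ?S) \<longlonglongrightarrow> measure \<mu> ?S"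
    by (rule weak_limit_clopen[OF _ _ sets_finite_volume open_cylinder[OF A] closed_cylinder])
      (use mu in \<open>auto simp: is_infinite_volume_def\<close>)
  moreover have "measure (finite_volume p \<beta> M) ?S = measure (gibbs p \<beta> M) {\<phi> \<in> configs M. \<forall>x\<in>A. \<phi> x \<in> B}"
    for M
  proof -
    have "?S \<in> sets borel" by (rule borel_open[OF open_cylinder[OF A]])
    moreover have "?S \<inter> configs M = {\<phi> \<in> configs M. \<forall>x\<in>A. \<phi> x \<in> B}" by auto
    ultimately show ?thesis by (simp add: measure_finite_volume)
  qed
  ultimately show ?thesis by simp
qed

lemma cylinder_upper:
  assumes mu: "is_infinite_volume p \<beta> \<mu>" and A: "finite A"
    and bound: "\<And>M. finite_measure (gibbs p \<beta> M) \<Longrightarrow>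
      measure (gibbs p \<beta> M) {\<phi> \<in> configs M. \<forall>x\<in>A. \<phi> x \<in> B} \<le> c * mass p \<beta> M"
  shows "measure \<mu> {\<phi>. \<forall>x\<in>A. \<phi> x \<in> B} \<le> c"
proof -
  have "(\<lambda>M. c * mass p \<beta> M) \<longlonglongrightarrow> c * 1"
    by (intro tendsto_mult tendsto_const mass_tendsto(1)[OF mu])
  then show ?thesis
    using tendsto_le[OF _ _ cylinder_limit[OF mu A] eventually_mono[OF mass_tendsto(2)[OF mu] bound]]
    by simp
qed

lemma cylinder_lower:
  assumes mu: "is_infinite_volume p \<beta> \<mu>" and A: "finite A"
    and bound: "\<And>M. M0 \<le> M \<Longrightarrow> finite_measure (gibbs p \<beta> M) \<Longrightarrow>
      c * mass p \<beta> M \<le> measure (gibbs p \<beta> M) {\<phi> \<in> configs M. \<forall>x\<in>A. \<phi> x \<in> B}"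
  shows "c \<le> measure \<mu> {\<phi>. \<forall>x\<in>A. \<phi> x \<in> B}"
proof -
  have lim: "(\<lambda>M. c * mass p \<beta> M) \<longlonglongrightarrow> c * 1"
    by (intro tendsto_mult tendsto_const mass_tendsto(1)[OF mu])
  have "eventually (\<lambda>M. c * mass p \<beta> M
      \<le> measure (gibbs p \<beta> M) {\<phi> \<in> configs M. \<forall>x\<in>A. \<phi> x \<in> B}) sequentially"
    using eventually_conj[OF eventually_ge_at_top[of M0] mass_tendsto(2)[OF mu]]
    by (rule eventually_mono) (use bound in blast)
  then show ?thesis using tendsto_le[OF _ cylinder_limit[OF mu A] lim] by simp
qed

section \<open>Large heights\<close>

lemma eventually_linear_le_powr:
  fixes a b c p :: real
  assumes "1 < p" "0 < b"
  shows "eventually (\<lambda>h. a * h + c \<le> b * h powr p) at_top"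
proof -
  have "((\<lambda>h::real. h powr (1 - p)) \<longlongrightarrow> 0) at_top" "((\<lambda>h::real. h powr (- p)) \<longlongrightarrow> 0) at_top"
    using assms by real_asymp+
  then have "((\<lambda>h. a * h powr (1 - p) + c * h powr (- p)) \<longlongrightarrow> a * 0 + c * 0) at_top"
    by (intro tendsto_intros)
  then have "eventually (\<lambda>h. a * h powr (1 - p) + c * h powr (- p) < b) at_top"
    by (rule order_tendstoD) (use assms in simp)
  then show ?thesis
    using eventually_gt_at_top[of 0]
  proof eventually_elim
    case (elim h)
    have "(a * h powr (1 - p) + c * h powr (- p)) * h powr p = a * h + c"
      using elim(2) by (simp add: distrib_right mult.assoc powr_add[symmetric])
    moreover have "(a * h powr (1 - p) + c * h powr (- p)) * h powr p \<le> b * h powr p"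
      using elim(1) by (intro mult_right_mono) auto
    ultimately show ?case by simp
  qed
qed

lemma obtain_int_threshold:
  assumes "eventually P (at_top :: real filter)"
  obtains h0 :: int where "1 \<le> h0" "\<And>h. h0 \<le> h \<Longrightarrow> P (real_of_int h)"
proof -
  obtain r where r: "\<And>x. r \<le> x \<Longrightarrow> P x" using assms by (auto simp: eventually_at_top_linorder)
  have "P (real_of_int h)" if "max 1 \<lceil>r\<rceil> \<le> h" for h
    by (rule r) (use that in linarith)
  then show thesis by (intro that[of "max 1 \<lceil>r\<rceil>"]) auto
qed

text \<open>The level \<open>m\<close> that separates the two cases is a small fraction \<open>\<eta>\<close> of \<open>h\<close>, so that giving up the
  layers below it costs at most \<open>\<epsilon> / 2\<close> in the energy. The cluster size \<open>n\<close> is then chosen so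
  large that a cluster with more points at this level is less likely than the event itself, whose
  energy is at most \<open>4 k h\<^sup>p\<close>.\<close>

lemma infinite_volume_upper:
  assumes mu: "is_infinite_volume p \<beta> \<mu>" and p: "1 < p" "p < 2" and b: "2 * ln 256 \<le> \<beta>"
    and k: "1 \<le> k" and \<epsilon>: "0 < \<epsilon>"
  shows "\<exists>h0 :: int. \<forall>h\<ge>h0. \<forall>A. finite A \<and> card A = k \<longrightarrow>
    measure \<mu> {\<phi>. \<forall>x\<in>A. h \<le> \<phi> x} \<le> exp (- \<beta> * (cap_energy p A - \<epsilon>) * real_of_int h powr p)"
proof -
  have b0: "0 < \<beta>" using b ln_gt_zero[of 256] by linarith
  \<comment> \<open>the energy is at most \<open>4 k\<close>, and \<open>(1 - \<eta>) powr p\<close> is at least \<open>1 - 2 \<eta>\<close>\<close>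
  define \<eta> where "\<eta> = min (1 / 2) (\<epsilon> / (16 * real k))"
  have eta: "0 < \<eta>" "\<eta> \<le> 1 / 2" "8 * real k * \<eta> \<le> \<epsilon> / 2"
  proof -
    have "\<eta> \<le> \<epsilon> / (16 * real k)" by (simp add: \<eta>_def)
    then show "8 * real k * \<eta> \<le> \<epsilon> / 2" using k by (simp add: field_simps)
  qed (use \<epsilon> k in \<open>auto simp: \<eta>_def\<close>)
  obtain n where n: "2 * (4 * real k + 1) \<le> decay_rate p (Suc n) * \<eta> powr p"
  proof -
    define r where "r = (2 - p) / 2"
    have "0 < r" using p by (simp add: r_def)
    then have "filterlim (\<lambda>n. real (Suc n) powr r) at_top sequentially" by real_asymp
    then have "eventually (\<lambda>n. 2 * (4 * real k + 1) / \<eta> powr p * sobolev_const p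
        \<le> real (Suc n) powr r) sequentially"
      by (simp add: filterlim_at_top)
    then obtain n where "2 * (4 * real k + 1) / \<eta> powr p * sobolev_const p \<le> real (Suc n) powr r"
      by (auto simp: eventually_sequentially)
    then have "2 * (4 * real k + 1) \<le> decay_rate p (Suc n) * \<eta> powr p"
      using sobolev_const_pos[OF p] eta by (simp add: decay_rate_def r_def field_simps)
    then show thesis by (rule that)
  qed
  define C where "C = real (short_contours n)"
  have C: "1 \<le> C"
  proof -
    have "(128::nat) ^ 0 \<le> short_contours n"
      unfolding short_contours_def by (rule member_le_sum) auto
    then show ?thesis by (simp add: C_def)
  qed
  have "eventually (\<lambda>h. (real k * ln C) * h + ln 2 \<le> (\<beta> * \<epsilon> / 2) * h powr p
      \<and> 0 * h + ln (2 * real k) \<le> \<beta> * h powr p) at_top"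
    by (intro eventually_conj eventually_linear_le_powr) (use p b0 \<epsilon> in auto)
  then obtain h0 where h0: "1 \<le> h0"
    "\<And>h. h0 \<le> h \<Longrightarrow> (real k * ln C) * real_of_int h + ln 2 \<le> (\<beta> * \<epsilon> / 2) * real_of_int h powr p
      \<and> 0 * real_of_int h + ln (2 * real k) \<le> \<beta> * real_of_int h powr p"
    by (rule obtain_int_threshold) blast
  show ?thesis
  proof (intro exI[of _ h0] allI impI)
    fix h :: int and A :: "vertex set"
    assume h: "h0 \<le> h" and "finite A \<and> card A = k"
    then have A: "finite A" "card A = k" by auto
    define E where "E = cap_energy p A"
    have E: "0 \<le> E" "E \<le> 4 * real k" using p_potential_facts(5,6)[OF p A(1)] A(2) by (auto simp: E_def)
    define H where "H = real_of_int h"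
    have H: "1 \<le> H" using h h0(1) by (simp add: H_def)
    define m where "m = \<lfloor>\<eta> * H\<rfloor>"
    have etaH: "0 < \<eta> * H" "\<eta> * H \<le> H / 2" using eta H by auto
    have m0: "0 \<le> m" using etaH(1) by (simp add: m_def)
    have mreal: "real_of_int m \<le> \<eta> * H" "\<eta> * H \<le> real_of_int (m + 1)"
      unfolding m_def by linarith+
    have mh: "m < h" using mreal(1) etaH H unfolding H_def by linarith
    have num: "(real k * ln C) * H + ln 2 \<le> (\<beta> * \<epsilon> / 2) * H powr p" "ln (2 * real k) \<le> \<beta> * H powr p"
      using h0(2)[OF h] by (simp_all add: H_def)
    have T1: "C ^ (nat (h - m) * k) * exp (- \<beta> * (E * real_of_int (h - m) powr p))
        \<le> exp (- \<beta> * (E - \<epsilon>) * H powr p) / 2"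
    proof -
      have "C ^ (nat (h - m) * k) = exp (real (nat (h - m) * k) * ln C)"
        unfolding exp_of_nat_mult using C by simp
      moreover have "real (nat (h - m) * k) * ln C \<le> (H * real k) * ln C"
        using m0 mh C by (intro mult_right_mono) (auto simp: H_def mult_right_mono)
      moreover have "(E - \<epsilon> / 2) * H powr p \<le> E * real_of_int (h - m) powr p"
      proof -
        have "1 - 2 * \<eta> \<le> (1 - \<eta>) ^ 2" by (simp add: power2_eq_square algebra_simps)
        also have "\<dots> = (1 - \<eta>) powr 2" using eta by simp
        also have "\<dots> \<le> (1 - \<eta>) powr p" by (rule powr_mono') (use p eta in auto)
        finally have "E * (1 - 2 * \<eta>) \<le> E * (1 - \<eta>) powr p" using E by (intro mult_left_mono)
        moreover have "E * (2 * \<eta>) \<le> 4 * real k * (2 * \<eta>)" using E eta by (intro mult_right_mono) auto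
        ultimately have "E - \<epsilon> / 2 \<le> E * (1 - \<eta>) powr p" using eta(3) by (simp add: algebra_simps)
        then have "(E - \<epsilon> / 2) * H powr p \<le> E * (1 - \<eta>) powr p * H powr p"
          by (intro mult_right_mono) auto
        also have "\<dots> = E * ((1 - \<eta>) * H) powr p" by (simp add: powr_mult)
        also have "\<dots> \<le> E * real_of_int (h - m) powr p"
          using mreal(1) eta H p E by (intro mult_left_mono powr_mono2) (auto simp: H_def algebra_simps)
        finally show ?thesis .
      qed
      then have "\<beta> * ((E - \<epsilon> / 2) * H powr p) \<le> \<beta> * (E * real_of_int (h - m) powr p)"
        using b0 by (intro mult_left_mono) auto
      ultimately have "C ^ (nat (h - m) * k) * exp (- \<beta> * (E * real_of_int (h - m) powr p))
          \<le> exp (- \<beta> * (E - \<epsilon>) * H powr p - ln 2)"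
        using num(1) by (simp add: mult_exp_exp algebra_simps)
      then show ?thesis by (simp add: exp_diff)
    qed
    have T2: "real k * exp (- (\<beta> / 2) * (decay_rate p (Suc n) * real_of_int (m + 1) powr p))
        \<le> exp (- \<beta> * (E - \<epsilon>) * H powr p) / 2"
    proof -
      have dec: "0 \<le> decay_rate p (Suc n)"
        using sobolev_const_pos[OF p] by (simp add: decay_rate_def)
      have "2 * (4 * real k + 1) * H powr p \<le> decay_rate p (Suc n) * \<eta> powr p * H powr p"
        by (rule mult_right_mono[OF n]) simp
      also have "\<dots> = decay_rate p (Suc n) * (\<eta> * H) powr p" by (simp add: powr_mult)
      also have "\<dots> \<le> decay_rate p (Suc n) * real_of_int (m + 1) powr p"
        using mreal(2) etaH(1) p dec by (intro mult_left_mono powr_mono2) auto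
      finally have "(\<beta> / 2) * (2 * (4 * real k + 1) * H powr p)
          \<le> (\<beta> / 2) * (decay_rate p (Suc n) * real_of_int (m + 1) powr p)"
        using b0 by (intro mult_left_mono) auto
      moreover have "\<beta> * ((E - \<epsilon>) * H powr p) \<le> \<beta> * (4 * real k * H powr p)"
        using E \<epsilon> b0 by (intro mult_left_mono mult_right_mono) auto
      moreover have "ln (2 * real k) = ln 2 + ln (real k)" using k by (simp add: ln_mult)
      ultimately have le: "ln (real k) - (\<beta> / 2) * (decay_rate p (Suc n) * real_of_int (m + 1) powr p)
          \<le> - \<beta> * (E - \<epsilon>) * H powr p - ln 2"
        using num(2) by (simp add: algebra_simps)
      have "real k * exp (- X) \<le> exp Y / 2" if "ln (real k) - X \<le> Y - ln 2" for X Y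
      proof -
        have "exp (ln (real k) + - X) \<le> exp (Y - ln 2)" using that by simp
        moreover have "exp (ln (real k) + - X) = real k * exp (- X)"
          unfolding exp_add using k by simp
        moreover have "exp (Y - ln 2) = exp Y / 2" by (simp add: exp_diff)
        ultimately show ?thesis by simp
      qed
      from this[OF le] show ?thesis by (simp only: mult_minus_left)
    qed
    have "measure \<mu> {\<phi>. \<forall>x\<in>A. \<phi> x \<in> {h..}} \<le> exp (- \<beta> * (E - \<epsilon>) * H powr p)"
    proof (rule cylinder_upper[OF mu A(1)])
      fix M assume fin: "finite_measure (gibbs p \<beta> M)"
      have "measure (gibbs p \<beta> M) {\<phi> \<in> configs M. \<forall>x\<in>A. h \<le> \<phi> x}
          \<le> (C ^ (nat (h - m) * k) * exp (- \<beta> * (E * real_of_int (h - m) powr p))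
            + real k * exp (- (\<beta> / 2) * (decay_rate p (Suc n) * real_of_int (m + 1) powr p)))
            * mass p \<beta> M"
        using finite_volume_upper_bound[OF fin p b A(1) m0 mh, of n] by (simp only: C_def E_def A(2))
      also have "\<dots> \<le> (exp (- \<beta> * (E - \<epsilon>) * H powr p) / 2 + exp (- \<beta> * (E - \<epsilon>) * H powr p) / 2)
            * mass p \<beta> M"
        by (intro mult_right_mono add_mono T1 T2 mass_nonneg)
      finally show "measure (gibbs p \<beta> M) {\<phi> \<in> configs M. \<forall>x\<in>A. \<phi> x \<in> {h..}}
          \<le> exp (- \<beta> * (E - \<epsilon>) * H powr p) * mass p \<beta> M" by simp
    qed
    then show "measure \<mu> {\<phi>. \<forall>x\<in>A. h \<le> \<phi> x}
        \<le> exp (- \<beta> * (cap_energy p A - \<epsilon>) * real_of_int h powr p)"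
      by (simp add: E_def H_def)
  qed
qed

text \<open>The cut-off \<open>d\<close> is taken so small that truncation and rounding multiply the energy by a factor
  \<open>R\<close> with \<open>(R - 1) 4 k\<close> below \<open>\<epsilon> / 2\<close>.\<close>

lemma infinite_volume_lower:
  assumes mu: "is_infinite_volume p \<beta> \<mu>" and p: "1 < p" "p < 2" and b: "2 * ln 256 \<le> \<beta>"
    and \<epsilon>: "0 < \<epsilon>"
  shows "\<exists>h0 :: int. \<forall>h\<ge>h0. \<forall>A. finite A \<and> card A = k \<longrightarrow>
    exp (- \<beta> * (cap_energy p A + \<epsilon>) * real_of_int h powr p) \<le> measure \<mu> {\<phi>. \<forall>x\<in>A. \<phi> x = h}"
proof -
  have b0: "0 < \<beta>" using b ln_gt_zero[of 256] by linarith
  obtain d :: real where d: "0 < d" "d < 1" "4 * real k * ((1 - d) powr (1 - 2 * p) - 1) < \<epsilon> / 2"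
  proof -
    have "((\<lambda>d::real. 4 * real k * ((1 - d) powr (1 - 2 * p) - 1))
        \<longlongrightarrow> 4 * real k * ((1 - 0) powr (1 - 2 * p) - 1)) (at_right 0)"
      by (intro tendsto_intros) auto
    then have "eventually (\<lambda>d::real. 4 * real k * ((1 - d) powr (1 - 2 * p) - 1) < \<epsilon> / 2) (at_right 0)"
      by (rule order_tendstoD) (use \<epsilon> in simp)
    then have "eventually (\<lambda>d::real. 4 * real k * ((1 - d) powr (1 - 2 * p) - 1) < \<epsilon> / 2
        \<and> d \<in> {0<..<1}) (at_right 0)"
      using eventually_at_right_real[OF zero_less_one] by (rule eventually_conj)
    then show thesis
      using eventually_happens'[OF trivial_limit_at_right_real] that by auto
  qed
  define R where "R = (1 - d) powr (1 - 2 * p)"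
  have R: "1 \<le> R" unfolding R_def using powr_mono'[of "1 - 2 * p" 0 "1 - d"] d p by simp
  obtain c D where c: "0 < c" and low: "\<And>A (h::int). finite A \<and> card A = k \<and> 1 \<le> h \<Longrightarrow>
      (\<exists>M0. \<forall>M\<ge>M0. finite_measure (gibbs p \<beta> M) \<longrightarrow>
        c * exp (- \<beta> * (R * cap_energy p A * real_of_int h powr p + D)) * mass p \<beta> M
        \<le> measure (gibbs p \<beta> M) {\<phi> \<in> configs M. \<forall>x\<in>A. \<phi> x = h})"
    using finite_volume_lower_bound[OF p b d(1,2), of k] unfolding R_def by blast
  have "eventually (\<lambda>h. 0 * h + (\<beta> * D - ln c) \<le> (\<beta> * \<epsilon> / 2) * h powr p) at_top"
    by (intro eventually_linear_le_powr) (use p b0 \<epsilon> in auto)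
  then obtain h0 where h0: "1 \<le> h0"
    "\<And>h. h0 \<le> h \<Longrightarrow> 0 * real_of_int h + (\<beta> * D - ln c) \<le> (\<beta> * \<epsilon> / 2) * real_of_int h powr p"
    by (rule obtain_int_threshold) blast
  show ?thesis
  proof (intro exI[of _ h0] allI impI)
    fix h :: int and A :: "vertex set"
    assume h: "h0 \<le> h" and A: "finite A \<and> card A = k"
    define E where "E = cap_energy p A"
    have E: "0 \<le> E" "E \<le> 4 * real k" using p_potential_facts(5,6)[OF p] A by (auto simp: E_def)
    define H where "H = real_of_int h"
    have "(R - 1) * E \<le> (R - 1) * (4 * real k)" using R E by (intro mult_left_mono) auto
    then have "(R - 1) * E \<le> \<epsilon> / 2" using d(3) by (simp add: R_def mult.commute)
    then have "R * E \<le> E + \<epsilon> / 2" by (simp add: algebra_simps)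
    then have "\<beta> * (R * E * H powr p) \<le> \<beta> * ((E + \<epsilon> / 2) * H powr p)"
      using b0 by (intro mult_left_mono mult_right_mono) auto
    moreover have "\<beta> * D - ln c \<le> (\<beta> * \<epsilon> / 2) * H powr p" using h0(2)[OF h] by (simp add: H_def)
    ultimately have "- \<beta> * (E + \<epsilon>) * H powr p \<le> ln c - \<beta> * (R * E * H powr p + D)"
      by (simp add: algebra_simps)
    then have "exp (- \<beta> * (E + \<epsilon>) * H powr p) \<le> exp (ln c + - \<beta> * (R * E * H powr p + D))"
      by simp
    also have "\<dots> = c * exp (- \<beta> * (R * E * H powr p + D))" using c by (simp only: exp_add exp_ln)
    also have "\<dots> \<le> measure \<mu> {\<phi>. \<forall>x\<in>A. \<phi> x \<in> {h}}"
    proof -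
      obtain M0 where M0: "\<And>M. M0 \<le> M \<Longrightarrow> finite_measure (gibbs p \<beta> M) \<Longrightarrow>
        c * exp (- \<beta> * (R * E * H powr p + D)) * mass p \<beta> M
        \<le> measure (gibbs p \<beta> M) {\<phi> \<in> configs M. \<forall>x\<in>A. \<phi> x = h}"
        using low[of A h] A h h0(1) unfolding E_def H_def by auto
      show ?thesis
        by (rule cylinder_lower[OF mu, where ?M0.0 = M0]) (use A M0 in simp_all)
    qed
    finally show "exp (- \<beta> * (cap_energy p A + \<epsilon>) * real_of_int h powr p)
        \<le> measure \<mu> {\<phi>. \<forall>x\<in>A. \<phi> x = h}"
      by (simp add: E_def H_def)
  qed
qed

theorem lemma8p11:
  fixes p :: real
  assumes "1 < p" and "p < 2"
  shows "\<exists>\<beta>0 :: real. \<forall>\<beta> \<ge> \<beta>0. \<forall>\<mu>. is_infinite_volume p \<beta> \<mu> \<longrightarrow>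
    (\<forall>(k :: nat) \<ge> 1. \<forall>\<epsilon> > 0. \<exists>h0 :: int. \<forall>h \<ge> h0. \<forall>A :: vertex set. finite A \<and> card A = k \<longrightarrow>
      (let E = enn2real (energy p (p_potential p A));
           lower = exp (- \<beta> * (E + \<epsilon>) * real_of_int h powr p);
           upper = exp (- \<beta> * (E - \<epsilon>) * real_of_int h powr p)
       in measure \<mu> {\<phi>. \<forall>x\<in>A. \<phi> x = h} \<in> {lower..upper} \<and>
          measure \<mu> {\<phi>. \<forall>x\<in>A. \<phi> x \<ge> h} \<in> {lower..upper}))"
proof (intro exI[of _ "2 * ln 256"] allI impI)
  fix \<beta> :: real and \<mu> :: "(vertex \<Rightarrow> int) measure" and k :: nat and \<epsilon> :: real
  assume b: "2 * ln 256 \<le> \<beta>" and mu: "is_infinite_volume p \<beta> \<mu>" and k: "1 \<le> k" and \<epsilon>: "0 < \<epsilon>"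
  obtain h1 :: int where h1: "\<And>h A. h1 \<le> h \<Longrightarrow> finite A \<and> card A = k \<Longrightarrow>
      measure \<mu> {\<phi>. \<forall>x\<in>A. h \<le> \<phi> x} \<le> exp (- \<beta> * (cap_energy p A - \<epsilon>) * real_of_int h powr p)"
    using infinite_volume_upper[OF mu assms b k \<epsilon>] by blast
  obtain h2 :: int where h2: "\<And>h A. h2 \<le> h \<Longrightarrow> finite A \<and> card A = k \<Longrightarrow>
      exp (- \<beta> * (cap_energy p A + \<epsilon>) * real_of_int h powr p) \<le> measure \<mu> {\<phi>. \<forall>x\<in>A. \<phi> x = h}"
    using infinite_volume_lower[OF mu assms b \<epsilon>, of k] by blast
  interpret prob_space \<mu> using mu by (simp add: is_infinite_volume_def)
  have sets: "sets \<mu> = sets borel" using mu by (simp add: is_infinite_volume_def)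
  show "\<exists>h0 :: int. \<forall>h \<ge> h0. \<forall>A :: vertex set. finite A \<and> card A = k \<longrightarrow>
      (let E = enn2real (energy p (p_potential p A));
           lower = exp (- \<beta> * (E + \<epsilon>) * real_of_int h powr p);
           upper = exp (- \<beta> * (E - \<epsilon>) * real_of_int h powr p)
       in measure \<mu> {\<phi>. \<forall>x\<in>A. \<phi> x = h} \<in> {lower..upper} \<and>
          measure \<mu> {\<phi>. \<forall>x\<in>A. \<phi> x \<ge> h} \<in> {lower..upper})"
  proof (intro exI[of _ "max h1 h2"] allI impI)
    fix h :: int and A :: "vertex set"
    assume h: "max h1 h2 \<le> h" and A: "finite A \<and> card A = k"
    have "{\<phi> :: vertex \<Rightarrow> int. \<forall>x\<in>A. h \<le> \<phi> x} \<in> sets \<mu>"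
      using borel_open[OF open_cylinder[of A "{h..}"]] A by (simp add: sets)
    then have "measure \<mu> {\<phi>. \<forall>x\<in>A. \<phi> x = h} \<le> measure \<mu> {\<phi>. \<forall>x\<in>A. h \<le> \<phi> x}"
      by (intro finite_measure_mono) auto
    then show "let E = enn2real (energy p (p_potential p A));
           lower = exp (- \<beta> * (E + \<epsilon>) * real_of_int h powr p);
           upper = exp (- \<beta> * (E - \<epsilon>) * real_of_int h powr p)
       in measure \<mu> {\<phi>. \<forall>x\<in>A. \<phi> x = h} \<in> {lower..upper} \<and>
          measure \<mu> {\<phi>. \<forall>x\<in>A. \<phi> x \<ge> h} \<in> {lower..upper}"
      unfolding Let_def cap_energy_def[symmetric]
      using h1[of h A] h2[of h A] h A by auto
  qed
qed

end
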